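(* For permutative categories $A$, $B$, and $C$, there is an adjoint equivalence $$W\colon\mathrm{PermCat}(A\otimes B,C)\rightleftarrows\mathrm{PermCat}(A,\mathrm{PermCat}(B,C))\colon W^\bullet$$ with the following properties. (i) The functor $W\colon\mathrm{PermCat}(A\otimes B,C)\to\mathrm{PermCat}(A,\mathrm{PermCat}(B,C))$ is 2-natural with respect to symmetric monoidal functors in $A$, $B$, and $C$ and is strict symmetric monoidal with respect to the pointwise structures. (ii) The functor $W^\bullet\colon\mathrm{PermCat}(A,\mathrm{PermCat}(B,C))\to\mathrm{PermCat}(A\otimes B,C)$ is 2-natural with respect to symmetric monoidal functors in $A$ and $B$, is 2-natural with respect to strict symmetric monoidal functors and pseudonatural with respect to symmetric monoidal functors in $C$, and is symmetric monoidal with respect to the pointwise structures.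
   Context: **Permutative categories.** A permutative category $C=(C,+,0,\beta)$ is a strict monoidal category $(C,+,0)$ with a natural isomorphism $\beta_{x,y}\colon x+y\to y+x$ such that $\beta_{y,x}\beta_{x,y}=1$ and $\beta_{x,y+z}=(1_y+\beta_{x,z})\circ(\beta_{x,y}+1_z)$. A symmetric monoidal functor $F\colon C\to C'$ (always in the strong sense) is a functor with a natural isomorphism $F_2\colon Fx+Fy\to F(x+y)$ and an isomorphism $F_0\colon 0\to F0$ satisfying the usual associativity, unity and symmetry axioms; it is strict if $F_2,F_0$ are identities. A monoidal transformation $\phi\colon F\Rightarrow G$ is a natural transformation with $\phi_{x+y}\circ F_2=G_2\circ(\phi_x+\phi_y)$ and $\phi_0\circ F_0=G_0$. $\mathrm{PermCat}$ is the 2-category of permutative categories, symmetric monoidal functors and monoidal transformations. **Pointwise structure.** $\mathrm{PermCat}(A,B)$ is a permutative category pointwise: $(F+F')(a)=Fa+F'a$, $(F+F')_2=(F_2+F'_2)\circ(1+\beta+1)$, $(F+F')_0=F_0+F'_0$, $(\phi+\phi')_a=\phi_a+\phi'_a$; the unit is the constant functor at $0$ and the symmetry is that of $B$ pointwise. **Tensor product of objects.** For permutative categories $A,B$, start with the free strict monoidal category $\coprod_{n\ge 0}(A\times B)^n$ on $A\times B$, writing objects as finite formal sums $\sum a_i.b_i$ (the empty sum is $0$) and morphisms of $A\times B$ as $f.g$. Freely adjoin (in strict monoidal categories) isomorphisms $\delta^L_a(b,b')\colon a.b+a.b'\to a.(b+b')$, $\delta^R_b(a,a')\colon a.b+a'.b\to(a+a').b$,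 $\beta_{a.b,a'.b'}\colon a.b+a'.b'\to a'.b'+a.b$, $\zeta^L_a\colon 0\to a.0$, $\zeta^R_b\colon 0\to 0.b$ for all $a,a'\in A$, $b,b'\in B$. Impose the relations: (1) all of these are natural in every variable; (2) $\beta$ together with $+,0$ gives a permutative structure; (3) each $a.(-)$ is a symmetric monoidal functor with constraints $\delta^L_a,\zeta^L_a$ and each $(-).b$ is a symmetric monoidal functor with constraints $\delta^R_b,\zeta^R_b$; (4) $\delta^L_{a+a'}\circ(\delta^R_b+\delta^R_{b'})=\delta^R_{b+b'}\circ(\delta^L_a+\delta^L_{a'})\circ(1+\beta+1)$ as morphisms $a.b+a'.b+a.b'+a'.b'\to(a+a').(b+b')$; (5) $\zeta^L_0=\zeta^R_0\colon 0\to 0.0$; (6) $\delta^R_0(a,a')\circ(\zeta^L_a+\zeta^L_{a'})=\zeta^L_{a+a'}$ and $\delta^L_0(b,b')\circ(\zeta^R_b+\zeta^R_{b'})=\zeta^R_{b+b'}$. The result is the permutative category $A\otimes B$. **Tensor product of 1- and 2-cells.** For symmetric monoidal functors $F\colon A\to A'$, $G\colon B\to B'$, the strict symmetric monoidal functor $F\otimes G$ is given by $a.b\mapsto Fa.Gb$, $f.g\mapsto Ff.Gg$, $\delta^L_a\mapsto(1.G_2)\circ\delta^L_{Fa}$, $\delta^R_b\mapsto(F_2.1)\circ\delta^R_{Gb}$, $\beta\mapsto\beta$, $\zeta^L_a\mapsto(1.G_0)\circ\zeta^L_{Fa}$, $\zeta^R_b\mapsto(F_0.1)\circ\zeta^R_{Gb}$.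 For monoidal transformations, $(\phi\otimes\psi)_{\sum a_i.b_i}=\sum\phi_{a_i}.\psi_{b_i}$ and $(\phi\otimes\psi)_0=1_0$. *)

theory Defs
  imports Main "HOL-Library.FuncSet"
begin

section \<open>Categories, functors, natural isomorphisms\<close>

record ('o, 'm) cat =
  Obj :: "'o set"
  Arr :: "'m set"
  Dom :: "'m \<Rightarrow> 'o"
  Cod :: "'m \<Rightarrow> 'o"
  Ident :: "'o \<Rightarrow> 'm"  ("\<one>\<index>")
  Cmp :: "'m \<Rightarrow> 'm \<Rightarrow> 'm"  (infixr "\<cdot>\<index>" 70)

definition Hom :: "('o, 'm, 'z) cat_scheme \<Rightarrow> 'o \<Rightarrow> 'o \<Rightarrow> 'm set" where
  "Hom C x y = {f \<in> Arr C. Dom C f = x \<and> Cod C f = y}"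

locale category =
  fixes C :: "('o, 'm, 'z) cat_scheme" (structure)
  assumes Dom_in: "f \<in> Arr C \<Longrightarrow> Dom C f \<in> Obj C"
    and Cod_in: "f \<in> Arr C \<Longrightarrow> Cod C f \<in> Obj C"
    and Ident_in: "x \<in> Obj C \<Longrightarrow> \<one> x \<in> Hom C x x"
    and Cmp_in: "\<lbrakk>f \<in> Hom C x y; g \<in> Hom C y z\<rbrakk> \<Longrightarrow> g \<cdot> f \<in> Hom C x z"
    and Cmp_assoc: "\<lbrakk>f \<in> Hom C w x; g \<in> Hom C x y; h \<in> Hom C y z\<rbrakk>
      \<Longrightarrow> h \<cdot> (g \<cdot> f) = (h \<cdot> g) \<cdot> f"
    and Cmp_Ident_left: "f \<in> Hom C x y \<Longrightarrow> \<one> y \<cdot> f = f"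
    and Cmp_Ident_right: "f \<in> Hom C x y \<Longrightarrow> f \<cdot> \<one> x = f"

definition inverse_arrows :: "('o, 'm, 'z) cat_scheme \<Rightarrow> 'm \<Rightarrow> 'm \<Rightarrow> bool" where
  "inverse_arrows C f g \<longleftrightarrow> f \<in> Arr C \<and> g \<in> Hom C (Cod C f) (Dom C f)
     \<and> g \<cdot>\<^bsub>C\<^esub> f = \<one>\<^bsub>C\<^esub> (Dom C f) \<and> f \<cdot>\<^bsub>C\<^esub> g = \<one>\<^bsub>C\<^esub> (Cod C f)"

definition iso :: "('o, 'm, 'z) cat_scheme \<Rightarrow> 'm \<Rightarrow> bool" where
  "iso C f \<longleftrightarrow> (\<exists>g. inverse_arrows C f g)"

definition inv_arr :: "('o, 'm, 'z) cat_scheme \<Rightarrow> 'm \<Rightarrow> 'm" where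
  "inv_arr C f = (THE g. inverse_arrows C f g)"

record ('o1, 'm1, 'o2, 'm2) func =
  fo :: "'o1 \<Rightarrow> 'o2"
  fm :: "'m1 \<Rightarrow> 'm2"

locale is_functor =
  X: category X + Y: category Y
  for X :: "('o1, 'm1, 'z1) cat_scheme"
    and Y :: "('o2, 'm2, 'z2) cat_scheme"
    and F :: "('o1, 'm1, 'o2, 'm2, 'z3) func_scheme" +
  assumes fo_in: "x \<in> Obj X \<Longrightarrow> fo F x \<in> Obj Y"
    and fm_in: "f \<in> Hom X x y \<Longrightarrow> fm F f \<in> Hom Y (fo F x) (fo F y)"
    and fm_Ident: "x \<in> Obj X \<Longrightarrow> fm F (\<one>\<^bsub>X\<^esub> x) = \<one>\<^bsub>Y\<^esub> (fo F x)"
    and fm_Cmp: "\<lbrakk>f \<in> Hom X x y; g \<in> Hom X y z\<rbrakk>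
      \<Longrightarrow> fm F (g \<cdot>\<^bsub>X\<^esub> f) = fm F g \<cdot>\<^bsub>Y\<^esub> fm F f"

definition id_func :: "('o, 'm, 'o, 'm) func" where
  "id_func = \<lparr>fo = \<lambda>x. x, fm = \<lambda>f. f\<rparr>"

definition comp_func ::
  "('o2, 'm2, 'o3, 'm3, 'z1) func_scheme \<Rightarrow> ('o1, 'm1, 'o2, 'm2, 'z2) func_scheme
    \<Rightarrow> ('o1, 'm1, 'o3, 'm3) func"  (infixr "\<circ>\<^sub>F" 65) where
  "G \<circ>\<^sub>F F = \<lparr>fo = \<lambda>x. fo G (fo F x), fm = \<lambda>f. fm G (fm F f)\<rparr>"

locale natural_iso =
  F: is_functor X Y F + G: is_functor X Y G
  for X :: "('o1, 'm1, 'z1) cat_scheme"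
    and Y :: "('o2, 'm2, 'z2) cat_scheme"
    and F :: "('o1, 'm1, 'o2, 'm2, 'z3) func_scheme"
    and G :: "('o1, 'm1, 'o2, 'm2, 'z4) func_scheme"
    and \<tau> :: "'o1 \<Rightarrow> 'm2" +
  assumes component_in: "x \<in> Obj X \<Longrightarrow> \<tau> x \<in> Hom Y (fo F x) (fo G x)"
    and component_iso: "x \<in> Obj X \<Longrightarrow> iso Y (\<tau> x)"
    and naturality: "f \<in> Hom X x y \<Longrightarrow> \<tau> y \<cdot>\<^bsub>Y\<^esub> fm F f = fm G f \<cdot>\<^bsub>Y\<^esub> \<tau> x"

locale adjoint_equivalence =
  L: is_functor X Y L + R: is_functor Y X R +
  unit: natural_iso X X id_func "R \<circ>\<^sub>F L" \<eta> +
  counit: natural_iso Y Y "L \<circ>\<^sub>F R" id_func \<epsilon>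
  for X :: "('o1, 'm1, 'z1) cat_scheme"
    and Y :: "('o2, 'm2, 'z2) cat_scheme"
    and L :: "('o1, 'm1, 'o2, 'm2, 'z3) func_scheme"
    and R :: "('o2, 'm2, 'o1, 'm1, 'z4) func_scheme"
    and \<eta> :: "'o1 \<Rightarrow> 'm1"
    and \<epsilon> :: "'o2 \<Rightarrow> 'm2" +
  assumes triangle_left: "x \<in> Obj X \<Longrightarrow> \<epsilon> (fo L x) \<cdot>\<^bsub>Y\<^esub> fm L (\<eta> x) = \<one>\<^bsub>Y\<^esub> (fo L x)"
    and triangle_right: "y \<in> Obj Y \<Longrightarrow> fm R (\<epsilon> y) \<cdot>\<^bsub>X\<^esub> \<eta> (fo R y) = \<one>\<^bsub>X\<^esub> (fo R y)"


section \<open>Permutative categories\<close>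

record ('o, 'm) pcat = "('o, 'm) cat" +
  Osum :: "'o \<Rightarrow> 'o \<Rightarrow> 'o"  (infixl "\<oplus>\<index>" 65)
  Asum :: "'m \<Rightarrow> 'm \<Rightarrow> 'm"  (infixl "\<boxplus>\<index>" 65)
  Zero :: "'o"  ("\<zero>\<index>")
  Sym :: "'o \<Rightarrow> 'o \<Rightarrow> 'm"  ("\<beta>\<index>")

abbreviation underlying_cat :: "('o, 'm) pcat \<Rightarrow> ('o, 'm) cat" where
  "underlying_cat \<equiv> cat.truncate"

locale permutative = category C for C :: "('o, 'm) pcat" (structure) +
  assumes Osum_in: "\<lbrakk>x \<in> Obj C; y \<in> Obj C\<rbrakk> \<Longrightarrow> x \<oplus> y \<in> Obj C"
    and Zero_in: "\<zero> \<in> Obj C"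
    and Asum_in: "\<lbrakk>f \<in> Hom C x y; g \<in> Hom C x' y'\<rbrakk>
      \<Longrightarrow> f \<boxplus> g \<in> Hom C (x \<oplus> x') (y \<oplus> y')"
    and Asum_Ident: "\<lbrakk>x \<in> Obj C; y \<in> Obj C\<rbrakk> \<Longrightarrow> \<one> x \<boxplus> \<one> y = \<one> (x \<oplus> y)"
    and Asum_Cmp: "\<lbrakk>f \<in> Hom C x y; g \<in> Hom C y z; f' \<in> Hom C x' y'; g' \<in> Hom C y' z'\<rbrakk>
      \<Longrightarrow> (g \<cdot> f) \<boxplus> (g' \<cdot> f') = (g \<boxplus> g') \<cdot> (f \<boxplus> f')"
    and Osum_assoc: "\<lbrakk>x \<in> Obj C; y \<in> Obj C; z \<in> Obj C\<rbrakk>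
      \<Longrightarrow> (x \<oplus> y) \<oplus> z = x \<oplus> (y \<oplus> z)"
    and Osum_Zero_left: "x \<in> Obj C \<Longrightarrow> \<zero> \<oplus> x = x"
    and Osum_Zero_right: "x \<in> Obj C \<Longrightarrow> x \<oplus> \<zero> = x"
    and Asum_assoc: "\<lbrakk>f \<in> Arr C; g \<in> Arr C; h \<in> Arr C\<rbrakk>
      \<Longrightarrow> (f \<boxplus> g) \<boxplus> h = f \<boxplus> (g \<boxplus> h)"
    and Asum_Zero_left: "f \<in> Arr C \<Longrightarrow> \<one> \<zero> \<boxplus> f = f"
    and Asum_Zero_right: "f \<in> Arr C \<Longrightarrow> f \<boxplus> \<one> \<zero> = f"
    and Sym_in: "\<lbrakk>x \<in> Obj C; y \<in> Obj C\<rbrakk> \<Longrightarrow> \<beta> x y \<in> Hom C (x \<oplus> y) (y \<oplus> x)"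
    and Sym_natural: "\<lbrakk>f \<in> Hom C x x'; g \<in> Hom C y y'\<rbrakk>
      \<Longrightarrow> \<beta> x' y' \<cdot> (f \<boxplus> g) = (g \<boxplus> f) \<cdot> \<beta> x y"
    and Sym_Sym: "\<lbrakk>x \<in> Obj C; y \<in> Obj C\<rbrakk> \<Longrightarrow> \<beta> y x \<cdot> \<beta> x y = \<one> (x \<oplus> y)"
    and Sym_Osum: "\<lbrakk>x \<in> Obj C; y \<in> Obj C; z \<in> Obj C\<rbrakk>
      \<Longrightarrow> \<beta> x (y \<oplus> z) = (\<one> y \<boxplus> \<beta> x z) \<cdot> (\<beta> x y \<boxplus> \<one> z)"


section \<open>Symmetric monoidal functors and monoidal transformations\<close>

record ('o1, 'm1, 'o2, 'm2) smf = "('o1, 'm1, 'o2, 'm2) func" +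
  fc2 :: "'o1 \<Rightarrow> 'o1 \<Rightarrow> 'm2"
  fc0 :: "'m2"

abbreviation underlying_func ::
  "('o1, 'm1, 'o2, 'm2) smf \<Rightarrow> ('o1, 'm1, 'o2, 'm2) func" where
  "underlying_func \<equiv> func.truncate"

text \<open>
  Symmetric monoidal functors and monoidal transformations are themselves the objects and arrows
  of hom categories, so their equality in HOL has to be the mathematical equality.  The total
  functions in the records are therefore required to be \<^const>\<open>undefined\<close> off the carriers, and
  \<open>smf_restrict\<close> enforces this.
\<close>

definition smf_restrict ::
  "('o1, 'm1) pcat \<Rightarrow> ('o1, 'm1, 'o2, 'm2) smf \<Rightarrow> ('o1, 'm1, 'o2, 'm2) smf" where
  "smf_restrict A F = \<lparr>fo = restrict (fo F) (Obj A), fm = restrict (fm F) (Arr A),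
     fc2 = (\<lambda>x y. if x \<in> Obj A \<and> y \<in> Obj A then fc2 F x y else undefined), fc0 = fc0 F\<rparr>"

locale sym_mon_functor =
  A: permutative A + B: permutative B + is_functor A B F
  for A :: "('o1, 'm1) pcat"
    and B :: "('o2, 'm2) pcat"
    and F :: "('o1, 'm1, 'o2, 'm2) smf" +
  assumes fc2_in: "\<lbrakk>x \<in> Obj A; y \<in> Obj A\<rbrakk>
      \<Longrightarrow> fc2 F x y \<in> Hom B (fo F x \<oplus>\<^bsub>B\<^esub> fo F y) (fo F (x \<oplus>\<^bsub>A\<^esub> y))"
    and fc2_iso: "\<lbrakk>x \<in> Obj A; y \<in> Obj A\<rbrakk> \<Longrightarrow> iso B (fc2 F x y)"
    and fc2_natural: "\<lbrakk>f \<in> Hom A x x'; g \<in> Hom A y y'\<rbrakk>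
      \<Longrightarrow> fc2 F x' y' \<cdot>\<^bsub>B\<^esub> (fm F f \<boxplus>\<^bsub>B\<^esub> fm F g) = fm F (f \<boxplus>\<^bsub>A\<^esub> g) \<cdot>\<^bsub>B\<^esub> fc2 F x y"
    and fc0_in: "fc0 F \<in> Hom B \<zero>\<^bsub>B\<^esub> (fo F \<zero>\<^bsub>A\<^esub>)"
    and fc0_iso: "iso B (fc0 F)"
    and fc2_assoc: "\<lbrakk>x \<in> Obj A; y \<in> Obj A; z \<in> Obj A\<rbrakk>
      \<Longrightarrow> fc2 F (x \<oplus>\<^bsub>A\<^esub> y) z \<cdot>\<^bsub>B\<^esub> (fc2 F x y \<boxplus>\<^bsub>B\<^esub> \<one>\<^bsub>B\<^esub> (fo F z))
        = fc2 F x (y \<oplus>\<^bsub>A\<^esub> z) \<cdot>\<^bsub>B\<^esub> (\<one>\<^bsub>B\<^esub> (fo F x) \<boxplus>\<^bsub>B\<^esub> fc2 F y z)"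
    and fc2_unit_left: "x \<in> Obj A
      \<Longrightarrow> fc2 F \<zero>\<^bsub>A\<^esub> x \<cdot>\<^bsub>B\<^esub> (fc0 F \<boxplus>\<^bsub>B\<^esub> \<one>\<^bsub>B\<^esub> (fo F x)) = \<one>\<^bsub>B\<^esub> (fo F x)"
    and fc2_unit_right: "x \<in> Obj A
      \<Longrightarrow> fc2 F x \<zero>\<^bsub>A\<^esub> \<cdot>\<^bsub>B\<^esub> (\<one>\<^bsub>B\<^esub> (fo F x) \<boxplus>\<^bsub>B\<^esub> fc0 F) = \<one>\<^bsub>B\<^esub> (fo F x)"
    and fc2_symmetry: "\<lbrakk>x \<in> Obj A; y \<in> Obj A\<rbrakk>
      \<Longrightarrow> fm F (\<beta>\<^bsub>A\<^esub> x y) \<cdot>\<^bsub>B\<^esub> fc2 F x y = fc2 F y x \<cdot>\<^bsub>B\<^esub> \<beta>\<^bsub>B\<^esub> (fo F x) (fo F y)"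
    and extensional: "smf_restrict A F = F"

locale strict_sym_mon_functor = sym_mon_functor +
  assumes fc2_strict: "\<lbrakk>x \<in> Obj A; y \<in> Obj A\<rbrakk> \<Longrightarrow> fc2 F x y = \<one>\<^bsub>B\<^esub> (fo F x \<oplus>\<^bsub>B\<^esub> fo F y)"
    and fc0_strict: "fc0 F = \<one>\<^bsub>B\<^esub> \<zero>\<^bsub>B\<^esub>"

record ('o1, 'm1, 'o2, 'm2) mtrans =
  src :: "('o1, 'm1, 'o2, 'm2) smf"
  tgt :: "('o1, 'm1, 'o2, 'm2) smf"
  cmpt :: "'o1 \<Rightarrow> 'm2"

locale mon_trans =
  F: sym_mon_functor A B "src \<phi>" + G: sym_mon_functor A B "tgt \<phi>"
  for A :: "('o1, 'm1) pcat"
    and B :: "('o2, 'm2) pcat"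
    and \<phi> :: "('o1, 'm1, 'o2, 'm2) mtrans" +
  assumes cmpt_in: "x \<in> Obj A \<Longrightarrow> cmpt \<phi> x \<in> Hom B (fo (src \<phi>) x) (fo (tgt \<phi>) x)"
    and cmpt_natural: "f \<in> Hom A x y
      \<Longrightarrow> cmpt \<phi> y \<cdot>\<^bsub>B\<^esub> fm (src \<phi>) f = fm (tgt \<phi>) f \<cdot>\<^bsub>B\<^esub> cmpt \<phi> x"
    and cmpt_fc2: "\<lbrakk>x \<in> Obj A; y \<in> Obj A\<rbrakk>
      \<Longrightarrow> cmpt \<phi> (x \<oplus>\<^bsub>A\<^esub> y) \<cdot>\<^bsub>B\<^esub> fc2 (src \<phi>) x y
        = fc2 (tgt \<phi>) x y \<cdot>\<^bsub>B\<^esub> (cmpt \<phi> x \<boxplus>\<^bsub>B\<^esub> cmpt \<phi> y)"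
    and cmpt_fc0: "cmpt \<phi> \<zero>\<^bsub>A\<^esub> \<cdot>\<^bsub>B\<^esub> fc0 (src \<phi>) = fc0 (tgt \<phi>)"
    and cmpt_extensional: "cmpt \<phi> \<in> extensional (Obj A)"

definition smf_id :: "('o, 'm) pcat \<Rightarrow> ('o, 'm, 'o, 'm) smf" where
  "smf_id A = smf_restrict A \<lparr>fo = \<lambda>x. x, fm = \<lambda>f. f,
     fc2 = \<lambda>x y. \<one>\<^bsub>A\<^esub> (x \<oplus>\<^bsub>A\<^esub> y), fc0 = \<one>\<^bsub>A\<^esub> \<zero>\<^bsub>A\<^esub>\<rparr>"

text \<open>In \<open>smf_comp A C G F\<close>, \<open>F\<close> starts at \<open>A\<close> and \<open>G\<close> ends at \<open>C\<close>; likewise for the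
  horizontal composite \<open>mt_hcomp A C \<psi> \<phi>\<close>.\<close>

definition smf_comp ::
  "('o1, 'm1) pcat \<Rightarrow> ('o3, 'm3) pcat \<Rightarrow> ('o2, 'm2, 'o3, 'm3) smf \<Rightarrow> ('o1, 'm1, 'o2, 'm2) smf
    \<Rightarrow> ('o1, 'm1, 'o3, 'm3) smf" where
  "smf_comp A C G F = smf_restrict A \<lparr>fo = \<lambda>x. fo G (fo F x), fm = \<lambda>f. fm G (fm F f),
     fc2 = \<lambda>x y. fm G (fc2 F x y) \<cdot>\<^bsub>C\<^esub> fc2 G (fo F x) (fo F y),
     fc0 = fm G (fc0 F) \<cdot>\<^bsub>C\<^esub> fc0 G\<rparr>"

definition mt_id ::
  "('o1, 'm1) pcat \<Rightarrow> ('o2, 'm2) pcat \<Rightarrow> ('o1, 'm1, 'o2, 'm2) smf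
    \<Rightarrow> ('o1, 'm1, 'o2, 'm2) mtrans" where
  "mt_id A B F = \<lparr>src = F, tgt = F, cmpt = \<lambda>x\<in>Obj A. \<one>\<^bsub>B\<^esub> (fo F x)\<rparr>"

definition mt_vcomp ::
  "('o1, 'm1) pcat \<Rightarrow> ('o2, 'm2) pcat \<Rightarrow> ('o1, 'm1, 'o2, 'm2) mtrans
    \<Rightarrow> ('o1, 'm1, 'o2, 'm2) mtrans \<Rightarrow> ('o1, 'm1, 'o2, 'm2) mtrans" where
  "mt_vcomp A B \<psi> \<phi> = \<lparr>src = src \<phi>, tgt = tgt \<psi>,
     cmpt = \<lambda>x\<in>Obj A. cmpt \<psi> x \<cdot>\<^bsub>B\<^esub> cmpt \<phi> x\<rparr>"

definition mt_hcomp ::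
  "('o1, 'm1) pcat \<Rightarrow> ('o3, 'm3) pcat \<Rightarrow> ('o2, 'm2, 'o3, 'm3) mtrans
    \<Rightarrow> ('o1, 'm1, 'o2, 'm2) mtrans \<Rightarrow> ('o1, 'm1, 'o3, 'm3) mtrans" where
  "mt_hcomp A C \<psi> \<phi> = \<lparr>src = smf_comp A C (src \<psi>) (src \<phi>), tgt = smf_comp A C (tgt \<psi>) (tgt \<phi>),
     cmpt = \<lambda>x\<in>Obj A. cmpt \<psi> (fo (tgt \<phi>) x) \<cdot>\<^bsub>C\<^esub> fm (src \<psi>) (cmpt \<phi> x)\<rparr>"


section \<open>The pointwise permutative structure on hom categories\<close>

definition smf_plus ::
  "('o1, 'm1) pcat \<Rightarrow> ('o2, 'm2) pcat \<Rightarrow> ('o1, 'm1, 'o2, 'm2) smf \<Rightarrow> ('o1, 'm1, 'o2, 'm2) smf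
    \<Rightarrow> ('o1, 'm1, 'o2, 'm2) smf" where
  "smf_plus A B F F' = smf_restrict A \<lparr>fo = \<lambda>x. fo F x \<oplus>\<^bsub>B\<^esub> fo F' x,
     fm = \<lambda>f. fm F f \<boxplus>\<^bsub>B\<^esub> fm F' f,
     fc2 = \<lambda>x y. (fc2 F x y \<boxplus>\<^bsub>B\<^esub> fc2 F' x y)
       \<cdot>\<^bsub>B\<^esub> (\<one>\<^bsub>B\<^esub> (fo F x) \<boxplus>\<^bsub>B\<^esub> \<beta>\<^bsub>B\<^esub> (fo F' x) (fo F y) \<boxplus>\<^bsub>B\<^esub> \<one>\<^bsub>B\<^esub> (fo F' y)),
     fc0 = fc0 F \<boxplus>\<^bsub>B\<^esub> fc0 F'\<rparr>"

definition smf_zero ::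
  "('o1, 'm1) pcat \<Rightarrow> ('o2, 'm2) pcat \<Rightarrow> ('o1, 'm1, 'o2, 'm2) smf" where
  "smf_zero A B = smf_restrict A \<lparr>fo = \<lambda>x. \<zero>\<^bsub>B\<^esub>, fm = \<lambda>f. \<one>\<^bsub>B\<^esub> \<zero>\<^bsub>B\<^esub>,
     fc2 = \<lambda>x y. \<one>\<^bsub>B\<^esub> \<zero>\<^bsub>B\<^esub>, fc0 = \<one>\<^bsub>B\<^esub> \<zero>\<^bsub>B\<^esub>\<rparr>"

definition PermHom ::
  "('o1, 'm1) pcat \<Rightarrow> ('o2, 'm2) pcat
    \<Rightarrow> (('o1, 'm1, 'o2, 'm2) smf, ('o1, 'm1, 'o2, 'm2) mtrans) pcat" where
  "PermHom A B = \<lparr>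
     Obj = {F. sym_mon_functor A B F}, Arr = {\<phi>. mon_trans A B \<phi>}, Dom = src, Cod = tgt,
     Ident = mt_id A B, Cmp = mt_vcomp A B,
     Osum = smf_plus A B,
     Asum = \<lambda>\<phi> \<phi>'. \<lparr>src = smf_plus A B (src \<phi>) (src \<phi>'), tgt = smf_plus A B (tgt \<phi>) (tgt \<phi>'),
       cmpt = \<lambda>x\<in>Obj A. cmpt \<phi> x \<boxplus>\<^bsub>B\<^esub> cmpt \<phi>' x\<rparr>,
     Zero = smf_zero A B,
     Sym = \<lambda>F F'. \<lparr>src = smf_plus A B F F', tgt = smf_plus A B F' F,
       cmpt = \<lambda>x\<in>Obj A. \<beta>\<^bsub>B\<^esub> (fo F x) (fo F' x)\<rparr>\<rparr>"

text \<open>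
  For \<open>S: A' \<rightarrow> A\<close> and \<open>K: C \<rightarrow> C'\<close>, \<open>PermHom1 A C A' C' S K\<close> is the symmetric monoidal functor
  from \<open>PermHom A C\<close> to \<open>PermHom A' C'\<close> sending \<open>P\<close> to \<open>K P S\<close>; its constraints are given by
  those of \<open>K\<close>.  \<open>PermHom2\<close> is the effect on monoidal transformations.
\<close>

definition PermHom1 ::
  "('oa, 'ma) pcat \<Rightarrow> ('oc, 'mc) pcat \<Rightarrow> ('oa1, 'ma1) pcat \<Rightarrow> ('oc1, 'mc1) pcat
    \<Rightarrow> ('oa1, 'ma1, 'oa, 'ma) smf \<Rightarrow> ('oc, 'mc, 'oc1, 'mc1) smf
    \<Rightarrow> (('oa, 'ma, 'oc, 'mc) smf, ('oa, 'ma, 'oc, 'mc) mtrans,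
        ('oa1, 'ma1, 'oc1, 'mc1) smf, ('oa1, 'ma1, 'oc1, 'mc1) mtrans) smf" where
  "PermHom1 A C A' C' S K =
    (let app = (\<lambda>P. smf_comp A' C' K (smf_comp A' C P S)) in
     smf_restrict (PermHom A C) \<lparr>
       fo = app,
       fm = \<lambda>\<alpha>. mt_hcomp A' C' (mt_id C C' K) (mt_hcomp A' C \<alpha> (mt_id A' A S)),
       fc2 = \<lambda>P Q. \<lparr>src = smf_plus A' C' (app P) (app Q), tgt = app (smf_plus A C P Q),
         cmpt = \<lambda>x\<in>Obj A'. fc2 K (fo P (fo S x)) (fo Q (fo S x))\<rparr>,
       fc0 = \<lparr>src = smf_zero A' C', tgt = app (smf_zero A C), cmpt = \<lambda>x\<in>Obj A'. fc0 K\<rparr>\<rparr>)"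

definition PermHom2 ::
  "('oa, 'ma) pcat \<Rightarrow> ('oc, 'mc) pcat \<Rightarrow> ('oa1, 'ma1) pcat \<Rightarrow> ('oc1, 'mc1) pcat
    \<Rightarrow> ('oa1, 'ma1, 'oa, 'ma) mtrans \<Rightarrow> ('oc, 'mc, 'oc1, 'mc1) mtrans
    \<Rightarrow> (('oa, 'ma, 'oc, 'mc) smf, ('oa, 'ma, 'oc, 'mc) mtrans,
        ('oa1, 'ma1, 'oc1, 'mc1) smf, ('oa1, 'ma1, 'oc1, 'mc1) mtrans) mtrans" where
  "PermHom2 A C A' C' \<sigma> \<kappa> = \<lparr>
     src = PermHom1 A C A' C' (src \<sigma>) (src \<kappa>), tgt = PermHom1 A C A' C' (tgt \<sigma>) (tgt \<kappa>),
     cmpt = \<lambda>P\<in>Obj (PermHom A C). mt_hcomp A' C' \<kappa> (mt_hcomp A' C (mt_id A C P) \<sigma>)\<rparr>"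


section \<open>The tensor product of permutative categories\<close>

text \<open>
  The arrows of \<open>A \<otimes> B\<close> are equivalence classes of expressions.  \<open>EBase\<close> embeds the arrows of the
  free strict monoidal category on \<open>A \<times> B\<close>, an arrow of which is a list of arrows of \<open>A \<times> B\<close>
  (a formal sum of terms \<open>f.g\<close>).
\<close>

datatype ('oa, 'ob) tgen =
    DeltaL 'oa 'ob 'ob
  | DeltaR 'ob 'oa 'oa
  | Beta "'oa \<times> 'ob" "'oa \<times> 'ob"
  | ZetaL 'oa
  | ZetaR 'ob

datatype ('oa, 'ma, 'ob, 'mb) texp =
    EBase "('ma \<times> 'mb) list"
  | EGen "('oa, 'ob) tgen"
  | EInv "('oa, 'ob) tgen"
  | ECmp "('oa, 'ma, 'ob, 'mb) texp" "('oa, 'ma, 'ob, 'mb) texp"  (infixr "\<odot>" 70)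
  | ESum "('oa, 'ma, 'ob, 'mb) texp" "('oa, 'ma, 'ob, 'mb) texp"  (infixl "\<uplus>" 65)

context
  fixes A :: "('oa, 'ma) pcat" and B :: "('ob, 'mb) pcat"
begin

fun gen_ok :: "('oa, 'ob) tgen \<Rightarrow> bool" where
  "gen_ok (DeltaL a b b') \<longleftrightarrow> a \<in> Obj A \<and> b \<in> Obj B \<and> b' \<in> Obj B"
| "gen_ok (DeltaR b a a') \<longleftrightarrow> b \<in> Obj B \<and> a \<in> Obj A \<and> a' \<in> Obj A"
| "gen_ok (Beta p q) \<longleftrightarrow> p \<in> Obj A \<times> Obj B \<and> q \<in> Obj A \<times> Obj B"
| "gen_ok (ZetaL a) \<longleftrightarrow> a \<in> Obj A"
| "gen_ok (ZetaR b) \<longleftrightarrow> b \<in> Obj B"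

fun gen_dom :: "('oa, 'ob) tgen \<Rightarrow> ('oa \<times> 'ob) list" where
  "gen_dom (DeltaL a b b') = [(a, b), (a, b')]"
| "gen_dom (DeltaR b a a') = [(a, b), (a', b)]"
| "gen_dom (Beta p q) = [p, q]"
| "gen_dom (ZetaL a) = []"
| "gen_dom (ZetaR b) = []"

fun gen_cod :: "('oa, 'ob) tgen \<Rightarrow> ('oa \<times> 'ob) list" where
  "gen_cod (DeltaL a b b') = [(a, b \<oplus>\<^bsub>B\<^esub> b')]"
| "gen_cod (DeltaR b a a') = [(a \<oplus>\<^bsub>A\<^esub> a', b)]"
| "gen_cod (Beta p q) = [q, p]"
| "gen_cod (ZetaL a) = [(a, \<zero>\<^bsub>B\<^esub>)]"
| "gen_cod (ZetaR b) = [(\<zero>\<^bsub>A\<^esub>, b)]"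

fun edom :: "('oa, 'ma, 'ob, 'mb) texp \<Rightarrow> ('oa \<times> 'ob) list" where
  "edom (EBase fs) = map (map_prod (Dom A) (Dom B)) fs"
| "edom (EGen t) = gen_dom t"
| "edom (EInv t) = gen_cod t"
| "edom (e' \<odot> e) = edom e"
| "edom (e \<uplus> e') = edom e @ edom e'"

fun ecod :: "('oa, 'ma, 'ob, 'mb) texp \<Rightarrow> ('oa \<times> 'ob) list" where
  "ecod (EBase fs) = map (map_prod (Cod A) (Cod B)) fs"
| "ecod (EGen t) = gen_cod t"
| "ecod (EInv t) = gen_dom t"
| "ecod (e' \<odot> e) = ecod e'"
| "ecod (e \<uplus> e') = ecod e @ ecod e'"

fun wf_exp :: "('oa, 'ma, 'ob, 'mb) texp \<Rightarrow> bool" where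
  "wf_exp (EBase fs) \<longleftrightarrow> set fs \<subseteq> Arr A \<times> Arr B"
| "wf_exp (EGen t) \<longleftrightarrow> gen_ok t"
| "wf_exp (EInv t) \<longleftrightarrow> gen_ok t"
| "wf_exp (e' \<odot> e) \<longleftrightarrow> wf_exp e' \<and> wf_exp e \<and> edom e' = ecod e"
| "wf_exp (e \<uplus> e') \<longleftrightarrow> wf_exp e \<and> wf_exp e'"

definition eid :: "('oa \<times> 'ob) list \<Rightarrow> ('oa, 'ma, 'ob, 'mb) texp" where
  "eid X = EBase (map (map_prod \<one>\<^bsub>A\<^esub> \<one>\<^bsub>B\<^esub>) X)"

definition pure :: "'ma \<Rightarrow> 'mb \<Rightarrow> ('oa, 'ma, 'ob, 'mb) texp" where
  "pure f g = EBase [(f, g)]"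

text \<open>The symmetry is adjoined only on generating objects \<open>a.b\<close>; the equation
  \<open>\<beta>\<^bsub>x,y+z\<^esub> = (1 + \<beta>\<^bsub>x,z\<^esub>) (\<beta>\<^bsub>x,y\<^esub> + 1)\<close> and its mirror image force its value \<open>ebeta X Y\<close> on
  arbitrary formal sums.\<close>

fun ebeta1 :: "'oa \<times> 'ob \<Rightarrow> ('oa \<times> 'ob) list \<Rightarrow> ('oa, 'ma, 'ob, 'mb) texp" where
  "ebeta1 p [] = eid [p]"
| "ebeta1 p (q # Y) = (eid [q] \<uplus> ebeta1 p Y) \<odot> (EGen (Beta p q) \<uplus> eid Y)"

fun ebeta :: "('oa \<times> 'ob) list \<Rightarrow> ('oa \<times> 'ob) list \<Rightarrow> ('oa, 'ma, 'ob, 'mb) texp" where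
  "ebeta [] Y = eid Y"
| "ebeta (p # X) Y = (ebeta1 p Y \<uplus> eid X) \<odot> (eid [p] \<uplus> ebeta X Y)"

text \<open>
  The imposed relations.  They are used below only between well-formed expressions, which
  supplies the membership conditions that are not stated.
\<close>

inductive trel :: "('oa, 'ma, 'ob, 'mb) texp \<Rightarrow> ('oa, 'ma, 'ob, 'mb) texp \<Rightarrow> bool" where
  \<comment> \<open>composition and sum of the free strict monoidal category on \<open>A \<times> B\<close> are retained\<close>
  base_Cmp: "trel (EBase gs \<odot> EBase fs)
    (EBase (map2 (\<lambda>(g, g') (f, f'). (g \<cdot>\<^bsub>A\<^esub> f, g' \<cdot>\<^bsub>B\<^esub> f')) gs fs))"
| base_Sum: "trel (EBase fs \<uplus> EBase gs) (EBase (fs @ gs))"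
  \<comment> \<open>strict monoidal category\<close>
| Cmp_assoc: "trel (e'' \<odot> (e' \<odot> e)) ((e'' \<odot> e') \<odot> e)"
| Cmp_id_left: "trel (eid (ecod e) \<odot> e) e"
| Cmp_id_right: "trel (e \<odot> eid (edom e)) e"
| Sum_Cmp: "trel ((e\<^sub>1' \<odot> e\<^sub>1) \<uplus> (e\<^sub>2' \<odot> e\<^sub>2)) ((e\<^sub>1' \<uplus> e\<^sub>2') \<odot> (e\<^sub>1 \<uplus> e\<^sub>2))"
| Sum_assoc: "trel ((e \<uplus> e') \<uplus> e'') (e \<uplus> (e' \<uplus> e''))"
| Sum_unit_left: "trel (eid [] \<uplus> e) e"
| Sum_unit_right: "trel (e \<uplus> eid []) e"
  \<comment> \<open>the generators are invertible\<close>
| inv_left: "trel (EInv t \<odot> EGen t) (eid (gen_dom t))"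
| inv_right: "trel (EGen t \<odot> EInv t) (eid (gen_cod t))"
  \<comment> \<open>naturality in every variable\<close>
| DeltaL_natural: "\<lbrakk>f \<in> Hom A a a1; g \<in> Hom B b b1; g' \<in> Hom B b' b1'\<rbrakk> \<Longrightarrow>
    trel (EGen (DeltaL a1 b1 b1') \<odot> (pure f g \<uplus> pure f g'))
      (pure f (g \<boxplus>\<^bsub>B\<^esub> g') \<odot> EGen (DeltaL a b b'))"
| DeltaR_natural: "\<lbrakk>g \<in> Hom B b b1; f \<in> Hom A a a1; f' \<in> Hom A a' a1'\<rbrakk> \<Longrightarrow>
    trel (EGen (DeltaR b1 a1 a1') \<odot> (pure f g \<uplus> pure f' g))
      (pure (f \<boxplus>\<^bsub>A\<^esub> f') g \<odot> EGen (DeltaR b a a'))"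
| ZetaL_natural: "f \<in> Hom A a a1 \<Longrightarrow>
    trel (EGen (ZetaL a1)) (pure f (\<one>\<^bsub>B\<^esub> \<zero>\<^bsub>B\<^esub>) \<odot> EGen (ZetaL a))"
| ZetaR_natural: "g \<in> Hom B b b1 \<Longrightarrow>
    trel (EGen (ZetaR b1)) (pure (\<one>\<^bsub>A\<^esub> \<zero>\<^bsub>A\<^esub>) g \<odot> EGen (ZetaR b))"
  \<comment> \<open>permutative structure; \<open>Beta_natural\<close> contains naturality of \<open>\<beta>\<^bsub>a.b,a'.b'\<^esub>\<close> in its variables
      as well as naturality with respect to the adjoined arrows\<close>
| Beta_natural: "trel (ebeta (ecod e) (ecod e') \<odot> (e \<uplus> e')) ((e' \<uplus> e) \<odot> ebeta (edom e) (edom e'))"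
| Beta_Beta: "\<lbrakk>X \<in> lists (Obj A \<times> Obj B); Y \<in> lists (Obj A \<times> Obj B)\<rbrakk> \<Longrightarrow>
    trel (ebeta Y X \<odot> ebeta X Y) (eid (X @ Y))"
| Beta_Sum: "\<lbrakk>X \<in> lists (Obj A \<times> Obj B); Y \<in> lists (Obj A \<times> Obj B); Z \<in> lists (Obj A \<times> Obj B)\<rbrakk> \<Longrightarrow>
    trel (ebeta X (Y @ Z)) ((eid Y \<uplus> ebeta X Z) \<odot> (ebeta X Y \<uplus> eid Z))"
  \<comment> \<open>\<open>a.(-)\<close> is symmetric monoidal\<close>
| DeltaL_assoc: "trel (EGen (DeltaL a (b \<oplus>\<^bsub>B\<^esub> b') b'') \<odot> (EGen (DeltaL a b b') \<uplus> eid [(a, b'')]))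
    (EGen (DeltaL a b (b' \<oplus>\<^bsub>B\<^esub> b'')) \<odot> (eid [(a, b)] \<uplus> EGen (DeltaL a b' b'')))"
| DeltaL_unit_left: "trel (EGen (DeltaL a \<zero>\<^bsub>B\<^esub> b) \<odot> (EGen (ZetaL a) \<uplus> eid [(a, b)])) (eid [(a, b)])"
| DeltaL_unit_right: "trel (EGen (DeltaL a b \<zero>\<^bsub>B\<^esub>) \<odot> (eid [(a, b)] \<uplus> EGen (ZetaL a))) (eid [(a, b)])"
| DeltaL_symmetry: "trel (pure (\<one>\<^bsub>A\<^esub> a) (\<beta>\<^bsub>B\<^esub> b b') \<odot> EGen (DeltaL a b b'))
    (EGen (DeltaL a b' b) \<odot> EGen (Beta (a, b) (a, b')))"
  \<comment> \<open>\<open>(-).b\<close> is symmetric monoidal\<close>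
| DeltaR_assoc: "trel (EGen (DeltaR b (a \<oplus>\<^bsub>A\<^esub> a') a'') \<odot> (EGen (DeltaR b a a') \<uplus> eid [(a'', b)]))
    (EGen (DeltaR b a (a' \<oplus>\<^bsub>A\<^esub> a'')) \<odot> (eid [(a, b)] \<uplus> EGen (DeltaR b a' a'')))"
| DeltaR_unit_left: "trel (EGen (DeltaR b \<zero>\<^bsub>A\<^esub> a) \<odot> (EGen (ZetaR b) \<uplus> eid [(a, b)])) (eid [(a, b)])"
| DeltaR_unit_right: "trel (EGen (DeltaR b a \<zero>\<^bsub>A\<^esub>) \<odot> (eid [(a, b)] \<uplus> EGen (ZetaR b))) (eid [(a, b)])"
| DeltaR_symmetry: "trel (pure (\<beta>\<^bsub>A\<^esub> a a') (\<one>\<^bsub>B\<^esub> b) \<odot> EGen (DeltaR b a a'))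
    (EGen (DeltaR b a' a) \<odot> EGen (Beta (a, b) (a', b)))"
  \<comment> \<open>compatibility of the two sides\<close>
| DeltaL_DeltaR: "trel
    (EGen (DeltaL (a \<oplus>\<^bsub>A\<^esub> a') b b') \<odot> (EGen (DeltaR b a a') \<uplus> EGen (DeltaR b' a a')))
    (EGen (DeltaR (b \<oplus>\<^bsub>B\<^esub> b') a a') \<odot> (EGen (DeltaL a b b') \<uplus> EGen (DeltaL a' b b'))
      \<odot> (eid [(a, b)] \<uplus> EGen (Beta (a', b) (a, b')) \<uplus> eid [(a', b')]))"
| ZetaL_ZetaR: "trel (EGen (ZetaL \<zero>\<^bsub>A\<^esub>)) (EGen (ZetaR \<zero>\<^bsub>B\<^esub>))"
| DeltaR_ZetaL: "trel (EGen (DeltaR \<zero>\<^bsub>B\<^esub> a a') \<odot> (EGen (ZetaL a) \<uplus> EGen (ZetaL a')))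
    (EGen (ZetaL (a \<oplus>\<^bsub>A\<^esub> a')))"
| DeltaL_ZetaR: "trel (EGen (DeltaL \<zero>\<^bsub>A\<^esub> b b') \<odot> (EGen (ZetaR b) \<uplus> EGen (ZetaR b')))
    (EGen (ZetaR (b \<oplus>\<^bsub>B\<^esub> b')))"

inductive teq :: "('oa, 'ma, 'ob, 'mb) texp \<Rightarrow> ('oa, 'ma, 'ob, 'mb) texp \<Rightarrow> bool" where
  rel: "\<lbrakk>trel e e'; wf_exp e; wf_exp e'\<rbrakk> \<Longrightarrow> teq e e'"
| refl: "wf_exp e \<Longrightarrow> teq e e"
| sym: "teq e e' \<Longrightarrow> teq e' e"
| trans: "\<lbrakk>teq e e'; teq e' e''\<rbrakk> \<Longrightarrow> teq e e''"
| Cmp_cong: "\<lbrakk>teq e\<^sub>1 e\<^sub>1'; teq e\<^sub>2 e\<^sub>2'; edom e\<^sub>1 = ecod e\<^sub>2; edom e\<^sub>1' = ecod e\<^sub>2'\<rbrakk>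
    \<Longrightarrow> teq (e\<^sub>1 \<odot> e\<^sub>2) (e\<^sub>1' \<odot> e\<^sub>2')"
| Sum_cong: "\<lbrakk>teq e\<^sub>1 e\<^sub>1'; teq e\<^sub>2 e\<^sub>2'\<rbrakk> \<Longrightarrow> teq (e\<^sub>1 \<uplus> e\<^sub>2) (e\<^sub>1' \<uplus> e\<^sub>2')"

definition tcls :: "('oa, 'ma, 'ob, 'mb) texp \<Rightarrow> ('oa, 'ma, 'ob, 'mb) texp set" where
  "tcls e = {e'. teq e e'}"

end

definition trep :: "('oa, 'ma, 'ob, 'mb) texp set \<Rightarrow> ('oa, 'ma, 'ob, 'mb) texp" where
  "trep E = (SOME e. e \<in> E)"

definition tensor ::
  "('oa, 'ma) pcat \<Rightarrow> ('ob, 'mb) pcat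
    \<Rightarrow> (('oa \<times> 'ob) list, ('oa, 'ma, 'ob, 'mb) texp set) pcat"  (infixl "\<otimes>" 75) where
  "A \<otimes> B = \<lparr>
     Obj = lists (Obj A \<times> Obj B),
     Arr = tcls A B ` {e. wf_exp A B e},
     Dom = \<lambda>E. edom A B (trep E), Cod = \<lambda>E. ecod A B (trep E),
     Ident = \<lambda>X. tcls A B (eid A B X),
     Cmp = \<lambda>E' E. tcls A B (trep E' \<odot> trep E),
     Osum = (@),
     Asum = \<lambda>E E'. tcls A B (trep E \<uplus> trep E'),
     Zero = [],
     Sym = \<lambda>X Y. tcls A B (ebeta A B X Y)\<rparr>"

text \<open>For \<open>F: A \<rightarrow> A'\<close> and \<open>G: B \<rightarrow> B'\<close>, \<open>tensor_exp A' B' F G\<close> is the map on expressions that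
  defines \<open>F \<otimes> G\<close>; the image of the formal inverse of a generator is the inverse of its image.\<close>

context
  fixes A' :: "('oa1, 'ma1) pcat" and B' :: "('ob1, 'mb1) pcat"
    and F :: "('oa, 'ma, 'oa1, 'ma1) smf" and G :: "('ob, 'mb, 'ob1, 'mb1) smf"
begin

fun tensor_exp :: "('oa, 'ma, 'ob, 'mb) texp \<Rightarrow> ('oa1, 'ma1, 'ob1, 'mb1) texp" where
  "tensor_exp (EBase fs) = EBase (map (map_prod (fm F) (fm G)) fs)"
| "tensor_exp (EGen (DeltaL a b b')) =
     pure (\<one>\<^bsub>A'\<^esub> (fo F a)) (fc2 G b b') \<odot> EGen (DeltaL (fo F a) (fo G b) (fo G b'))"
| "tensor_exp (EGen (DeltaR b a a')) =
     pure (fc2 F a a') (\<one>\<^bsub>B'\<^esub> (fo G b)) \<odot> EGen (DeltaR (fo G b) (fo F a) (fo F a'))"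
| "tensor_exp (EGen (Beta p q)) =
     EGen (Beta (map_prod (fo F) (fo G) p) (map_prod (fo F) (fo G) q))"
| "tensor_exp (EGen (ZetaL a)) = pure (\<one>\<^bsub>A'\<^esub> (fo F a)) (fc0 G) \<odot> EGen (ZetaL (fo F a))"
| "tensor_exp (EGen (ZetaR b)) = pure (fc0 F) (\<one>\<^bsub>B'\<^esub> (fo G b)) \<odot> EGen (ZetaR (fo G b))"
| "tensor_exp (EInv (DeltaL a b b')) =
     EInv (DeltaL (fo F a) (fo G b) (fo G b')) \<odot> pure (\<one>\<^bsub>A'\<^esub> (fo F a)) (inv_arr B' (fc2 G b b'))"
| "tensor_exp (EInv (DeltaR b a a')) =
     EInv (DeltaR (fo G b) (fo F a) (fo F a')) \<odot> pure (inv_arr A' (fc2 F a a')) (\<one>\<^bsub>B'\<^esub> (fo G b))"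
| "tensor_exp (EInv (Beta p q)) =
     EInv (Beta (map_prod (fo F) (fo G) p) (map_prod (fo F) (fo G) q))"
| "tensor_exp (EInv (ZetaL a)) =
     EInv (ZetaL (fo F a)) \<odot> pure (\<one>\<^bsub>A'\<^esub> (fo F a)) (inv_arr B' (fc0 G))"
| "tensor_exp (EInv (ZetaR b)) =
     EInv (ZetaR (fo G b)) \<odot> pure (inv_arr A' (fc0 F)) (\<one>\<^bsub>B'\<^esub> (fo G b))"
| "tensor_exp (e' \<odot> e) = tensor_exp e' \<odot> tensor_exp e"
| "tensor_exp (e \<uplus> e') = tensor_exp e \<uplus> tensor_exp e'"

end

definition tensor1 ::
  "('oa, 'ma) pcat \<Rightarrow> ('ob, 'mb) pcat \<Rightarrow> ('oa1, 'ma1) pcat \<Rightarrow> ('ob1, 'mb1) pcat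
    \<Rightarrow> ('oa, 'ma, 'oa1, 'ma1) smf \<Rightarrow> ('ob, 'mb, 'ob1, 'mb1) smf
    \<Rightarrow> (('oa \<times> 'ob) list, ('oa, 'ma, 'ob, 'mb) texp set,
        ('oa1 \<times> 'ob1) list, ('oa1, 'ma1, 'ob1, 'mb1) texp set) smf" where
  "tensor1 A B A' B' F G = smf_restrict (A \<otimes> B) \<lparr>
     fo = map (map_prod (fo F) (fo G)),
     fm = \<lambda>E. tcls A' B' (tensor_exp A' B' F G (trep E)),
     fc2 = \<lambda>X Y. \<one>\<^bsub>A' \<otimes> B'\<^esub> (map (map_prod (fo F) (fo G)) (X @ Y)),
     fc0 = \<one>\<^bsub>A' \<otimes> B'\<^esub> \<zero>\<^bsub>A' \<otimes> B'\<^esub>\<rparr>"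

definition tensor2 ::
  "('oa, 'ma) pcat \<Rightarrow> ('ob, 'mb) pcat \<Rightarrow> ('oa1, 'ma1) pcat \<Rightarrow> ('ob1, 'mb1) pcat
    \<Rightarrow> ('oa, 'ma, 'oa1, 'ma1) mtrans \<Rightarrow> ('ob, 'mb, 'ob1, 'mb1) mtrans
    \<Rightarrow> (('oa \<times> 'ob) list, ('oa, 'ma, 'ob, 'mb) texp set,
        ('oa1 \<times> 'ob1) list, ('oa1, 'ma1, 'ob1, 'mb1) texp set) mtrans" where
  "tensor2 A B A' B' \<phi> \<psi> = \<lparr>
     src = tensor1 A B A' B' (src \<phi>) (src \<psi>), tgt = tensor1 A B A' B' (tgt \<phi>) (tgt \<psi>),
     cmpt = \<lambda>X\<in>Obj (A \<otimes> B). tcls A' B' (EBase (map (map_prod (cmpt \<phi>) (cmpt \<psi>)) X))\<rparr>"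


section \<open>2-categories and transformations of Cat-valued 2-functors\<close>

record ('x, 'f, 't) two_cat =
  Cell0 :: "'x set"
  HomCat :: "'x \<Rightarrow> 'x \<Rightarrow> ('f, 't) cat"
  One1 :: "'x \<Rightarrow> 'f"
  Cmp1 :: "'x \<Rightarrow> 'x \<Rightarrow> 'x \<Rightarrow> 'f \<Rightarrow> 'f \<Rightarrow> 'f"
  HCmp :: "'x \<Rightarrow> 'x \<Rightarrow> 'x \<Rightarrow> 't \<Rightarrow> 't \<Rightarrow> 't"

definition prod_cat :: "('o1, 'm1) cat \<Rightarrow> ('o2, 'm2) cat \<Rightarrow> ('o1 \<times> 'o2, 'm1 \<times> 'm2) cat" where
  "prod_cat C D = \<lparr>Obj = Obj C \<times> Obj D, Arr = Arr C \<times> Arr D,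
     Dom = map_prod (Dom C) (Dom D), Cod = map_prod (Cod C) (Cod D),
     Ident = map_prod \<one>\<^bsub>C\<^esub> \<one>\<^bsub>D\<^esub>,
     Cmp = \<lambda>(g, g') (f, f'). (g \<cdot>\<^bsub>C\<^esub> f, g' \<cdot>\<^bsub>D\<^esub> f')\<rparr>"

text \<open>\<open>op2\<close> reverses 1-cells only.\<close>

definition op2 :: "('x, 'f, 't) two_cat \<Rightarrow> ('x, 'f, 't) two_cat" where
  "op2 \<X> = \<lparr>Cell0 = Cell0 \<X>, HomCat = \<lambda>x y. HomCat \<X> y x, One1 = One1 \<X>,
     Cmp1 = \<lambda>x y z g f. Cmp1 \<X> z y x f g, HCmp = \<lambda>x y z t s. HCmp \<X> z y x s t\<rparr>"

definition prod2 ::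
  "('x, 'f, 't) two_cat \<Rightarrow> ('y, 'g, 's) two_cat \<Rightarrow> ('x \<times> 'y, 'f \<times> 'g, 't \<times> 's) two_cat"
  (infixr "\<times>\<^sub>2" 80) where
  "\<X> \<times>\<^sub>2 \<Y> = \<lparr>Cell0 = Cell0 \<X> \<times> Cell0 \<Y>,
     HomCat = \<lambda>(x, y) (x', y'). prod_cat (HomCat \<X> x x') (HomCat \<Y> y y'),
     One1 = map_prod (One1 \<X>) (One1 \<Y>),
     Cmp1 = \<lambda>(x, y) (x', y') (x'', y'') (g, g') (f, f').
       (Cmp1 \<X> x x' x'' g f, Cmp1 \<Y> y y' y'' g' f'),
     HCmp = \<lambda>(x, y) (x', y') (x'', y'') (t, t') (s, s').
       (HCmp \<X> x x' x'' t s, HCmp \<Y> y y' y'' t' s')\<rparr>"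

definition PermCat :: "(('o, 'm) pcat, ('o, 'm, 'o, 'm) smf, ('o, 'm, 'o, 'm) mtrans) two_cat" where
  "PermCat = \<lparr>Cell0 = {A. permutative A}, HomCat = \<lambda>A B. underlying_cat (PermHom A B),
     One1 = smf_id, Cmp1 = \<lambda>A B C. smf_comp A C, HCmp = \<lambda>A B C. mt_hcomp A C\<rparr>"

text \<open>The locally full sub-2-category on the strict symmetric monoidal functors.\<close>

definition StrictPermCat ::
  "(('o, 'm) pcat, ('o, 'm, 'o, 'm) smf, ('o, 'm, 'o, 'm) mtrans) two_cat" where
  "StrictPermCat = PermCat \<lparr>HomCat := \<lambda>A B. (underlying_cat (PermHom A B))
     \<lparr>Obj := {F. strict_sym_mon_functor A B F},
      Arr := {\<phi>. mon_trans A B \<phi> \<and> strict_sym_mon_functor A B (src \<phi>)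
        \<and> strict_sym_mon_functor A B (tgt \<phi>)}\<rparr>\<rparr>"

text \<open>The data of a 2-functor to the 2-category of categories: \<open>on2 S x y t\<close> is the family of
  components of the natural transformation assigned to the 2-cell \<open>t\<close>.\<close>

record ('x, 'f, 't, 'o, 'm) two_functor =
  on0 :: "'x \<Rightarrow> ('o, 'm) cat"
  on1 :: "'x \<Rightarrow> 'x \<Rightarrow> 'f \<Rightarrow> ('o, 'm, 'o, 'm) func"
  on2 :: "'x \<Rightarrow> 'x \<Rightarrow> 't \<Rightarrow> 'o \<Rightarrow> 'm"

locale two_natural =
  fixes \<X> :: "('x, 'f, 't) two_cat"
    and S :: "('x, 'f, 't, 'o1, 'm1) two_functor"
    and T :: "('x, 'f, 't, 'o2, 'm2) two_functor"
    and \<alpha> :: "'x \<Rightarrow> ('o1, 'm1, 'o2, 'm2) func"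
  assumes component: "x \<in> Cell0 \<X> \<Longrightarrow> is_functor (on0 S x) (on0 T x) (\<alpha> x)"
    and naturality_obj: "\<lbrakk>x \<in> Cell0 \<X>; y \<in> Cell0 \<X>; f \<in> Obj (HomCat \<X> x y); p \<in> Obj (on0 S x)\<rbrakk>
      \<Longrightarrow> fo (on1 T x y f) (fo (\<alpha> x) p) = fo (\<alpha> y) (fo (on1 S x y f) p)"
    and naturality_arr: "\<lbrakk>x \<in> Cell0 \<X>; y \<in> Cell0 \<X>; f \<in> Obj (HomCat \<X> x y); m \<in> Arr (on0 S x)\<rbrakk>
      \<Longrightarrow> fm (on1 T x y f) (fm (\<alpha> x) m) = fm (\<alpha> y) (fm (on1 S x y f) m)"
    and naturality_two: "\<lbrakk>x \<in> Cell0 \<X>; y \<in> Cell0 \<X>; t \<in> Arr (HomCat \<X> x y); p \<in> Obj (on0 S x)\<rbrakk>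
      \<Longrightarrow> on2 T x y t (fo (\<alpha> x) p) = fm (\<alpha> y) (on2 S x y t p)"

locale pseudonatural =
  fixes \<X> :: "('x, 'f, 't) two_cat"
    and S :: "('x, 'f, 't, 'o1, 'm1) two_functor"
    and T :: "('x, 'f, 't, 'o2, 'm2) two_functor"
    and \<alpha> :: "'x \<Rightarrow> ('o1, 'm1, 'o2, 'm2) func"
    and \<omega> :: "'x \<Rightarrow> 'x \<Rightarrow> 'f \<Rightarrow> 'o1 \<Rightarrow> 'm2"
  assumes component: "x \<in> Cell0 \<X> \<Longrightarrow> is_functor (on0 S x) (on0 T x) (\<alpha> x)"
    and constraint: "\<lbrakk>x \<in> Cell0 \<X>; y \<in> Cell0 \<X>; f \<in> Obj (HomCat \<X> x y)\<rbrakk>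
      \<Longrightarrow> natural_iso (on0 S x) (on0 T y) (on1 T x y f \<circ>\<^sub>F \<alpha> x) (\<alpha> y \<circ>\<^sub>F on1 S x y f) (\<omega> x y f)"
    and naturality_two: "\<lbrakk>x \<in> Cell0 \<X>; y \<in> Cell0 \<X>; t \<in> Hom (HomCat \<X> x y) f g; p \<in> Obj (on0 S x)\<rbrakk>
      \<Longrightarrow> \<omega> x y g p \<cdot>\<^bsub>on0 T y\<^esub> on2 T x y t (fo (\<alpha> x) p)
        = fm (\<alpha> y) (on2 S x y t p) \<cdot>\<^bsub>on0 T y\<^esub> \<omega> x y f p"
    and unity: "\<lbrakk>x \<in> Cell0 \<X>; p \<in> Obj (on0 S x)\<rbrakk>
      \<Longrightarrow> \<omega> x x (One1 \<X> x) p = \<one>\<^bsub>on0 T x\<^esub> (fo (\<alpha> x) p)"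
    and compositionality: "\<lbrakk>x \<in> Cell0 \<X>; y \<in> Cell0 \<X>; z \<in> Cell0 \<X>;
        f \<in> Obj (HomCat \<X> x y); g \<in> Obj (HomCat \<X> y z); p \<in> Obj (on0 S x)\<rbrakk>
      \<Longrightarrow> \<omega> x z (Cmp1 \<X> x y z g f) p
        = \<omega> y z g (fo (on1 S x y f) p) \<cdot>\<^bsub>on0 T z\<^esub> fm (on1 T y z g) (\<omega> x y f p)"


section \<open>The two 2-functors of three variables\<close>

text \<open>A 1-cell from \<open>(A, B, C)\<close> to \<open>(A', B', C')\<close> of \<open>op2 PermCat \<times>\<^sub>2 op2 PermCat \<times>\<^sub>2 PermCat\<close> is a
  triple of symmetric monoidal functors \<open>F: A' \<rightarrow> A\<close>, \<open>G: B' \<rightarrow> B\<close>, \<open>K: C \<rightarrow> C'\<close>.\<close>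

type_synonym ('oa, 'ma, 'ob, 'mb, 'oc, 'mc) triple0 =
  "('oa, 'ma) pcat \<times> ('ob, 'mb) pcat \<times> ('oc, 'mc) pcat"
type_synonym ('oa, 'ma, 'ob, 'mb, 'oc, 'mc) triple1 =
  "('oa, 'ma, 'oa, 'ma) smf \<times> ('ob, 'mb, 'ob, 'mb) smf \<times> ('oc, 'mc, 'oc, 'mc) smf"
type_synonym ('oa, 'ma, 'ob, 'mb, 'oc, 'mc) triple2 =
  "('oa, 'ma, 'oa, 'ma) mtrans \<times> ('ob, 'mb, 'ob, 'mb) mtrans \<times> ('oc, 'mc, 'oc, 'mc) mtrans"

type_synonym ('oa, 'ma, 'ob, 'mb, 'oc, 'mc) left_obj =
  "(('oa \<times> 'ob) list, ('oa, 'ma, 'ob, 'mb) texp set, 'oc, 'mc) smf"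
type_synonym ('oa, 'ma, 'ob, 'mb, 'oc, 'mc) left_arr =
  "(('oa \<times> 'ob) list, ('oa, 'ma, 'ob, 'mb) texp set, 'oc, 'mc) mtrans"
type_synonym ('oa, 'ma, 'ob, 'mb, 'oc, 'mc) right_obj =
  "('oa, 'ma, ('ob, 'mb, 'oc, 'mc) smf, ('ob, 'mb, 'oc, 'mc) mtrans) smf"
type_synonym ('oa, 'ma, 'ob, 'mb, 'oc, 'mc) right_arr =
  "('oa, 'ma, ('ob, 'mb, 'oc, 'mc) smf, ('ob, 'mb, 'oc, 'mc) mtrans) mtrans"

definition PermCat_tensor ::
  "(('oa, 'ma, 'ob, 'mb, 'oc, 'mc) triple0, ('oa, 'ma, 'ob, 'mb, 'oc, 'mc) triple1,
    ('oa, 'ma, 'ob, 'mb, 'oc, 'mc) triple2,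
    ('oa, 'ma, 'ob, 'mb, 'oc, 'mc) left_obj, ('oa, 'ma, 'ob, 'mb, 'oc, 'mc) left_arr)
   two_functor" where
  "PermCat_tensor = \<lparr>
     on0 = \<lambda>(A, B, C). underlying_cat (PermHom (A \<otimes> B) C),
     on1 = \<lambda>(A, B, C) (A', B', C') (F, G, K).
       underlying_func (PermHom1 (A \<otimes> B) C (A' \<otimes> B') C' (tensor1 A' B' A B F G) K),
     on2 = \<lambda>(A, B, C) (A', B', C') (\<phi>, \<psi>, \<kappa>).
       cmpt (PermHom2 (A \<otimes> B) C (A' \<otimes> B') C' (tensor2 A' B' A B \<phi> \<psi>) \<kappa>)\<rparr>"

definition PermCat_iterated ::
  "(('oa, 'ma, 'ob, 'mb, 'oc, 'mc) triple0, ('oa, 'ma, 'ob, 'mb, 'oc, 'mc) triple1,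
    ('oa, 'ma, 'ob, 'mb, 'oc, 'mc) triple2,
    ('oa, 'ma, 'ob, 'mb, 'oc, 'mc) right_obj, ('oa, 'ma, 'ob, 'mb, 'oc, 'mc) right_arr)
   two_functor" where
  "PermCat_iterated = \<lparr>
     on0 = \<lambda>(A, B, C). underlying_cat (PermHom A (PermHom B C)),
     on1 = \<lambda>(A, B, C) (A', B', C') (F, G, K).
       underlying_func
         (PermHom1 A (PermHom B C) A' (PermHom B' C') F (PermHom1 B C B' C' G K)),
     on2 = \<lambda>(A, B, C) (A', B', C') (\<phi>, \<psi>, \<kappa>).
       cmpt (PermHom2 A (PermHom B C) A' (PermHom B' C') \<phi> (PermHom2 B C B' C' \<psi> \<kappa>))\<rparr>"

end

theory Submission
  imports Defs
begin

text \<open>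
  Write \<open>T = A \<otimes> B\<close>.  The generators of \<open>T\<close> assemble into a symmetric monoidal functor
  \<open>U: A \<rightarrow> PermHom B T\<close>, \<open>a \<mapsto> a.(-)\<close>, and \<open>W P\<close> is \<open>U\<close> followed by composition with \<open>P\<close>; so \<open>W\<close> is
  well defined and strict for formal reasons.  Evaluating expressions shows that every
  \<open>Q: A \<rightarrow> PermHom B C\<close> equals \<open>W P\<close> for a strict \<open>P = Ro Q\<close>.  Moreover \<open>W\<close> is fully faithful: a
  monoidal transformation out of \<open>T\<close> is determined by its components at the one-term sums \<open>a.b\<close>, and
  these may be prescribed because \<open>P\<^sub>2\<close> and \<open>P\<^sub>0\<close> are invertible.

  All remaining data are therefore the unique lifts along \<open>W\<close> of identities: the unit of the
  adjunction, the monoidal constraints of \<open>W\<^sub>b\<close> and its pseudonaturality constraint.  Every axiom about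
  them is an equation between arrows of \<open>PermHom T C\<close> that becomes trivial after applying \<open>W\<close>.  Strict
  functors out of \<open>T\<close> with the same image under \<open>W\<close> are equal, which gives both the strict naturality
  of \<open>W\<^sub>b\<close> and the functoriality of the tensor product.
\<close>

section \<open>Categories and permutative categories\<close>

text \<open>The relations imposed on T and the axioms of a symmetric monoidal functor from A to
  \<open>PermHom B C\<close> match each other. Read in T they make \<open>U\<close> such a functor;
  read in C they make evaluation along Q respect the relations. This is why
  \<open>Wo (Ro Q) = Q\<close> holds on the nose.

  In the other direction \<open>Ro (Wo P)\<close> differs from P in general: it sends a formal sum
  to the sum of the values of P at its terms, while P preserves sums only up to
  \<open>fc2 P\<close>. So the counit is an identity and the unit merely invertible. The same
  phenomenon governs naturality in C: postcomposing the strict \<open>Ro Q\<close> with a nonstrict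
  K leaves the strict functors, and a comparison 2-cell appears.

  The technical obstacle is that arrows of T are classes of expressions. Explicit work with
  expressions is confined to the construction of T, to the evaluation \<open>val\<close> and to its
  comparison with the maps defining the tensor product of 1- and 2-cells; elsewhere arrows of T are
  treated by induction over generators, and functors and transformations through their images under
  \<open>W\<close>.\<close>

lemma HomI: "\<lbrakk>f \<in> Arr C; Dom C f = x; Cod C f = y\<rbrakk> \<Longrightarrow> f \<in> Hom C x y"
  by (simp add: Hom_def)

lemma HomD: "f \<in> Hom C x y \<Longrightarrow> f \<in> Arr C" "f \<in> Hom C x y \<Longrightarrow> Dom C f = x"
  "f \<in> Hom C x y \<Longrightarrow> Cod C f = y"
  by (simp_all add: Hom_def)

lemma Arr_Hom: "f \<in> Arr C \<Longrightarrow> f \<in> Hom C (Dom C f) (Cod C f)"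
  by (simp add: Hom_def)

text \<open>Here and in the introduction and simp rules below, membership in
  \<open>Hom C x y\<close> is traded for equations about \<open>Dom\<close> and \<open>Cod\<close>:
  these can be discharged by rewriting, whereas \<open>Hom\<close> would require the objects x and y
  to be guessed.\<close>

lemma categoryI:
  assumes "\<And>f. f \<in> Arr C \<Longrightarrow> Dom C f \<in> Obj C" "\<And>f. f \<in> Arr C \<Longrightarrow> Cod C f \<in> Obj C"
    and "\<And>x. x \<in> Obj C \<Longrightarrow> \<one>\<^bsub>C\<^esub> x \<in> Arr C" "\<And>x. x \<in> Obj C \<Longrightarrow> Dom C (\<one>\<^bsub>C\<^esub> x) = x"
      "\<And>x. x \<in> Obj C \<Longrightarrow> Cod C (\<one>\<^bsub>C\<^esub> x) = x"
    and "\<And>f g. \<lbrakk>f \<in> Arr C; g \<in> Arr C; Dom C g = Cod C f\<rbrakk> \<Longrightarrow> g \<cdot>\<^bsub>C\<^esub> f \<in> Arr C"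
      "\<And>f g. \<lbrakk>f \<in> Arr C; g \<in> Arr C; Dom C g = Cod C f\<rbrakk> \<Longrightarrow> Dom C (g \<cdot>\<^bsub>C\<^esub> f) = Dom C f"
      "\<And>f g. \<lbrakk>f \<in> Arr C; g \<in> Arr C; Dom C g = Cod C f\<rbrakk> \<Longrightarrow> Cod C (g \<cdot>\<^bsub>C\<^esub> f) = Cod C g"
    and "\<And>f g h. \<lbrakk>f \<in> Arr C; g \<in> Arr C; h \<in> Arr C; Dom C g = Cod C f; Dom C h = Cod C g\<rbrakk>
      \<Longrightarrow> h \<cdot>\<^bsub>C\<^esub> (g \<cdot>\<^bsub>C\<^esub> f) = (h \<cdot>\<^bsub>C\<^esub> g) \<cdot>\<^bsub>C\<^esub> f"
    and "\<And>f. f \<in> Arr C \<Longrightarrow> \<one>\<^bsub>C\<^esub> (Cod C f) \<cdot>\<^bsub>C\<^esub> f = f"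
    and "\<And>f. f \<in> Arr C \<Longrightarrow> f \<cdot>\<^bsub>C\<^esub> \<one>\<^bsub>C\<^esub> (Dom C f) = f"
  shows "category C"
  by unfold_locales (use assms in \<open>auto simp: Hom_def\<close>)

context category
begin

lemma Obj_Dom [simp]: "f \<in> Arr C \<Longrightarrow> Dom C f \<in> Obj C"
  and Obj_Cod [simp]: "f \<in> Arr C \<Longrightarrow> Cod C f \<in> Obj C"
  by (rule Dom_in Cod_in; assumption)+

lemma Ident_Arr [simp]: "x \<in> Obj C \<Longrightarrow> \<one> x \<in> Arr C"
  and Dom_Ident [simp]: "x \<in> Obj C \<Longrightarrow> Dom C (\<one> x) = x"
  and Cod_Ident [simp]: "x \<in> Obj C \<Longrightarrow> Cod C (\<one> x) = x"
  using Ident_in by (auto simp: Hom_def)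

lemma Cmp_Arr [simp]: "\<lbrakk>f \<in> Arr C; g \<in> Arr C; Dom C g = Cod C f\<rbrakk> \<Longrightarrow> g \<cdot> f \<in> Arr C"
  and Dom_Cmp [simp]: "\<lbrakk>f \<in> Arr C; g \<in> Arr C; Dom C g = Cod C f\<rbrakk> \<Longrightarrow> Dom C (g \<cdot> f) = Dom C f"
  and Cod_Cmp [simp]: "\<lbrakk>f \<in> Arr C; g \<in> Arr C; Dom C g = Cod C f\<rbrakk> \<Longrightarrow> Cod C (g \<cdot> f) = Cod C g"
  using Cmp_in[of f "Dom C f" "Cod C f" g "Cod C g"] by (auto simp: Hom_def)

lemma assoc [simp]: "\<lbrakk>f \<in> Arr C; g \<in> Arr C; h \<in> Arr C; Dom C g = Cod C f; Dom C h = Cod C g\<rbrakk>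
    \<Longrightarrow> (h \<cdot> g) \<cdot> f = h \<cdot> (g \<cdot> f)"
  using Cmp_assoc[of f "Dom C f" "Cod C f" g "Cod C g" h "Cod C h"] by (simp add: Hom_def)

lemma id_left [simp]: "\<lbrakk>f \<in> Arr C; Cod C f = y\<rbrakk> \<Longrightarrow> \<one> y \<cdot> f = f"
  using Cmp_Ident_left[of f "Dom C f" y] by (simp add: Hom_def)

lemma id_right [simp]: "\<lbrakk>f \<in> Arr C; Dom C f = x\<rbrakk> \<Longrightarrow> f \<cdot> \<one> x = f"
  using Cmp_Ident_right[of f x "Cod C f"] by (simp add: Hom_def)

lemma inverse_arrowsI: "\<lbrakk>f \<in> Arr C; g \<in> Arr C; Dom C g = Cod C f; Cod C g = Dom C f;
    g \<cdot> f = \<one> (Dom C f); f \<cdot> g = \<one> (Cod C f)\<rbrakk> \<Longrightarrow> inverse_arrows C f g"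
  by (simp add: inverse_arrows_def Hom_def)

lemma inverse_arrows_unique:
  assumes "inverse_arrows C f g" "inverse_arrows C f g'"
  shows "g = g'"
proof -
  have *: "f \<in> Arr C" "g \<in> Arr C" "g' \<in> Arr C" "Dom C g = Cod C f" "Cod C g = Dom C f"
    "Dom C g' = Cod C f" "Cod C g' = Dom C f" "g \<cdot> f = \<one> (Dom C f)" "f \<cdot> g' = \<one> (Cod C f)"
    using assms by (auto simp: inverse_arrows_def Hom_def)
  have "g = g \<cdot> (f \<cdot> g')" using * by simp
  also have "\<dots> = (g \<cdot> f) \<cdot> g'" using * by (subst assoc) auto
  also have "\<dots> = g'" using * by simp
  finally show ?thesis .
qed

lemma inv_arr_eq: "inverse_arrows C f g \<Longrightarrow> inv_arr C f = g"
  unfolding inv_arr_def using inverse_arrows_unique by blast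

lemma iso_inverse: "iso C f \<Longrightarrow> inverse_arrows C f (inv_arr C f)"
  unfolding iso_def using inv_arr_eq by metis

lemma isoI: "inverse_arrows C f g \<Longrightarrow> iso C f"
  by (auto simp: iso_def)

lemma iso_Arr: "iso C f \<Longrightarrow> f \<in> Arr C"
  by (auto simp: iso_def inverse_arrows_def)

lemma inv_Arr [simp]: "iso C f \<Longrightarrow> inv_arr C f \<in> Arr C"
  and Dom_inv [simp]: "iso C f \<Longrightarrow> Dom C (inv_arr C f) = Cod C f"
  and Cod_inv [simp]: "iso C f \<Longrightarrow> Cod C (inv_arr C f) = Dom C f"
  and inv_Cmp [simp]: "iso C f \<Longrightarrow> inv_arr C f \<cdot> f = \<one> (Dom C f)"
  and Cmp_inv [simp]: "iso C f \<Longrightarrow> f \<cdot> inv_arr C f = \<one> (Cod C f)"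
  using iso_inverse by (auto simp: inverse_arrows_def Hom_def)

lemma inv_Cmp_Cmp [simp]: "\<lbrakk>iso C f; g \<in> Arr C; Cod C g = Dom C f\<rbrakk> \<Longrightarrow> inv_arr C f \<cdot> (f \<cdot> g) = g"
  using assoc[of g f "inv_arr C f"] iso_Arr[of f] by simp

lemma inverse_arrows_sym: "inverse_arrows C f g \<Longrightarrow> inverse_arrows C g f"
  by (auto simp: inverse_arrows_def Hom_def)

lemma iso_inv [simp]: "iso C f \<Longrightarrow> iso C (inv_arr C f)"
  by (meson inverse_arrows_sym isoI iso_inverse)

lemma iso_Ident [simp]: "x \<in> Obj C \<Longrightarrow> iso C (\<one> x)"
  by (rule isoI[of _ "\<one> x"], rule inverse_arrowsI) auto

lemma inv_Ident [simp]: "x \<in> Obj C \<Longrightarrow> inv_arr C (\<one> x) = \<one> x"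
  by (rule inv_arr_eq, rule inverse_arrowsI) auto

lemma inverse_arrows_Cmp:
  assumes "inverse_arrows C f f'" "inverse_arrows C g g'" "Dom C g = Cod C f"
  shows "inverse_arrows C (g \<cdot> f) (f' \<cdot> g')"
proof -
  have *: "f \<in> Arr C" "f' \<in> Arr C" "Dom C f' = Cod C f" "Cod C f' = Dom C f" "f' \<cdot> f = \<one> (Dom C f)"
     "f \<cdot> f' = \<one> (Cod C f)" "g \<in> Arr C" "g' \<in> Arr C" "Dom C g' = Cod C g" "Cod C g' = Dom C g"
     "g' \<cdot> g = \<one> (Dom C g)" "g \<cdot> g' = \<one> (Cod C g)" "Dom C g = Cod C f"
    using assms by (auto simp: inverse_arrows_def Hom_def)
  have "g' \<cdot> (g \<cdot> f) = f" using * assoc[of f g g'] by simp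
  moreover have "f \<cdot> (f' \<cdot> g') = g'" using * assoc[of g' f' f] by simp
  ultimately show ?thesis using * by (intro inverse_arrowsI) simp_all
qed

lemma iso_Cmp [simp]: "\<lbrakk>iso C f; iso C g; Dom C g = Cod C f\<rbrakk> \<Longrightarrow> iso C (g \<cdot> f)"
  by (meson inverse_arrows_Cmp isoI iso_inverse)

lemma inv_arr_Cmp: "\<lbrakk>iso C f; iso C g; Dom C g = Cod C f\<rbrakk>
    \<Longrightarrow> inv_arr C (g \<cdot> f) = inv_arr C f \<cdot> inv_arr C g"
  by (meson inverse_arrows_Cmp inv_arr_eq iso_inverse)

text \<open>The cancellation behind most arguments about T: an equation is first proved after
  precomposition with an invertible \<open>fc2 P\<close> or \<open>fc0 P\<close>.\<close>

lemma iso_cancel_right: "\<lbrakk>g \<cdot> f = h \<cdot> f; iso C f; g \<in> Arr C; h \<in> Arr C; Dom C g = Cod C f;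
    Dom C h = Cod C f\<rbrakk> \<Longrightarrow> g = h"
  by (metis assoc Cmp_inv Dom_inv Cod_inv inv_Arr id_right iso_Arr)

text \<open>Transposes a naturality square to inverse arrows. It yields inverses of monoidal
  transformations and naturality at inverses of arrows of T.\<close>

lemma inv_commute:
  assumes "f' \<cdot> s = t \<cdot> f" "iso C f" "iso C f'" "s \<in> Arr C" "t \<in> Arr C"
    "Cod C s = Dom C f'" "Dom C t = Cod C f" "Dom C s = Dom C f" "Cod C t = Cod C f'"
  shows "inv_arr C f' \<cdot> t = s \<cdot> inv_arr C f"
proof -
  note [simp] = iso_Arr[OF assms(2)] iso_Arr[OF assms(3)]
  have "inv_arr C f' \<cdot> t = inv_arr C f' \<cdot> ((t \<cdot> f) \<cdot> inv_arr C f)" using assms(2-) by simp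
  also have "\<dots> = inv_arr C f' \<cdot> ((f' \<cdot> s) \<cdot> inv_arr C f)" using assms(1) by simp
  also have "\<dots> = s \<cdot> inv_arr C f" using assms(2-) by simp
  finally show ?thesis .
qed

end

section \<open>Functors in terms of domains and codomains\<close>

lemma (in is_functor) fm_Arr [simp]: "f \<in> Arr X \<Longrightarrow> fm F f \<in> Arr Y"
  and Dom_fm [simp]: "f \<in> Arr X \<Longrightarrow> Dom Y (fm F f) = fo F (Dom X f)"
  and Cod_fm [simp]: "f \<in> Arr X \<Longrightarrow> Cod Y (fm F f) = fo F (Cod X f)"
  using fm_in[of f "Dom X f" "Cod X f"] by (auto simp: Hom_def)

lemma (in is_functor) fm_comp:
  "\<lbrakk>f \<in> Arr X; g \<in> Arr X; Dom X g = Cod X f\<rbrakk> \<Longrightarrow> fm F (g \<cdot>\<^bsub>X\<^esub> f) = fm F g \<cdot>\<^bsub>Y\<^esub> fm F f"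
  using fm_Cmp[of f "Dom X f" "Cod X f" g "Cod X g"] by (simp add: Hom_def)

lemma (in is_functor) inverse_arrows_fm:
  "inverse_arrows X f g \<Longrightarrow> inverse_arrows Y (fm F f) (fm F g)"
  using fm_comp[of f g] fm_comp[of g f]
  by (auto simp: inverse_arrows_def Hom_def fm_Ident)

lemma (in is_functor) iso_fm [simp]: "iso X f \<Longrightarrow> iso Y (fm F f)"
  by (meson inverse_arrows_fm X.iso_inverse Y.isoI)

lemma (in is_functor) fm_inv: "iso X f \<Longrightarrow> fm F (inv_arr X f) = inv_arr Y (fm F f)"
  using inverse_arrows_fm X.iso_inverse Y.inv_arr_eq by metis

lemma is_functorI:
  assumes "category X" "category Y"
    and "\<And>x. x \<in> Obj X \<Longrightarrow> fo F x \<in> Obj Y"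
    and "\<And>f. f \<in> Arr X \<Longrightarrow> fm F f \<in> Arr Y" "\<And>f. f \<in> Arr X \<Longrightarrow> Dom Y (fm F f) = fo F (Dom X f)"
      "\<And>f. f \<in> Arr X \<Longrightarrow> Cod Y (fm F f) = fo F (Cod X f)"
    and "\<And>x. x \<in> Obj X \<Longrightarrow> fm F (\<one>\<^bsub>X\<^esub> x) = \<one>\<^bsub>Y\<^esub> (fo F x)"
    and "\<And>f g. \<lbrakk>f \<in> Arr X; g \<in> Arr X; Dom X g = Cod X f\<rbrakk> \<Longrightarrow> fm F (g \<cdot>\<^bsub>X\<^esub> f) = fm F g \<cdot>\<^bsub>Y\<^esub> fm F f"
  shows "is_functor X Y F"
  by (rule is_functor.intro[OF assms(1,2)], unfold_locales) (use assms in \<open>auto simp: Hom_def\<close>)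

section \<open>Permutative categories: units, hexagons and the middle four interchange\<close>

context permutative
begin

lemma Obj_Osum [simp]: "\<lbrakk>x \<in> Obj C; y \<in> Obj C\<rbrakk> \<Longrightarrow> x \<oplus> y \<in> Obj C"
  by (rule Osum_in)

lemma Obj_Zero [simp]: "\<zero> \<in> Obj C" by (rule Zero_in)

declare Osum_assoc [simp] Osum_Zero_left [simp] Osum_Zero_right [simp]
  Asum_assoc [simp] Asum_Zero_left [simp] Asum_Zero_right [simp] Asum_Ident [simp]

lemma Asum_Arr [simp]: "\<lbrakk>f \<in> Arr C; g \<in> Arr C\<rbrakk> \<Longrightarrow> f \<boxplus> g \<in> Arr C"
  and Dom_Asum [simp]: "\<lbrakk>f \<in> Arr C; g \<in> Arr C\<rbrakk> \<Longrightarrow> Dom C (f \<boxplus> g) = Dom C f \<oplus> Dom C g"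
  and Cod_Asum [simp]: "\<lbrakk>f \<in> Arr C; g \<in> Arr C\<rbrakk> \<Longrightarrow> Cod C (f \<boxplus> g) = Cod C f \<oplus> Cod C g"
  using Asum_in[of f "Dom C f" "Cod C f" g "Dom C g" "Cod C g"] by (auto simp: Hom_def)

lemma Asum_Ident_Ident [simp]: "\<lbrakk>x \<in> Obj C; y \<in> Obj C; f \<in> Arr C\<rbrakk>
    \<Longrightarrow> \<one> x \<boxplus> (\<one> y \<boxplus> f) = \<one> (x \<oplus> y) \<boxplus> f"
  using Asum_assoc[of "\<one> x" "\<one> y" f] by simp

lemma interchange: "\<lbrakk>f \<in> Arr C; g \<in> Arr C; f' \<in> Arr C; g' \<in> Arr C; Dom C g = Cod C f; Dom C g' = Cod C f'\<rbrakk>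
    \<Longrightarrow> (g \<boxplus> g') \<cdot> (f \<boxplus> f') = (g \<cdot> f) \<boxplus> (g' \<cdot> f')"
  using Asum_Cmp[of f "Dom C f" "Cod C f" g "Cod C g" f' "Dom C f'" "Cod C f'" g' "Cod C g'"]
  by (simp add: Hom_def)

lemma interchange_Cmp: "\<lbrakk>f \<in> Arr C; g \<in> Arr C; f' \<in> Arr C; g' \<in> Arr C; h \<in> Arr C; Dom C g = Cod C f;
    Dom C g' = Cod C f'; Cod C h = Dom C f \<oplus> Dom C f'\<rbrakk>
    \<Longrightarrow> (g \<boxplus> g') \<cdot> ((f \<boxplus> f') \<cdot> h) = ((g \<cdot> f) \<boxplus> (g' \<cdot> f')) \<cdot> h"
  using assoc[of h "f \<boxplus> f'" "g \<boxplus> g'"] interchange[of f g f' g'] by simp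

lemma Sym_Arr [simp]: "\<lbrakk>x \<in> Obj C; y \<in> Obj C\<rbrakk> \<Longrightarrow> \<beta> x y \<in> Arr C"
  and Dom_Sym [simp]: "\<lbrakk>x \<in> Obj C; y \<in> Obj C\<rbrakk> \<Longrightarrow> Dom C (\<beta> x y) = x \<oplus> y"
  and Cod_Sym [simp]: "\<lbrakk>x \<in> Obj C; y \<in> Obj C\<rbrakk> \<Longrightarrow> Cod C (\<beta> x y) = y \<oplus> x"
  using Sym_in[of x y] by (auto simp: Hom_def)

declare Sym_Sym [simp]

lemma Sym_nat: "\<lbrakk>f \<in> Arr C; g \<in> Arr C; Cod C f = x; Cod C g = y\<rbrakk>
    \<Longrightarrow> \<beta> x y \<cdot> (f \<boxplus> g) = (g \<boxplus> f) \<cdot> \<beta> (Dom C f) (Dom C g)"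
  using Sym_natural[of f "Dom C f" "Cod C f" g "Dom C g" "Cod C g"] by (simp add: Hom_def)

lemma iso_Sym [simp]: "\<lbrakk>x \<in> Obj C; y \<in> Obj C\<rbrakk> \<Longrightarrow> iso C (\<beta> x y)"
  by (rule isoI[of _ "\<beta> y x"], rule inverse_arrowsI) auto

lemma inv_Sym [simp]: "\<lbrakk>x \<in> Obj C; y \<in> Obj C\<rbrakk> \<Longrightarrow> inv_arr C (\<beta> x y) = \<beta> y x"
  by (rule inv_arr_eq, rule inverse_arrowsI) auto

text \<open>The hexagon at y = z = 0 makes this symmetry idempotent, and an invertible idempotent is
  an identity.\<close>

lemma Sym_Zero_right [simp]: "x \<in> Obj C \<Longrightarrow> \<beta> x \<zero> = \<one> x"
proof -
  assume x: "x \<in> Obj C"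
  have "\<beta> x \<zero> \<cdot> \<beta> x \<zero> = \<one> x \<cdot> \<beta> x \<zero>"
    using Sym_Osum[of x \<zero> \<zero>] x by simp
  then show ?thesis
    by (rule iso_cancel_right) (use x in auto)
qed

lemma Sym_Zero_left [simp]: "x \<in> Obj C \<Longrightarrow> \<beta> \<zero> x = \<one> x"
  using Sym_Sym[of x \<zero>] by simp

text \<open>The second hexagon is the inverse of the first: both sides are inverse to the symmetry
  of z with \<open>x \<oplus> y\<close>.\<close>

lemma Osum_Sym:
  assumes "x \<in> Obj C" "y \<in> Obj C" "z \<in> Obj C"
  shows "\<beta> (x \<oplus> y) z = (\<beta> x z \<boxplus> \<one> y) \<cdot> (\<one> x \<boxplus> \<beta> y z)"
proof -
  have "inverse_arrows C (\<beta> z (x \<oplus> y)) ((\<beta> x z \<boxplus> \<one> y) \<cdot> (\<one> x \<boxplus> \<beta> y z))"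
    using assms
    by (intro inverse_arrowsI) (simp_all add: Sym_Osum interchange interchange_Cmp)
  then show ?thesis
    using inv_arr_eq inv_Sym assms by (metis Obj_Osum)
qed

lemma inverse_arrows_Asum:
  assumes "inverse_arrows C f f'" "inverse_arrows C g g'"
  shows "inverse_arrows C (f \<boxplus> g) (f' \<boxplus> g')"
  using assms by (auto simp: inverse_arrows_def Hom_def interchange)

lemma iso_Asum [simp]: "\<lbrakk>iso C f; iso C g\<rbrakk> \<Longrightarrow> iso C (f \<boxplus> g)"
  by (meson inverse_arrows_Asum isoI iso_inverse)

lemma inv_Asum: "\<lbrakk>iso C f; iso C g\<rbrakk> \<Longrightarrow> inv_arr C (f \<boxplus> g) = inv_arr C f \<boxplus> inv_arr C g"
  by (meson inverse_arrows_Asum inv_arr_eq iso_inverse)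

text \<open>The middle four interchange, which defines the constraint of a sum of functors.\<close>

definition mid :: "'o \<Rightarrow> 'o \<Rightarrow> 'o \<Rightarrow> 'o \<Rightarrow> 'm" where
  "mid a b c d = \<one> a \<boxplus> \<beta> b c \<boxplus> \<one> d"

lemma mid_Arr [simp]: "\<lbrakk>a \<in> Obj C; b \<in> Obj C; c \<in> Obj C; d \<in> Obj C\<rbrakk> \<Longrightarrow> mid a b c d \<in> Arr C"
  and Dom_mid [simp]: "\<lbrakk>a \<in> Obj C; b \<in> Obj C; c \<in> Obj C; d \<in> Obj C\<rbrakk>
    \<Longrightarrow> Dom C (mid a b c d) = a \<oplus> (b \<oplus> (c \<oplus> d))"
  and Cod_mid [simp]: "\<lbrakk>a \<in> Obj C; b \<in> Obj C; c \<in> Obj C; d \<in> Obj C\<rbrakk>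
    \<Longrightarrow> Cod C (mid a b c d) = a \<oplus> (c \<oplus> (b \<oplus> d))"
  and iso_mid [simp]: "\<lbrakk>a \<in> Obj C; b \<in> Obj C; c \<in> Obj C; d \<in> Obj C\<rbrakk> \<Longrightarrow> iso C (mid a b c d)"
  by (simp_all add: mid_def)

lemma mid_mid:
  "\<lbrakk>a \<in> Obj C; b \<in> Obj C; c \<in> Obj C; d \<in> Obj C\<rbrakk> \<Longrightarrow> mid a c b d \<cdot> mid a b c d = \<one> (a \<oplus> (b \<oplus> (c \<oplus> d)))"
  by (simp add: mid_def interchange)

lemma mid_Zero:
  "\<lbrakk>a \<in> Obj C; b \<in> Obj C; c \<in> Obj C\<rbrakk> \<Longrightarrow> mid a \<zero> b c = \<one> (a \<oplus> (b \<oplus> c))"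
  "\<lbrakk>a \<in> Obj C; b \<in> Obj C; c \<in> Obj C\<rbrakk> \<Longrightarrow> mid a b \<zero> c = \<one> (a \<oplus> (b \<oplus> c))"
  by (simp_all add: mid_def)

lemma mid_nat:
  assumes [simp]: "f \<in> Arr C" "g \<in> Arr C" "h \<in> Arr C" "k \<in> Arr C"
    and [symmetric, simp]: "Cod C f = a" "Cod C g = b" "Cod C h = c" "Cod C k = d"
  shows "mid a b c d \<cdot> (f \<boxplus> (g \<boxplus> (h \<boxplus> k)))
    = (f \<boxplus> (h \<boxplus> (g \<boxplus> k))) \<cdot> mid (Dom C f) (Dom C g) (Dom C h) (Dom C k)"
proof -
  \<comment> \<open>Only the two inner arrows are interchanged, so naturality of \<beta> is used for
    g and h with k carried along; f is added afterwards by interchange.\<close>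
  have "(\<beta> b c \<boxplus> \<one> d) \<cdot> ((g \<boxplus> h) \<boxplus> k) = ((h \<boxplus> g) \<boxplus> k) \<cdot> (\<beta> (Dom C g) (Dom C h) \<boxplus> \<one> (Dom C k))"
    by (simp add: interchange Sym_nat del: Asum_assoc)
  then show ?thesis by (simp add: mid_def interchange)
qed

end

context permutative
begin

text \<open>The simplifier keeps composites nested to the right; \<open>assoc_eq\<close> and \<open>assoc_eq1\<close> apply an equation
  between short composites at the head of a longer one.\<close>

lemma assoc_eq:
  assumes "l \<cdot> m = r \<cdot> s" "l \<in> Arr C" "m \<in> Arr C" "r \<in> Arr C" "s \<in> Arr C" "h \<in> Arr C"
    "Dom C l = Cod C m" "Dom C r = Cod C s" "Dom C m = Cod C h" "Dom C s = Cod C h"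
  shows "l \<cdot> (m \<cdot> h) = r \<cdot> (s \<cdot> h)"
  using assoc[of h m l] assoc[of h s r] assms by simp

lemma assoc_eq1:
  assumes "l \<cdot> m = r" "l \<in> Arr C" "m \<in> Arr C" "h \<in> Arr C"
    "Dom C l = Cod C m" "Dom C m = Cod C h"
  shows "l \<cdot> (m \<cdot> h) = r \<cdot> h"
  using assoc[of h m l] assms by simp

lemma whisker_left: "\<lbrakk>x \<in> Obj C; f \<in> Arr C; g \<in> Arr C; Dom C g = Cod C f\<rbrakk>
    \<Longrightarrow> \<one> x \<boxplus> (g \<cdot> f) = (\<one> x \<boxplus> g) \<cdot> (\<one> x \<boxplus> f)"
  by (simp add: interchange)

lemma whisker_right: "\<lbrakk>x \<in> Obj C; f \<in> Arr C; g \<in> Arr C; Dom C g = Cod C f\<rbrakk>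
    \<Longrightarrow> (g \<cdot> f) \<boxplus> \<one> x = (g \<boxplus> \<one> x) \<cdot> (f \<boxplus> \<one> x)"
  by (simp add: interchange)

text \<open>The coherence behind associativity of the constraint of a sum of functors. The outer
  objects a and f never move; stripped of them, both sides carry b, c, d, e to c, e, b, d, and the
  hexagons reduce their equality to interchange.\<close>

lemma mid_assoc:
  assumes "a \<in> Obj C" "b \<in> Obj C" "c \<in> Obj C" "d \<in> Obj C" "e \<in> Obj C" "f \<in> Obj C"
  shows "mid (a \<oplus> c) (b \<oplus> d) e f \<cdot> (mid a b c d \<boxplus> \<one> (e \<oplus> f))
    = mid a b (c \<oplus> e) (d \<oplus> f) \<cdot> (\<one> (a \<oplus> b) \<boxplus> mid c d e f)"
proof -
  have *: "(\<one> c \<boxplus> \<beta> (b \<oplus> d) e) \<cdot> (\<beta> b c \<boxplus> \<one> (d \<oplus> e))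
      = (\<beta> b (c \<oplus> e) \<boxplus> \<one> d) \<cdot> (\<one> (b \<oplus> c) \<boxplus> \<beta> d e)"
    using assms
    by (simp add: Sym_Osum Osum_Sym whisker_left whisker_right) (simp add: interchange)
  have "mid (a \<oplus> c) (b \<oplus> d) e f \<cdot> (mid a b c d \<boxplus> \<one> (e \<oplus> f))
      = (\<one> a \<boxplus> ((\<one> c \<boxplus> \<beta> (b \<oplus> d) e) \<boxplus> \<one> f)) \<cdot> (\<one> a \<boxplus> ((\<beta> b c \<boxplus> \<one> (d \<oplus> e)) \<boxplus> \<one> f))"
    using assms by (simp add: mid_def)
  also have "\<dots> = \<one> a \<boxplus> ((\<one> c \<boxplus> \<beta> (b \<oplus> d) e) \<cdot> (\<beta> b c \<boxplus> \<one> (d \<oplus> e)) \<boxplus> \<one> f)"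
    using assms by (subst interchange; simp del: Asum_assoc Asum_Ident_Ident)
      (subst interchange; simp del: Asum_assoc Asum_Ident_Ident)
  also have "\<dots> = (\<one> a \<boxplus> ((\<beta> b (c \<oplus> e) \<boxplus> \<one> d) \<boxplus> \<one> f)) \<cdot> (\<one> a \<boxplus> ((\<one> (b \<oplus> c) \<boxplus> \<beta> d e) \<boxplus> \<one> f))"
    unfolding * using assms by (subst interchange; simp del: Asum_assoc Asum_Ident_Ident)
      (subst interchange; simp del: Asum_assoc Asum_Ident_Ident)
  also have "\<dots> = mid a b (c \<oplus> e) (d \<oplus> f) \<cdot> (\<one> (a \<oplus> b) \<boxplus> mid c d e f)"
    using assms by (simp add: mid_def)
  finally show ?thesis .
qed

text \<open>The coherence behind associativity of \<open>smf_plus\<close> itself, where three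
  functors are evaluated at two objects; the proof again strips off a and f.\<close>

lemma mid_assoc2:
  assumes "a \<in> Obj C" "b \<in> Obj C" "c \<in> Obj C" "d \<in> Obj C" "e \<in> Obj C" "f \<in> Obj C"
  shows "(mid a b d e \<boxplus> \<one> (c \<oplus> f)) \<cdot> mid (a \<oplus> b) c (d \<oplus> e) f
    = (\<one> (a \<oplus> d) \<boxplus> mid b c e f) \<cdot> mid a (b \<oplus> c) d (e \<oplus> f)"
proof -
  have *: "(\<beta> b d \<boxplus> \<one> (e \<oplus> c)) \<cdot> (\<one> b \<boxplus> \<beta> c (d \<oplus> e))
      = (\<one> (d \<oplus> b) \<boxplus> \<beta> c e) \<cdot> (\<beta> (b \<oplus> c) d \<boxplus> \<one> e)"
    using assms
    by (simp add: Sym_Osum Osum_Sym whisker_left whisker_right) (simp add: interchange_Cmp)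
  have "(mid a b d e \<boxplus> \<one> (c \<oplus> f)) \<cdot> mid (a \<oplus> b) c (d \<oplus> e) f
      = (\<one> a \<boxplus> ((\<beta> b d \<boxplus> \<one> (e \<oplus> c)) \<boxplus> \<one> f)) \<cdot> (\<one> a \<boxplus> ((\<one> b \<boxplus> \<beta> c (d \<oplus> e)) \<boxplus> \<one> f))"
    using assms by (simp add: mid_def)
  also have "\<dots> = \<one> a \<boxplus> ((\<beta> b d \<boxplus> \<one> (e \<oplus> c)) \<cdot> (\<one> b \<boxplus> \<beta> c (d \<oplus> e)) \<boxplus> \<one> f)"
    using assms by (subst interchange; simp del: Asum_assoc Asum_Ident_Ident)
      (subst interchange; simp del: Asum_assoc Asum_Ident_Ident)
  also have "\<dots> = (\<one> a \<boxplus> ((\<one> (d \<oplus> b) \<boxplus> \<beta> c e) \<boxplus> \<one> f)) \<cdot> (\<one> a \<boxplus> ((\<beta> (b \<oplus> c) d \<boxplus> \<one> e) \<boxplus> \<one> f))"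
    unfolding * using assms by (subst interchange; simp del: Asum_assoc Asum_Ident_Ident)
      (subst interchange; simp del: Asum_assoc Asum_Ident_Ident)
  also have "\<dots> = (\<one> (a \<oplus> d) \<boxplus> mid b c e f) \<cdot> mid a (b \<oplus> c) d (e \<oplus> f)"
    using assms by (simp add: mid_def)
  finally show ?thesis .
qed

text \<open>Exchanging two blocks of two amounts to shuffling, exchanging componentwise and
  shuffling back. Since \<open>mid\<close> is inverted by \<open>mid\<close>, either shuffle can be
  moved across: \<open>Sym_mid_left\<close> serves the symmetry axiom of a sum of functors,
  \<open>Sym_mid_right\<close> the monoidality of the pointwise symmetry.\<close>

lemma Sym_mid:
  assumes "a \<in> Obj C" "b \<in> Obj C" "c \<in> Obj C" "d \<in> Obj C"
  shows "\<beta> (a \<oplus> b) (c \<oplus> d) = mid c a d b \<cdot> ((\<beta> a c \<boxplus> \<beta> b d) \<cdot> mid a b c d)"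
proof -
  have "\<beta> a c \<boxplus> \<beta> b d = (\<one> (c \<oplus> a) \<boxplus> \<beta> b d) \<cdot> (\<beta> a c \<boxplus> \<one> (b \<oplus> d))"
    using assms by (simp add: interchange)
  then show ?thesis using assms
    by (simp add: mid_def Sym_Osum Osum_Sym whisker_left whisker_right)
qed

lemma Sym_mid_left:
  assumes "a \<in> Obj C" "b \<in> Obj C" "c \<in> Obj C" "d \<in> Obj C"
  shows "(\<beta> a c \<boxplus> \<beta> b d) \<cdot> mid a b c d = mid c d a b \<cdot> \<beta> (a \<oplus> b) (c \<oplus> d)"
  using assms mid_mid by (simp add: Sym_mid assoc_eq1[OF mid_mid])

lemma Sym_mid_right:
  assumes "a \<in> Obj C" "b \<in> Obj C" "c \<in> Obj C" "d \<in> Obj C"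
  shows "\<beta> (a \<oplus> c) (b \<oplus> d) \<cdot> mid a b c d = mid b a d c \<cdot> (\<beta> a b \<boxplus> \<beta> c d)"
  using assms mid_mid by (simp add: Sym_mid)

end

section \<open>Equality of symmetric monoidal functors and of transformations, and rules for a pair
  of categories\<close>

lemma fo_restrict [simp]: "x \<in> Obj A \<Longrightarrow> fo (smf_restrict A F) x = fo F x"
  and fm_restrict [simp]: "f \<in> Arr A \<Longrightarrow> fm (smf_restrict A F) f = fm F f"
  and fc2_restrict [simp]: "\<lbrakk>x \<in> Obj A; y \<in> Obj A\<rbrakk> \<Longrightarrow> fc2 (smf_restrict A F) x y = fc2 F x y"
  and fc0_restrict [simp]: "fc0 (smf_restrict A F) = fc0 F"
  by (simp_all add: smf_restrict_def)

lemma smf_restrict_restrict [simp]: "smf_restrict A (smf_restrict A F) = smf_restrict A F"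
  by (auto simp: smf_restrict_def fun_eq_iff)

lemma smf_eqI:
  assumes "smf_restrict A F = F" "smf_restrict A G = G"
    and "\<And>x. x \<in> Obj A \<Longrightarrow> fo F x = fo G x" "\<And>f. f \<in> Arr A \<Longrightarrow> fm F f = fm G f"
      "\<And>x y. \<lbrakk>x \<in> Obj A; y \<in> Obj A\<rbrakk> \<Longrightarrow> fc2 F x y = fc2 G x y" "fc0 F = fc0 G"
  shows "F = G"
proof -
  have "smf_restrict A F = smf_restrict A G"
    using assms(3-) unfolding smf_restrict_def by (auto simp: fun_eq_iff)
  then show ?thesis using assms by metis
qed

lemma mt_eqI:
  fixes \<phi> \<psi> :: "('o1, 'm1, 'o2, 'm2) mtrans"
  assumes "src \<phi> = src \<psi>" "tgt \<phi> = tgt \<psi>" "cmpt \<phi> \<in> extensional (Obj A)" "cmpt \<psi> \<in> extensional (Obj A)"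
    and "\<And>x. x \<in> Obj A \<Longrightarrow> cmpt \<phi> x = cmpt \<psi> x"
  shows "\<phi> = \<psi>"
proof -
  have "cmpt \<phi> = cmpt \<psi>" using assms(3-) by (rule extensionalityI)
  with assms(1,2) show ?thesis by (cases \<phi>; cases \<psi>) simp
qed

locale perm_pair = A: permutative A + B: permutative B
  for A :: "('o1, 'm1) pcat" and B :: "('o2, 'm2) pcat" (structure)
begin

context
  fixes F assumes F: "sym_mon_functor A B F"
begin

interpretation F: sym_mon_functor A B F by (rule F)

text \<open>The locale facts are restated as rules conditional on
  \<open>sym_mon_functor A B F\<close>, so that they apply to compound terms such as
  \<open>src \<phi>\<close> or \<open>smf_comp A C G F\<close> without an interpretation for each of
  them.\<close>

lemma fo_Obj [simp]: "x \<in> Obj A \<Longrightarrow> fo F x \<in> Obj B"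
  by (rule F.fo_in)

lemma fm_Arr [simp]: "f \<in> Arr A \<Longrightarrow> fm F f \<in> Arr B"
  and Dom_fm [simp]: "f \<in> Arr A \<Longrightarrow> Dom B (fm F f) = fo F (Dom A f)"
  and Cod_fm [simp]: "f \<in> Arr A \<Longrightarrow> Cod B (fm F f) = fo F (Cod A f)"
  by simp_all

lemma fm_Ident [simp]: "x \<in> Obj A \<Longrightarrow> fm F (\<one>\<^bsub>A\<^esub> x) = \<one> (fo F x)"
  by (rule F.fm_Ident)

lemma fm_Cmp [simp]:
  "\<lbrakk>f \<in> Arr A; g \<in> Arr A; Dom A g = Cod A f\<rbrakk> \<Longrightarrow> fm F (g \<cdot>\<^bsub>A\<^esub> f) = fm F g \<cdot> fm F f"
  by (rule F.fm_comp)

lemma iso_fm [simp]: "iso A f \<Longrightarrow> iso B (fm F f)"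
  by simp

lemma fc2_Arr [simp]: "\<lbrakk>x \<in> Obj A; y \<in> Obj A\<rbrakk> \<Longrightarrow> fc2 F x y \<in> Arr B"
  and Dom_fc2 [simp]: "\<lbrakk>x \<in> Obj A; y \<in> Obj A\<rbrakk> \<Longrightarrow> Dom B (fc2 F x y) = fo F x \<oplus> fo F y"
  and Cod_fc2 [simp]: "\<lbrakk>x \<in> Obj A; y \<in> Obj A\<rbrakk> \<Longrightarrow> Cod B (fc2 F x y) = fo F (x \<oplus>\<^bsub>A\<^esub> y)"
  using F.fc2_in[of x y] by (auto dest: HomD)

lemma fc0_Arr [simp]: "fc0 F \<in> Arr B" and Dom_fc0 [simp]: "Dom B (fc0 F) = \<zero>"
  and Cod_fc0 [simp]: "Cod B (fc0 F) = fo F \<zero>\<^bsub>A\<^esub>"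
  using F.fc0_in by (auto dest: HomD)

lemma iso_fc2 [simp]: "\<lbrakk>x \<in> Obj A; y \<in> Obj A\<rbrakk> \<Longrightarrow> iso B (fc2 F x y)"
  and iso_fc0 [simp]: "iso B (fc0 F)"
  by (rule F.fc2_iso F.fc0_iso; assumption)+

lemma fc2_nat: "\<lbrakk>f \<in> Arr A; g \<in> Arr A; Cod A f = x; Cod A g = y\<rbrakk> \<Longrightarrow>
    fc2 F x y \<cdot> (fm F f \<boxplus> fm F g) = fm F (f \<boxplus>\<^bsub>A\<^esub> g) \<cdot> fc2 F (Dom A f) (Dom A g)"
  using F.fc2_natural[of f "Dom A f" x g "Dom A g" y] by (simp add: HomI)

lemma smf_extensional: "smf_restrict A F = F"
  by (rule F.extensional)

text \<open>A symmetric monoidal functor respects the middle four interchange. By associativity the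
  constraint of four summands is regrouped so that the two inner ones stand together; there the
  symmetry axiom applies.\<close>

lemma fc2_mid:
  assumes [simp]: "a \<in> Obj A" "b \<in> Obj A" "c \<in> Obj A" "d \<in> Obj A"
  shows "fc2 F (a \<oplus>\<^bsub>A\<^esub> b) (c \<oplus>\<^bsub>A\<^esub> d) \<cdot> ((fc2 F a b \<boxplus> fc2 F c d)
       \<cdot> B.mid (fo F a) (fo F c) (fo F b) (fo F d))
    = fm F (A.mid a c b d) \<cdot> (fc2 F (a \<oplus>\<^bsub>A\<^esub> c) (b \<oplus>\<^bsub>A\<^esub> d) \<cdot> (fc2 F a c \<boxplus> fc2 F b d))"
proof -
  note [simp] = fm_Arr Dom_fm Cod_fm fc2_Arr Dom_fc2 Cod_fc2 fo_Obj fm_Ident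
  \<comment> \<open>\<open>K3\<close> is the constraint of a threefold sum; associativity says that
    the other bracketing gives the same arrow (\<open>K3'\<close>).\<close>
  define K3 where "K3 b c d = fc2 F b (c \<oplus>\<^bsub>A\<^esub> d) \<cdot> (\<one> (fo F b) \<boxplus> fc2 F c d)" for b c d
  have K3 [simp]: "K3 b c d \<in> Arr B" "Dom B (K3 b c d) = fo F b \<oplus> (fo F c \<oplus> fo F d)"
      "Cod B (K3 b c d) = fo F (b \<oplus>\<^bsub>A\<^esub> (c \<oplus>\<^bsub>A\<^esub> d))" if "b \<in> Obj A" "c \<in> Obj A" "d \<in> Obj A" for b c d
    using that by (simp_all add: K3_def)
  have K3': "K3 b c d = fc2 F (b \<oplus>\<^bsub>A\<^esub> c) d \<cdot> (fc2 F b c \<boxplus> \<one> (fo F d))"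
    if "b \<in> Obj A" "c \<in> Obj A" "d \<in> Obj A" for b c d
    using that by (simp add: K3_def F.fc2_assoc)
  have 1: "fc2 F (a \<oplus>\<^bsub>A\<^esub> b) (c \<oplus>\<^bsub>A\<^esub> d) \<cdot> (fc2 F a b \<boxplus> fc2 F c d)
     = fc2 F a (b \<oplus>\<^bsub>A\<^esub> (c \<oplus>\<^bsub>A\<^esub> d)) \<cdot> (\<one> (fo F a) \<boxplus> K3 b c d)"
    if [simp]: "a \<in> Obj A" "b \<in> Obj A" "c \<in> Obj A" "d \<in> Obj A" for a b c d
  proof -
    have "fc2 F (a \<oplus>\<^bsub>A\<^esub> b) (c \<oplus>\<^bsub>A\<^esub> d) \<cdot> (fc2 F a b \<boxplus> fc2 F c d)
      = (fc2 F (a \<oplus>\<^bsub>A\<^esub> b) (c \<oplus>\<^bsub>A\<^esub> d) \<cdot> (fc2 F a b \<boxplus> \<one> (fo F (c \<oplus>\<^bsub>A\<^esub> d))))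
        \<cdot> (\<one> (fo F a \<oplus> fo F b) \<boxplus> fc2 F c d)"
      by (simp add: B.interchange)
    also have "\<dots> = fc2 F a (b \<oplus>\<^bsub>A\<^esub> (c \<oplus>\<^bsub>A\<^esub> d)) \<cdot> ((\<one> (fo F a) \<boxplus> fc2 F b (c \<oplus>\<^bsub>A\<^esub> d))
        \<cdot> (\<one> (fo F a) \<boxplus> (\<one> (fo F b) \<boxplus> fc2 F c d)))"
      by (simp add: F.fc2_assoc)
    finally show ?thesis by (simp add: B.interchange K3_def del: B.Asum_Ident_Ident)
  qed
  have 2: "K3 b c d \<cdot> (\<beta> (fo F c) (fo F b) \<boxplus> \<one> (fo F d))
      = fm F (\<beta>\<^bsub>A\<^esub> c b \<boxplus>\<^bsub>A\<^esub> \<one>\<^bsub>A\<^esub> d) \<cdot> K3 c b d"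
  proof -
    have "K3 b c d \<cdot> (\<beta> (fo F c) (fo F b) \<boxplus> \<one> (fo F d))
        = fc2 F (b \<oplus>\<^bsub>A\<^esub> c) d \<cdot> ((fm F (\<beta>\<^bsub>A\<^esub> c b) \<cdot> fc2 F c b) \<boxplus> (fm F (\<one>\<^bsub>A\<^esub> d) \<cdot> \<one> (fo F d)))"
      by (simp add: K3' B.interchange F.fc2_symmetry)
    also have "\<dots> = fc2 F (b \<oplus>\<^bsub>A\<^esub> c) d \<cdot> ((fm F (\<beta>\<^bsub>A\<^esub> c b) \<boxplus> fm F (\<one>\<^bsub>A\<^esub> d)) \<cdot> (fc2 F c b \<boxplus> \<one> (fo F d)))"
      by (subst B.interchange) simp_all
    also have "\<dots> = fm F (\<beta>\<^bsub>A\<^esub> c b \<boxplus>\<^bsub>A\<^esub> \<one>\<^bsub>A\<^esub> d) \<cdot> K3 c b d"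
      by (subst B.assoc_eq[OF fc2_nat]) (simp_all add: K3')
    finally show ?thesis .
  qed
  have "fc2 F (a \<oplus>\<^bsub>A\<^esub> b) (c \<oplus>\<^bsub>A\<^esub> d) \<cdot> ((fc2 F a b \<boxplus> fc2 F c d)
       \<cdot> B.mid (fo F a) (fo F c) (fo F b) (fo F d))
     = fc2 F a (b \<oplus>\<^bsub>A\<^esub> (c \<oplus>\<^bsub>A\<^esub> d)) \<cdot> (fm F (\<one>\<^bsub>A\<^esub> a) \<boxplus> (fm F (\<beta>\<^bsub>A\<^esub> c b \<boxplus>\<^bsub>A\<^esub> \<one>\<^bsub>A\<^esub> d) \<cdot> K3 c b d))"
    using 1 by (simp add: B.assoc_eq[OF 1] B.mid_def B.interchange 2)
  also have "\<dots> = fc2 F a (b \<oplus>\<^bsub>A\<^esub> (c \<oplus>\<^bsub>A\<^esub> d)) \<cdot> ((fm F (\<one>\<^bsub>A\<^esub> a) \<boxplus> fm F (\<beta>\<^bsub>A\<^esub> c b \<boxplus>\<^bsub>A\<^esub> \<one>\<^bsub>A\<^esub> d))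
       \<cdot> (\<one> (fo F a) \<boxplus> K3 c b d))"
    by (simp add: B.interchange)
  also have "\<dots> = fm F (A.mid a c b d) \<cdot> (fc2 F a (c \<oplus>\<^bsub>A\<^esub> (b \<oplus>\<^bsub>A\<^esub> d)) \<cdot> (\<one> (fo F a) \<boxplus> K3 c b d))"
    by (subst B.assoc_eq[OF fc2_nat]) (simp_all add: A.mid_def)
  finally show ?thesis by (simp add: 1)
qed

end

text \<open>The conclusion concerns \<open>smf_restrict A F\<close> because all functors below are
  defined as such restrictions. The right unit law is obtained from the left one and the symmetry
  axiom.\<close>

lemma sym_mon_functorI:
  assumes "\<And>x. x \<in> Obj A \<Longrightarrow> fo F x \<in> Obj B"
    and "\<And>f. f \<in> Arr A \<Longrightarrow> fm F f \<in> Arr B" "\<And>f. f \<in> Arr A \<Longrightarrow> Dom B (fm F f) = fo F (Dom A f)"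
      "\<And>f. f \<in> Arr A \<Longrightarrow> Cod B (fm F f) = fo F (Cod A f)"
    and "\<And>x. x \<in> Obj A \<Longrightarrow> fm F (\<one>\<^bsub>A\<^esub> x) = \<one> (fo F x)"
    and "\<And>f g. \<lbrakk>f \<in> Arr A; g \<in> Arr A; Dom A g = Cod A f\<rbrakk> \<Longrightarrow> fm F (g \<cdot>\<^bsub>A\<^esub> f) = fm F g \<cdot> fm F f"
    and "\<And>x y. \<lbrakk>x \<in> Obj A; y \<in> Obj A\<rbrakk> \<Longrightarrow> iso B (fc2 F x y)"
      "\<And>x y. \<lbrakk>x \<in> Obj A; y \<in> Obj A\<rbrakk> \<Longrightarrow> Dom B (fc2 F x y) = fo F x \<oplus> fo F y"
      "\<And>x y. \<lbrakk>x \<in> Obj A; y \<in> Obj A\<rbrakk> \<Longrightarrow> Cod B (fc2 F x y) = fo F (x \<oplus>\<^bsub>A\<^esub> y)"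
    and "\<And>f g. \<lbrakk>f \<in> Arr A; g \<in> Arr A\<rbrakk> \<Longrightarrow> fc2 F (Cod A f) (Cod A g) \<cdot> (fm F f \<boxplus> fm F g)
      = fm F (f \<boxplus>\<^bsub>A\<^esub> g) \<cdot> fc2 F (Dom A f) (Dom A g)"
    and "iso B (fc0 F)" "Dom B (fc0 F) = \<zero>" "Cod B (fc0 F) = fo F \<zero>\<^bsub>A\<^esub>"
    and "\<And>x y z. \<lbrakk>x \<in> Obj A; y \<in> Obj A; z \<in> Obj A\<rbrakk>
      \<Longrightarrow> fc2 F (x \<oplus>\<^bsub>A\<^esub> y) z \<cdot> (fc2 F x y \<boxplus> \<one> (fo F z))
        = fc2 F x (y \<oplus>\<^bsub>A\<^esub> z) \<cdot> (\<one> (fo F x) \<boxplus> fc2 F y z)"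
    and "\<And>x. x \<in> Obj A
      \<Longrightarrow> fc2 F \<zero>\<^bsub>A\<^esub> x \<cdot> (fc0 F \<boxplus> \<one> (fo F x)) = \<one> (fo F x)"
    and "\<And>x y. \<lbrakk>x \<in> Obj A; y \<in> Obj A\<rbrakk>
      \<Longrightarrow> fm F (\<beta>\<^bsub>A\<^esub> x y) \<cdot> fc2 F x y = fc2 F y x \<cdot> \<beta> (fo F x) (fo F y)"
  shows "sym_mon_functor A B (smf_restrict A F)"
proof -
  have [simp]: "fc2 F x y \<in> Arr B" if "x \<in> Obj A" "y \<in> Obj A" for x y
    using assms(7) that B.iso_Arr by blast
  have [simp]: "fc0 F \<in> Arr B"
    using assms(11) B.iso_Arr by blast
  \<comment> \<open>By naturality the symmetry of C with the zero object, an identity, carries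
    \<open>fc0 F\<close> to the other summand; then the symmetry axiom at the pair of 0 and x
    applies, where F sends the symmetry of A to an identity.\<close>
  have *: "fc2 F x \<zero>\<^bsub>A\<^esub> \<cdot> (\<one> (fo F x) \<boxplus> fc0 F) = \<one> (fo F x)" if x [simp]: "x \<in> Obj A" for x
  proof -
    have "fc2 F x \<zero>\<^bsub>A\<^esub> \<cdot> (\<one> (fo F x) \<boxplus> fc0 F)
        = fc2 F x \<zero>\<^bsub>A\<^esub> \<cdot> (\<beta> (fo F \<zero>\<^bsub>A\<^esub>) (fo F x) \<cdot> (fc0 F \<boxplus> \<one> (fo F x)))"
      using assms by (simp add: B.Sym_nat)
    also have "\<dots> = fc2 F \<zero>\<^bsub>A\<^esub> x \<cdot> (fc0 F \<boxplus> \<one> (fo F x))"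
      using assms assms(16)[of "\<zero>\<^bsub>A\<^esub>" x] by (subst B.assoc_eq1[where r = "fc2 F \<zero>\<^bsub>A\<^esub> x"]) simp_all
    finally show ?thesis using assms(15) x by simp
  qed
  show ?thesis
    by (intro sym_mon_functor.intro is_functorI A.permutative_axioms B.permutative_axioms
        A.category_axioms B.category_axioms, goal_cases)
      (unfold_locales; (use assms * in \<open>auto simp: Hom_def\<close>; fail) | use assms in \<open>auto simp: Hom_def\<close>; fail)+
qed

end

section \<open>Symmetric monoidal functors and the pointwise structure\<close>

lemma permutativeI:
  fixes C :: "('o, 'm) pcat" (structure)
  assumes "category C"
    and "\<And>x y. \<lbrakk>x \<in> Obj C; y \<in> Obj C\<rbrakk> \<Longrightarrow> x \<oplus> y \<in> Obj C" "\<zero> \<in> Obj C"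
    and "\<And>f g. \<lbrakk>f \<in> Arr C; g \<in> Arr C\<rbrakk> \<Longrightarrow> f \<boxplus> g \<in> Arr C"
      "\<And>f g. \<lbrakk>f \<in> Arr C; g \<in> Arr C\<rbrakk> \<Longrightarrow> Dom C (f \<boxplus> g) = Dom C f \<oplus> Dom C g"
      "\<And>f g. \<lbrakk>f \<in> Arr C; g \<in> Arr C\<rbrakk> \<Longrightarrow> Cod C (f \<boxplus> g) = Cod C f \<oplus> Cod C g"
    and "\<And>x y. \<lbrakk>x \<in> Obj C; y \<in> Obj C\<rbrakk> \<Longrightarrow> \<one> x \<boxplus> \<one> y = \<one> (x \<oplus> y)"
    and "\<And>f g f' g'. \<lbrakk>f \<in> Arr C; g \<in> Arr C; f' \<in> Arr C; g' \<in> Arr C; Dom C g = Cod C f; Dom C g' = Cod C f'\<rbrakk>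
      \<Longrightarrow> (g \<cdot> f) \<boxplus> (g' \<cdot> f') = (g \<boxplus> g') \<cdot> (f \<boxplus> f')"
    and "\<And>x y z. \<lbrakk>x \<in> Obj C; y \<in> Obj C; z \<in> Obj C\<rbrakk> \<Longrightarrow> (x \<oplus> y) \<oplus> z = x \<oplus> (y \<oplus> z)"
    and "\<And>x. x \<in> Obj C \<Longrightarrow> \<zero> \<oplus> x = x" "\<And>x. x \<in> Obj C \<Longrightarrow> x \<oplus> \<zero> = x"
    and "\<And>f g h. \<lbrakk>f \<in> Arr C; g \<in> Arr C; h \<in> Arr C\<rbrakk> \<Longrightarrow> (f \<boxplus> g) \<boxplus> h = f \<boxplus> (g \<boxplus> h)"
    and "\<And>f. f \<in> Arr C \<Longrightarrow> \<one> \<zero> \<boxplus> f = f" "\<And>f. f \<in> Arr C \<Longrightarrow> f \<boxplus> \<one> \<zero> = f"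
    and "\<And>x y. \<lbrakk>x \<in> Obj C; y \<in> Obj C\<rbrakk> \<Longrightarrow> \<beta> x y \<in> Arr C"
      "\<And>x y. \<lbrakk>x \<in> Obj C; y \<in> Obj C\<rbrakk> \<Longrightarrow> Dom C (\<beta> x y) = x \<oplus> y"
      "\<And>x y. \<lbrakk>x \<in> Obj C; y \<in> Obj C\<rbrakk> \<Longrightarrow> Cod C (\<beta> x y) = y \<oplus> x"
    and "\<And>f g. \<lbrakk>f \<in> Arr C; g \<in> Arr C\<rbrakk> \<Longrightarrow> \<beta> (Cod C f) (Cod C g) \<cdot> (f \<boxplus> g) = (g \<boxplus> f) \<cdot> \<beta> (Dom C f) (Dom C g)"
    and "\<And>x y. \<lbrakk>x \<in> Obj C; y \<in> Obj C\<rbrakk> \<Longrightarrow> \<beta> y x \<cdot> \<beta> x y = \<one> (x \<oplus> y)"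
    and "\<And>x y z. \<lbrakk>x \<in> Obj C; y \<in> Obj C; z \<in> Obj C\<rbrakk> \<Longrightarrow> \<beta> x (y \<oplus> z) = (\<one> y \<boxplus> \<beta> x z) \<cdot> (\<beta> x y \<boxplus> \<one> z)"
  shows "permutative C"
  by (rule permutative.intro[OF assms(1)], unfold_locales) (use assms(2-) in \<open>auto simp: Hom_def\<close>)

context perm_pair
begin

context
  fixes \<phi> assumes \<phi>: "mon_trans A B \<phi>"
begin

interpretation mon_trans A B \<phi> by (rule \<phi>)

lemma src_smf [simp]: "sym_mon_functor A B (src \<phi>)" and tgt_smf [simp]: "sym_mon_functor A B (tgt \<phi>)"
  by unfold_locales

lemma cmpt_Arr [simp]: "x \<in> Obj A \<Longrightarrow> cmpt \<phi> x \<in> Arr B"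
  and Dom_cmpt [simp]: "x \<in> Obj A \<Longrightarrow> Dom B (cmpt \<phi> x) = fo (src \<phi>) x"
  and Cod_cmpt [simp]: "x \<in> Obj A \<Longrightarrow> Cod B (cmpt \<phi> x) = fo (tgt \<phi>) x"
  using cmpt_in[of x] by (auto simp: Hom_def)

lemma cmpt_nat: "\<lbrakk>f \<in> Arr A; Cod A f = y\<rbrakk> \<Longrightarrow>
    cmpt \<phi> y \<cdot> fm (src \<phi>) f = fm (tgt \<phi>) f \<cdot> cmpt \<phi> (Dom A f)"
  using cmpt_natural[of f "Dom A f" y] by (simp add: Hom_def)

lemma cmpt_sum: "\<lbrakk>x \<in> Obj A; y \<in> Obj A\<rbrakk> \<Longrightarrow> cmpt \<phi> (x \<oplus>\<^bsub>A\<^esub> y) \<cdot> fc2 (src \<phi>) x y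
    = fc2 (tgt \<phi>) x y \<cdot> (cmpt \<phi> x \<boxplus> cmpt \<phi> y)"
  by (rule cmpt_fc2)

lemma cmpt_zero: "cmpt \<phi> \<zero>\<^bsub>A\<^esub> \<cdot> fc0 (src \<phi>) = fc0 (tgt \<phi>)"
  by (rule cmpt_fc0)

lemma cmpt_ext [simp]: "cmpt \<phi> \<in> extensional (Obj A)"
  by (rule cmpt_extensional)

end

lemma mon_transI:
  assumes "sym_mon_functor A B F" "sym_mon_functor A B G"
    and "\<And>x. x \<in> Obj A \<Longrightarrow> c x \<in> Arr B" "\<And>x. x \<in> Obj A \<Longrightarrow> Dom B (c x) = fo F x"
      "\<And>x. x \<in> Obj A \<Longrightarrow> Cod B (c x) = fo G x"
    and "\<And>f. f \<in> Arr A \<Longrightarrow> c (Cod A f) \<cdot> fm F f = fm G f \<cdot> c (Dom A f)"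
    and "\<And>x y. \<lbrakk>x \<in> Obj A; y \<in> Obj A\<rbrakk> \<Longrightarrow> c (x \<oplus>\<^bsub>A\<^esub> y) \<cdot> fc2 F x y = fc2 G x y \<cdot> (c x \<boxplus> c y)"
    and "c \<zero>\<^bsub>A\<^esub> \<cdot> fc0 F = fc0 G"
  shows "mon_trans A B \<lparr>src = F, tgt = G, cmpt = restrict c (Obj A)\<rparr>"
  by (rule mon_trans.intro, simp_all add: assms(1,2), unfold_locales) (use assms(3-) in \<open>auto simp: Hom_def\<close>)

end

section \<open>Projection rules for identities, composites, sums and hom categories\<close>

lemma smf_id_simps [simp]:
  "x \<in> Obj A \<Longrightarrow> fo (smf_id A) x = x" "f \<in> Arr A \<Longrightarrow> fm (smf_id A) f = f"
  "\<lbrakk>x \<in> Obj A; y \<in> Obj A\<rbrakk> \<Longrightarrow> fc2 (smf_id A) x y = \<one>\<^bsub>A\<^esub> (x \<oplus>\<^bsub>A\<^esub> y)" "fc0 (smf_id A) = \<one>\<^bsub>A\<^esub> \<zero>\<^bsub>A\<^esub>"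
  "smf_restrict A (smf_id A) = smf_id A"
  by (simp_all add: smf_id_def)

lemma smf_comp_simps [simp]:
  "x \<in> Obj A \<Longrightarrow> fo (smf_comp A C G F) x = fo G (fo F x)"
  "f \<in> Arr A \<Longrightarrow> fm (smf_comp A C G F) f = fm G (fm F f)"
  "\<lbrakk>x \<in> Obj A; y \<in> Obj A\<rbrakk> \<Longrightarrow> fc2 (smf_comp A C G F) x y = fm G (fc2 F x y) \<cdot>\<^bsub>C\<^esub> fc2 G (fo F x) (fo F y)"
  "fc0 (smf_comp A C G F) = fm G (fc0 F) \<cdot>\<^bsub>C\<^esub> fc0 G"
  "smf_restrict A (smf_comp A C G F) = smf_comp A C G F"
  by (simp_all add: smf_comp_def)

lemma smf_zero_simps [simp]:
  "x \<in> Obj A \<Longrightarrow> fo (smf_zero A B) x = \<zero>\<^bsub>B\<^esub>" "f \<in> Arr A \<Longrightarrow> fm (smf_zero A B) f = \<one>\<^bsub>B\<^esub> \<zero>\<^bsub>B\<^esub>"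
  "\<lbrakk>x \<in> Obj A; y \<in> Obj A\<rbrakk> \<Longrightarrow> fc2 (smf_zero A B) x y = \<one>\<^bsub>B\<^esub> \<zero>\<^bsub>B\<^esub>" "fc0 (smf_zero A B) = \<one>\<^bsub>B\<^esub> \<zero>\<^bsub>B\<^esub>"
  "smf_restrict A (smf_zero A B) = smf_zero A B"
  by (simp_all add: smf_zero_def)

lemma smf_plus_simps [simp]:
  "x \<in> Obj A \<Longrightarrow> fo (smf_plus A B F F') x = fo F x \<oplus>\<^bsub>B\<^esub> fo F' x"
  "f \<in> Arr A \<Longrightarrow> fm (smf_plus A B F F') f = fm F f \<boxplus>\<^bsub>B\<^esub> fm F' f"
  "fc0 (smf_plus A B F F') = fc0 F \<boxplus>\<^bsub>B\<^esub> fc0 F'"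
  "smf_restrict A (smf_plus A B F F') = smf_plus A B F F'"
  by (simp_all add: smf_plus_def)

lemma mt_id_simps [simp]: "src (mt_id A B F) = F" "tgt (mt_id A B F) = F"
  "x \<in> Obj A \<Longrightarrow> cmpt (mt_id A B F) x = \<one>\<^bsub>B\<^esub> (fo F x)" "cmpt (mt_id A B F) \<in> extensional (Obj A)"
  by (simp_all add: mt_id_def)

lemma mt_vcomp_simps [simp]: "src (mt_vcomp A B \<psi> \<phi>) = src \<phi>" "tgt (mt_vcomp A B \<psi> \<phi>) = tgt \<psi>"
  "x \<in> Obj A \<Longrightarrow> cmpt (mt_vcomp A B \<psi> \<phi>) x = cmpt \<psi> x \<cdot>\<^bsub>B\<^esub> cmpt \<phi> x"
  "cmpt (mt_vcomp A B \<psi> \<phi>) \<in> extensional (Obj A)"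
  by (simp_all add: mt_vcomp_def)

lemma mt_hcomp_simps [simp]:
  "src (mt_hcomp A C \<psi> \<phi>) = smf_comp A C (src \<psi>) (src \<phi>)"
  "tgt (mt_hcomp A C \<psi> \<phi>) = smf_comp A C (tgt \<psi>) (tgt \<phi>)"
  "x \<in> Obj A \<Longrightarrow> cmpt (mt_hcomp A C \<psi> \<phi>) x = cmpt \<psi> (fo (tgt \<phi>) x) \<cdot>\<^bsub>C\<^esub> fm (src \<psi>) (cmpt \<phi> x)"
  "cmpt (mt_hcomp A C \<psi> \<phi>) \<in> extensional (Obj A)"
  by (simp_all add: mt_hcomp_def)

lemma PermHom_simps [simp]:
  "F \<in> Obj (PermHom A B) \<longleftrightarrow> sym_mon_functor A B F" "\<phi> \<in> Arr (PermHom A B) \<longleftrightarrow> mon_trans A B \<phi>"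
  "Dom (PermHom A B) = src" "Cod (PermHom A B) = tgt" "Ident (PermHom A B) = mt_id A B"
  "Cmp (PermHom A B) = mt_vcomp A B" "Osum (PermHom A B) = smf_plus A B" "Zero (PermHom A B) = smf_zero A B"
  by (simp_all add: PermHom_def)

lemma PermHom_Asum_simps [simp]:
  "src (\<phi> \<boxplus>\<^bsub>PermHom A B\<^esub> \<phi>') = smf_plus A B (src \<phi>) (src \<phi>')"
  "tgt (\<phi> \<boxplus>\<^bsub>PermHom A B\<^esub> \<phi>') = smf_plus A B (tgt \<phi>) (tgt \<phi>')"
  "x \<in> Obj A \<Longrightarrow> cmpt (\<phi> \<boxplus>\<^bsub>PermHom A B\<^esub> \<phi>') x = cmpt \<phi> x \<boxplus>\<^bsub>B\<^esub> cmpt \<phi>' x"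
  "cmpt (\<phi> \<boxplus>\<^bsub>PermHom A B\<^esub> \<phi>') \<in> extensional (Obj A)"
  by (simp_all add: PermHom_def)

lemma PermHom_Sym_simps [simp]:
  "src (\<beta>\<^bsub>PermHom A B\<^esub> F F') = smf_plus A B F F'" "tgt (\<beta>\<^bsub>PermHom A B\<^esub> F F') = smf_plus A B F' F"
  "x \<in> Obj A \<Longrightarrow> cmpt (\<beta>\<^bsub>PermHom A B\<^esub> F F') x = \<beta>\<^bsub>B\<^esub> (fo F x) (fo F' x)"
  "cmpt (\<beta>\<^bsub>PermHom A B\<^esub> F F') \<in> extensional (Obj A)"
  by (simp_all add: PermHom_def)

context perm_pair
begin

lemma fc2_plus [simp]: "\<lbrakk>x \<in> Obj A; y \<in> Obj A\<rbrakk> \<Longrightarrow> fc2 (smf_plus A B F F') x y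
    = (fc2 F x y \<boxplus> fc2 F' x y) \<cdot> B.mid (fo F x) (fo F' x) (fo F y) (fo F' y)"
  by (simp add: smf_plus_def B.mid_def)

lemma smf_zero_smf [simp]: "sym_mon_functor A B (smf_zero A B)"
  unfolding smf_zero_def by (rule sym_mon_functorI) auto

text \<open>Once the shuffles \<open>mid\<close> are moved to the right by naturality, each axiom
  splits into those of F and F' and a coherence identity of shuffles: \<open>mid_assoc\<close> for
  associativity, \<open>mid_Zero\<close> for the unit, \<open>Sym_mid_left\<close> for the
  symmetry.\<close>

lemma smf_plus_smf [simp]:
  assumes [simp]: "sym_mon_functor A B F" "sym_mon_functor A B F'"
  shows "sym_mon_functor A B (smf_plus A B F F')"
proof -
  interpret F: sym_mon_functor A B F by simp
  interpret F': sym_mon_functor A B F' by simp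
  let ?G = "smf_plus A B F F'"
  have "sym_mon_functor A B (smf_restrict A ?G)"
  proof (rule sym_mon_functorI, goal_cases)
    case (10 f g)
    have "fc2 ?G (Cod A f) (Cod A g) \<cdot> (fm ?G f \<boxplus> fm ?G g)
      = ((fc2 F (Cod A f) (Cod A g) \<cdot> (fm F f \<boxplus> fm F g)) \<boxplus> (fc2 F' (Cod A f) (Cod A g) \<cdot> (fm F' f \<boxplus> fm F' g)))
        \<cdot> B.mid (fo F (Dom A f)) (fo F' (Dom A f)) (fo F (Dom A g)) (fo F' (Dom A g))"
      using 10 by (simp add: B.mid_nat flip: B.interchange)
    also have "\<dots> = fm ?G (f \<boxplus>\<^bsub>A\<^esub> g) \<cdot> fc2 ?G (Dom A f) (Dom A g)"
      using 10 by (simp add: fc2_nat) (simp flip: B.interchange)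
    finally show ?case .
  next
    case (14 x y z)
    note [simp] = 14
    have "fc2 ?G (x \<oplus>\<^bsub>A\<^esub> y) z \<cdot> (fc2 ?G x y \<boxplus> \<one> (fo ?G z))
      = (fc2 F (x \<oplus>\<^bsub>A\<^esub> y) z \<boxplus> fc2 F' (x \<oplus>\<^bsub>A\<^esub> y) z) \<cdot>
        ((B.mid (fo F (x \<oplus>\<^bsub>A\<^esub> y)) (fo F' (x \<oplus>\<^bsub>A\<^esub> y)) (fo F z) (fo F' z)
          \<cdot> (fc2 F x y \<boxplus> (fc2 F' x y \<boxplus> (\<one> (fo F z) \<boxplus> \<one> (fo F' z)))))
         \<cdot> (B.mid (fo F x) (fo F' x) (fo F y) (fo F' y) \<boxplus> \<one> (fo F z \<oplus> fo F' z)))"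
      using B.interchange[of "B.mid (fo F x) (fo F' x) (fo F y) (fo F' y)" "fc2 F x y \<boxplus> fc2 F' x y"
        "\<one> (fo F z \<oplus> fo F' z)" "\<one> (fo F z \<oplus> fo F' z)"] by simp
    also have "\<dots> = ((fc2 F (x \<oplus>\<^bsub>A\<^esub> y) z \<cdot> (fc2 F x y \<boxplus> \<one> (fo F z))) \<boxplus> (fc2 F' (x \<oplus>\<^bsub>A\<^esub> y) z \<cdot> (fc2 F' x y \<boxplus> \<one> (fo F' z))))
      \<cdot> (B.mid (fo F x \<oplus> fo F y) (fo F' x \<oplus> fo F' y) (fo F z) (fo F' z)
         \<cdot> (B.mid (fo F x) (fo F' x) (fo F y) (fo F' y) \<boxplus> \<one> (fo F z \<oplus> fo F' z)))"
      by (subst B.mid_nat; simp del: B.Asum_Ident B.Asum_Ident_Ident) (simp flip: B.interchange)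
    also have "\<dots> = ((fc2 F x (y \<oplus>\<^bsub>A\<^esub> z) \<cdot> (\<one> (fo F x) \<boxplus> fc2 F y z)) \<boxplus> (fc2 F' x (y \<oplus>\<^bsub>A\<^esub> z) \<cdot> (\<one> (fo F' x) \<boxplus> fc2 F' y z)))
      \<cdot> (B.mid (fo F x) (fo F' x) (fo F y \<oplus> fo F z) (fo F' y \<oplus> fo F' z)
         \<cdot> (\<one> (fo F x \<oplus> fo F' x) \<boxplus> B.mid (fo F y) (fo F' y) (fo F z) (fo F' z)))"
      by (simp add: F.fc2_assoc F'.fc2_assoc B.mid_assoc)
    also have "\<dots> = (fc2 F x (y \<oplus>\<^bsub>A\<^esub> z) \<boxplus> fc2 F' x (y \<oplus>\<^bsub>A\<^esub> z)) \<cdot>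
        ((B.mid (fo F x) (fo F' x) (fo F (y \<oplus>\<^bsub>A\<^esub> z)) (fo F' (y \<oplus>\<^bsub>A\<^esub> z))
          \<cdot> (\<one> (fo F x) \<boxplus> (\<one> (fo F' x) \<boxplus> (fc2 F y z \<boxplus> fc2 F' y z))))
         \<cdot> (\<one> (fo F x \<oplus> fo F' x) \<boxplus> B.mid (fo F y) (fo F' y) (fo F z) (fo F' z)))"
      by (subst B.mid_nat; simp del: B.Asum_Ident B.Asum_Ident_Ident) (simp flip: B.interchange)
    also have "\<dots> = fc2 ?G x (y \<oplus>\<^bsub>A\<^esub> z) \<cdot> (\<one> (fo ?G x) \<boxplus> fc2 ?G y z)"
      using B.interchange[of "\<one> (fo F x \<oplus> fo F' x)" "\<one> (fo F x \<oplus> fo F' x)"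
         "B.mid (fo F y) (fo F' y) (fo F z) (fo F' z)" "fc2 F y z \<boxplus> fc2 F' y z"] by simp
    finally show ?case .
  next
    case (15 x)
    then have "fc2 ?G \<zero>\<^bsub>A\<^esub> x \<cdot> (fc0 ?G \<boxplus> \<one> (fo ?G x))
      = (fc2 F \<zero>\<^bsub>A\<^esub> x \<boxplus> fc2 F' \<zero>\<^bsub>A\<^esub> x) \<cdot>
         (B.mid (fo F \<zero>\<^bsub>A\<^esub>) (fo F' \<zero>\<^bsub>A\<^esub>) (fo F x) (fo F' x)
         \<cdot> (fc0 F \<boxplus> (fc0 F' \<boxplus> (\<one> (fo F x) \<boxplus> \<one> (fo F' x)))))"
      by simp
    also have "\<dots> = (fc2 F \<zero>\<^bsub>A\<^esub> x \<boxplus> fc2 F' \<zero>\<^bsub>A\<^esub> x) \<cdot> ((fc0 F \<boxplus> \<one> (fo F x)) \<boxplus> (fc0 F' \<boxplus> \<one> (fo F' x)))"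
      using 15 by (subst B.mid_nat; simp add: B.mid_Zero del: B.Asum_Ident B.Asum_Ident_Ident)
    also have "\<dots> = \<one> (fo ?G x)"
      using 15 by (subst B.interchange) (simp_all del: B.Asum_assoc add: F.fc2_unit_left F'.fc2_unit_left)
    finally show ?case .
  next
    case (16 x y)
    have "fm ?G (\<beta>\<^bsub>A\<^esub> x y) \<cdot> fc2 ?G x y = (fc2 F y x \<boxplus> fc2 F' y x) \<cdot>
       ((\<beta> (fo F x) (fo F y) \<boxplus> \<beta> (fo F' x) (fo F' y)) \<cdot> B.mid (fo F x) (fo F' x) (fo F y) (fo F' y))"
      using 16 by (simp add: B.interchange_Cmp F.fc2_symmetry F'.fc2_symmetry)
    also have "\<dots> = fc2 ?G y x \<cdot> \<beta> (fo ?G x) (fo ?G y)"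
      using 16 by (simp add: B.Sym_mid_left)
    finally show ?case .
  qed (auto simp: B.interchange)
  then show ?thesis by simp
qed

end

section \<open>The hom category is permutative, and its isomorphisms are the pointwise ones\<close>

context perm_pair
begin

lemma mt_id_mon_trans [simp]: "sym_mon_functor A B F \<Longrightarrow> mon_trans A B (mt_id A B F)"
  unfolding mt_id_def by (rule mon_transI) (auto simp: fc2_nat)

lemma mt_vcomp_mon_trans [simp]:
  assumes [simp]: "mon_trans A B \<phi>" "mon_trans A B \<psi>" "src \<psi> = tgt \<phi>"
  shows "mon_trans A B (mt_vcomp A B \<psi> \<phi>)"
  unfolding mt_vcomp_def
proof (rule mon_transI, goal_cases)
  case (6 f)
  then show ?case
    using B.assoc_eq[OF cmpt_nat[of \<psi> f "Cod A f"], of "cmpt \<phi> (Dom A f)"] by (simp add: cmpt_nat)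
next
  case (7 x y)
  then show ?case
    using B.assoc_eq[OF cmpt_sum[of \<psi> x y], of "cmpt \<phi> x \<boxplus> cmpt \<phi> y"]
    by (simp add: cmpt_sum) (simp add: B.interchange)
next
  case 8
  then show ?case
    using cmpt_zero[of \<psi>] by (simp add: cmpt_zero)
qed auto

lemma mt_Asum_mon_trans [simp]:
  assumes [simp]: "mon_trans A B \<phi>" "mon_trans A B \<psi>"
  shows "mon_trans A B (\<phi> \<boxplus>\<^bsub>PermHom A B\<^esub> \<psi>)"
  unfolding PermHom_def pcat.simps
proof (rule mon_transI, goal_cases)
  case (7 x y)
  note [simp] = 7
  have "(cmpt \<phi> (x \<oplus>\<^bsub>A\<^esub> y) \<boxplus> cmpt \<psi> (x \<oplus>\<^bsub>A\<^esub> y)) \<cdot> fc2 (smf_plus A B (src \<phi>) (src \<psi>)) x y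
    = (fc2 (tgt \<phi>) x y \<boxplus> fc2 (tgt \<psi>) x y) \<cdot> (((cmpt \<phi> x \<boxplus> (cmpt \<phi> y \<boxplus> (cmpt \<psi> x \<boxplus> cmpt \<psi> y))))
        \<cdot> B.mid (fo (src \<phi>) x) (fo (src \<psi>) x) (fo (src \<phi>) y) (fo (src \<psi>) y))"
    by (simp add: B.interchange_Cmp cmpt_sum)
      (simp flip: B.interchange)
  also have "\<dots> = fc2 (smf_plus A B (tgt \<phi>) (tgt \<psi>)) x y
    \<cdot> (cmpt \<phi> x \<boxplus> cmpt \<psi> x \<boxplus> (cmpt \<phi> y \<boxplus> cmpt \<psi> y))"
    by (simp add: B.mid_nat)
  finally show ?case by simp
qed (auto simp: B.interchange cmpt_nat cmpt_zero)

lemma mt_Sym_mon_trans [simp]: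
  assumes [simp]: "sym_mon_functor A B F" "sym_mon_functor A B G"
  shows "mon_trans A B (\<beta>\<^bsub>PermHom A B\<^esub> F G)"
  unfolding PermHom_def pcat.simps
proof (rule mon_transI, goal_cases)
  case (7 x y)
  note [simp] = 7
  show ?case
    by (simp add: B.assoc_eq[OF B.Sym_nat] B.Sym_mid_right)
qed (auto simp: B.Sym_nat)

lemma category_PermHom: "category (PermHom A B)"
  by (rule categoryI) (auto intro!: mt_eqI[where A = A])

lemma smf_plus_assoc [simp]:
  assumes [simp]: "sym_mon_functor A B F" "sym_mon_functor A B G" "sym_mon_functor A B H"
  shows "smf_plus A B (smf_plus A B F G) H = smf_plus A B F (smf_plus A B G H)"
proof (rule smf_eqI[where A = A], goal_cases)
  case (5 x y)
  note [simp] = 5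
  have "fc2 (smf_plus A B (smf_plus A B F G) H) x y = (fc2 F x y \<boxplus> (fc2 G x y \<boxplus> fc2 H x y)) \<cdot>
      ((B.mid (fo F x) (fo G x) (fo F y) (fo G y) \<boxplus> \<one> (fo H x \<oplus> fo H y))
        \<cdot> B.mid (fo F x \<oplus> fo G x) (fo H x) (fo F y \<oplus> fo G y) (fo H y))"
    using B.interchange_Cmp[of "B.mid (fo F x) (fo G x) (fo F y) (fo G y)" "fc2 F x y \<boxplus> fc2 G x y"
        "\<one> (fo H x \<oplus> fo H y)" "fc2 H x y"] by simp
  also have "\<dots> = (fc2 F x y \<boxplus> (fc2 G x y \<boxplus> fc2 H x y)) \<cdot>
      ((\<one> (fo F x \<oplus> fo F y) \<boxplus> B.mid (fo G x) (fo H x) (fo G y) (fo H y))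
        \<cdot> B.mid (fo F x) (fo G x \<oplus> fo H x) (fo F y) (fo G y \<oplus> fo H y))"
    by (simp add: B.mid_assoc2)
  also have "\<dots> = fc2 (smf_plus A B F (smf_plus A B G H)) x y"
    by (simp add: B.interchange_Cmp)
  finally show ?case .
qed auto

lemma smf_plus_zero [simp]:
  assumes [simp]: "sym_mon_functor A B F"
  shows "smf_plus A B (smf_zero A B) F = F" "smf_plus A B F (smf_zero A B) = F"
  by (rule smf_eqI[where A = A]; simp add: smf_extensional B.mid_Zero)+

lemma permutative_PermHom: "permutative (PermHom A B)"
  by (rule permutativeI[OF category_PermHom])
    (auto intro!: mt_eqI[where A = A] simp: B.interchange B.Sym_nat B.Sym_Osum)

text \<open>Pointwise inverses form a monoidal transformation because the naturality and constraint
  squares can be inverted.\<close>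

lemma iso_PermHomI:
  assumes [simp]: "mon_trans A B \<phi>" and iso [simp]: "\<And>x. x \<in> Obj A \<Longrightarrow> iso B (cmpt \<phi> x)"
  shows "iso (PermHom A B) \<phi>"
proof -
  interpret H: permutative "PermHom A B" by (rule permutative_PermHom)
  let ?\<psi> = "\<lparr>src = tgt \<phi>, tgt = src \<phi>, cmpt = restrict (\<lambda>x. inv_arr B (cmpt \<phi> x)) (Obj A)\<rparr>"
  have "mon_trans A B ?\<psi>"
  proof (rule mon_transI, goal_cases)
    case (6 f)
    then show ?case by (intro B.inv_commute) (simp_all add: cmpt_nat)
  next
    case (7 x y)
    note [simp] = 7
    have "inv_arr B (cmpt \<phi> (x \<oplus>\<^bsub>A\<^esub> y)) \<cdot> fc2 (tgt \<phi>) x y = fc2 (src \<phi>) x y \<cdot> inv_arr B (cmpt \<phi> x \<boxplus> cmpt \<phi> y)"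
      by (intro B.inv_commute) (simp_all add: cmpt_sum)
    then show ?case by (simp add: B.inv_Asum)
  next
    case 8
    have "inv_arr B (cmpt \<phi> \<zero>\<^bsub>A\<^esub>) \<cdot> (cmpt \<phi> \<zero>\<^bsub>A\<^esub> \<cdot> fc0 (src \<phi>)) = fc0 (src \<phi>)" by simp
    then show ?case by (simp add: cmpt_zero)
  qed auto
  then have "inverse_arrows (PermHom A B) \<phi> ?\<psi>"
    by (intro H.inverse_arrowsI) (auto intro!: mt_eqI[where A = A])
  then show ?thesis by (rule H.isoI)
qed

text \<open>Composition in \<open>PermHom A B\<close> is pointwise, so evaluation at x preserves
  inverses. This is what later makes components of \<open>fc2 Q\<close> and \<open>fc0 Q\<close>
  admissible values of invertible generators.\<close>

lemma iso_cmpt: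
  assumes "iso (PermHom A B) \<phi>" and [simp]: "x \<in> Obj A"
  shows "iso B (cmpt \<phi> x)"
proof -
  interpret H: permutative "PermHom A B" by (rule permutative_PermHom)
  have [simp]: "mon_trans A B \<phi>" "mon_trans A B (inv_arr (PermHom A B) \<phi>)"
    using H.iso_Arr H.inv_Arr assms(1) by fastforce+
  have "inverse_arrows B (cmpt \<phi> x) (cmpt (inv_arr (PermHom A B) \<phi>) x)"
    using H.Dom_inv[OF assms(1)] H.Cod_inv[OF assms(1)]
      arg_cong[OF H.inv_Cmp[OF assms(1)], where f = "\<lambda>\<phi>. cmpt \<phi> x"]
      arg_cong[OF H.Cmp_inv[OF assms(1)], where f = "\<lambda>\<phi>. cmpt \<phi> x"]
    by (intro B.inverse_arrowsI) simp_all
  then show ?thesis by (rule B.isoI)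
qed

end

text \<open>Admits hom categories as arguments of the same locales, and hence iterated hom
  categories.\<close>

sublocale perm_pair \<subseteq> H: permutative "PermHom A B"
  by (rule permutative_PermHom)

context permutative
begin

interpretation perm_pair C C ..

lemma smf_id_smf [simp]: "sym_mon_functor C C (smf_id C)"
  unfolding smf_id_def by (rule sym_mon_functorI) auto

end

section \<open>Composition of functors and of transformations\<close>

locale perm_triple = A: permutative A + B: permutative B + C: permutative C
  for A :: "('o1, 'm1) pcat" and B :: "('o2, 'm2) pcat" and C :: "('o3, 'm3) pcat" (structure)
begin

sublocale AB: perm_pair A B ..
sublocale BC: perm_pair B C ..
sublocale AC: perm_pair A C ..

lemma smf_comp_smf [simp]:
  assumes [simp]: "sym_mon_functor A B F" "sym_mon_functor B C G"
  shows "sym_mon_functor A C (smf_comp A C G F)"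
proof -
  interpret F: sym_mon_functor A B F by simp
  interpret G: sym_mon_functor B C G by simp
  let ?G = "smf_comp A C G F"
  have "sym_mon_functor A C (smf_restrict A ?G)"
  proof (rule AC.sym_mon_functorI, goal_cases)
    case (10 f g)
    then show ?case
      using AB.fc2_nat[of F f g "Cod A f" "Cod A g"]
      by (simp add: BC.fc2_nat)  (simp flip: C.assoc BC.fm_Cmp)
  next
    case (14 x y z)
    note [simp] = 14
    have *: "fm G (\<one>\<^bsub>B\<^esub> (fo F v)) = \<one> (fo G (fo F v))" if "v \<in> Obj A" for v
      using that by simp
    \<comment> \<open>The constraint of F is pulled inside G by naturality of \<open>fc2 G\<close>;
      then associativity of F acts inside G and associativity of G outside, and the first moves are
      undone.\<close>
    have "fc2 ?G (x \<oplus>\<^bsub>A\<^esub> y) z \<cdot> (fc2 ?G x y \<boxplus> \<one> (fo ?G z))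
      = fm G (fc2 F (x \<oplus>\<^bsub>A\<^esub> y) z) \<cdot> ((fc2 G (fo F (x \<oplus>\<^bsub>A\<^esub> y)) (fo F z) \<cdot> (fm G (fc2 F x y) \<boxplus> fm G (\<one>\<^bsub>B\<^esub> (fo F z))))
         \<cdot> (fc2 G (fo F x) (fo F y) \<boxplus> \<one> (fo G (fo F z))))"
      by (simp add: C.whisker_right)
    also have "\<dots> = fm G (fc2 F (x \<oplus>\<^bsub>A\<^esub> y) z \<cdot>\<^bsub>B\<^esub> (fc2 F x y \<boxplus>\<^bsub>B\<^esub> \<one>\<^bsub>B\<^esub> (fo F z))) \<cdot>
       (fc2 G (fo F x \<oplus>\<^bsub>B\<^esub> fo F y) (fo F z) \<cdot> (fc2 G (fo F x) (fo F y) \<boxplus> \<one> (fo G (fo F z))))"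
      by (subst BC.fc2_nat) simp_all
    also have "\<dots> = fm G (fc2 F x (y \<oplus>\<^bsub>A\<^esub> z) \<cdot>\<^bsub>B\<^esub> (\<one>\<^bsub>B\<^esub> (fo F x) \<boxplus>\<^bsub>B\<^esub> fc2 F y z)) \<cdot>
       (fc2 G (fo F x) (fo F y \<oplus>\<^bsub>B\<^esub> fo F z) \<cdot> (\<one> (fo G (fo F x)) \<boxplus> fc2 G (fo F y) (fo F z)))"
      by (simp only: F.fc2_assoc G.fc2_assoc 14 AB.fo_Obj assms)
    also have "\<dots> = fm G (fc2 F x (y \<oplus>\<^bsub>A\<^esub> z)) \<cdot> ((fc2 G (fo F x) (fo F (y \<oplus>\<^bsub>A\<^esub> z)) \<cdot> (fm G (\<one>\<^bsub>B\<^esub> (fo F x)) \<boxplus> fm G (fc2 F y z)))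
         \<cdot> (\<one> (fo G (fo F x)) \<boxplus> fc2 G (fo F y) (fo F z)))"
      by (subst BC.fc2_nat) simp_all
    also have "\<dots> = fc2 ?G x (y \<oplus>\<^bsub>A\<^esub> z) \<cdot> (\<one> (fo ?G x) \<boxplus> fc2 ?G y z)"
      by (simp add: C.whisker_left)
    finally show ?case .
  next
    case (15 x)
    note [simp] = 15
    have "fc2 ?G \<zero>\<^bsub>A\<^esub> x \<cdot> (fc0 ?G \<boxplus> \<one> (fo ?G x))
      = fm G (fc2 F \<zero>\<^bsub>A\<^esub> x) \<cdot> ((fc2 G (fo F \<zero>\<^bsub>A\<^esub>) (fo F x) \<cdot> (fm G (fc0 F) \<boxplus> fm G (\<one>\<^bsub>B\<^esub> (fo F x))))
         \<cdot> (fc0 G \<boxplus> \<one> (fo G (fo F x))))"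
      by (simp add: C.whisker_right)
    also have "\<dots> = fm G (fc2 F \<zero>\<^bsub>A\<^esub> x \<cdot>\<^bsub>B\<^esub> (fc0 F \<boxplus>\<^bsub>B\<^esub> \<one>\<^bsub>B\<^esub> (fo F x))) \<cdot>
       (fc2 G \<zero>\<^bsub>B\<^esub> (fo F x) \<cdot> (fc0 G \<boxplus> \<one> (fo G (fo F x))))"
      by (subst BC.fc2_nat) simp_all
    also have "\<dots> = \<one> (fo ?G x)"
      using F.fc2_unit_left[of x] G.fc2_unit_left[of "fo F x"] by (simp del: BC.fm_Cmp)
    finally show ?case .
  next
    case (16 x y)
    then show ?case
      using F.fc2_symmetry[of x y] G.fc2_symmetry[of "fo F x" "fo F y"]
      by (simp flip: C.assoc BC.fm_Cmp) simp
  qed auto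
  then show ?thesis by simp
qed

lemma mt_hcomp_mon_trans [simp]:
  assumes [simp]: "mon_trans A B \<phi>" "mon_trans B C \<psi>"
  shows "mon_trans A C (mt_hcomp A C \<psi> \<phi>)"
  unfolding mt_hcomp_def
proof (rule AC.mon_transI, goal_cases)
  case (6 f)
  have "cmpt \<psi> (fo (tgt \<phi>) (Cod A f)) \<cdot> fm (src \<psi>) (cmpt \<phi> (Cod A f) \<cdot>\<^bsub>B\<^esub> fm (src \<phi>) f)
    = fm (tgt \<psi>) (fm (tgt \<phi>) f) \<cdot> (cmpt \<psi> (fo (tgt \<phi>) (Dom A f)) \<cdot> fm (src \<psi>) (cmpt \<phi> (Dom A f)))"
    using 6 by (simp add: AB.cmpt_nat C.assoc_eq[OF BC.cmpt_nat] del: BC.fm_Cmp) (simp add: C.assoc_eq[OF BC.cmpt_nat])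
  then show ?case using 6 by simp
next
  case (7 x y)
  note [simp] = 7
  have "cmpt \<psi> (fo (tgt \<phi>) (x \<oplus>\<^bsub>A\<^esub> y)) \<cdot> (fm (src \<psi>) (cmpt \<phi> (x \<oplus>\<^bsub>A\<^esub> y) \<cdot>\<^bsub>B\<^esub> fc2 (src \<phi>) x y) \<cdot> fc2 (src \<psi>) (fo (src \<phi>) x) (fo (src \<phi>) y))
    = cmpt \<psi> (fo (tgt \<phi>) (x \<oplus>\<^bsub>A\<^esub> y)) \<cdot> (fm (src \<psi>) (fc2 (tgt \<phi>) x y)
       \<cdot> (fm (src \<psi>) (cmpt \<phi> x \<boxplus>\<^bsub>B\<^esub> cmpt \<phi> y) \<cdot> fc2 (src \<psi>) (fo (src \<phi>) x) (fo (src \<phi>) y)))"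
    by (subst AB.cmpt_sum) simp_all
  also have "\<dots> = fm (tgt \<psi>) (fc2 (tgt \<phi>) x y) \<cdot> (cmpt \<psi> (fo (tgt \<phi>) x \<oplus>\<^bsub>B\<^esub> fo (tgt \<phi>) y)
       \<cdot> (fc2 (src \<psi>) (fo (tgt \<phi>) x) (fo (tgt \<phi>) y) \<cdot> (fm (src \<psi>) (cmpt \<phi> x) \<boxplus> fm (src \<psi>) (cmpt \<phi> y))))"
    by (subst C.assoc_eq[OF BC.cmpt_nat]) (simp_all add: BC.fc2_nat)
  also have "\<dots> = fm (tgt \<psi>) (fc2 (tgt \<phi>) x y) \<cdot> (fc2 (tgt \<psi>) (fo (tgt \<phi>) x) (fo (tgt \<phi>) y) \<cdot>
       ((cmpt \<psi> (fo (tgt \<phi>) x) \<cdot> fm (src \<psi>) (cmpt \<phi> x)) \<boxplus> (cmpt \<psi> (fo (tgt \<phi>) y) \<cdot> fm (src \<psi>) (cmpt \<phi> y))))"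
    by (subst C.assoc_eq[OF BC.cmpt_sum]) (simp_all add: C.interchange)
  finally show ?case by simp
next
  case 8
  have "cmpt \<psi> (fo (tgt \<phi>) \<zero>\<^bsub>A\<^esub>) \<cdot> (fm (src \<psi>) (cmpt \<phi> \<zero>\<^bsub>A\<^esub> \<cdot>\<^bsub>B\<^esub> fc0 (src \<phi>)) \<cdot> fc0 (src \<psi>))
    = fm (tgt \<psi>) (fc0 (tgt \<phi>)) \<cdot> fc0 (tgt \<psi>)"
    by (simp add: AB.cmpt_zero BC.cmpt_zero C.assoc_eq[OF BC.cmpt_nat] del: BC.fm_Cmp)
  then show ?case by simp
qed auto

end

context perm_pair
begin

lemma smf_comp_id [simp]:
  assumes [simp]: "sym_mon_functor A B F"
  shows "smf_comp A B F (smf_id A) = F" "smf_comp A B (smf_id B) F = F"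
  by (rule smf_eqI[where A = A]; simp add: smf_extensional)+

text \<open>One copy of \<open>fc0 F\<close> is inserted first, by interchange; the left unit law
  absorbs the other. It provides the unit axioms when constraints of K are viewed as
  transformations.\<close>

lemma fc2_zero_zero:
  assumes [simp]: "sym_mon_functor A B F"
  shows "fc2 F \<zero>\<^bsub>A\<^esub> \<zero>\<^bsub>A\<^esub> \<cdot> (fc0 F \<boxplus> fc0 F) = fc0 F"
proof -
  interpret F: sym_mon_functor A B F by simp
  have "fc2 F \<zero>\<^bsub>A\<^esub> \<zero>\<^bsub>A\<^esub> \<cdot> (fc0 F \<boxplus> fc0 F)
    = (fc2 F \<zero>\<^bsub>A\<^esub> \<zero>\<^bsub>A\<^esub> \<cdot> (fc0 F \<boxplus> \<one> (fo F \<zero>\<^bsub>A\<^esub>))) \<cdot> (\<one> \<zero> \<boxplus> fc0 F)"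
    by (simp add: B.interchange del: B.Asum_Zero_left)
  also have "\<dots> = fc0 F"
    by (subst F.fc2_unit_left) simp_all
  finally show ?thesis .
qed

end

context perm_triple
begin

lemma smf_zero_comp [simp]: "sym_mon_functor A B F \<Longrightarrow> smf_comp A C (smf_zero B C) F = smf_zero A C"
  by (rule smf_eqI[where A = A]) auto

lemma smf_plus_comp [simp]:
  assumes [simp]: "sym_mon_functor A B F" "sym_mon_functor B C G" "sym_mon_functor B C G'"
  shows "smf_comp A C (smf_plus B C G G') F = smf_plus A C (smf_comp A C G F) (smf_comp A C G' F)"
  by (rule smf_eqI[where A = A]) (auto simp: C.interchange_Cmp C.interchange)

text \<open>The constraint of K, evaluated along U and V, is a monoidal transformation. Symmetry of
  K enters here through \<open>fc2_mid\<close>: the constraint of a sum of functors contains a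
  shuffle, which K has to respect. This is what makes postcomposition with K symmetric
  monoidal.\<close>

lemma fc2_mon_trans:
  assumes [simp]: "sym_mon_functor A B U" "sym_mon_functor A B V" "sym_mon_functor B C K"
  shows "mon_trans A C \<lparr>src = smf_plus A C (smf_comp A C K U) (smf_comp A C K V),
    tgt = smf_comp A C K (smf_plus A B U V), cmpt = \<lambda>x\<in>Obj A. fc2 K (fo U x) (fo V x)\<rparr>"
proof (rule AC.mon_transI, goal_cases)
  case (7 x y)
  note [simp] = 7
  have "fc2 K (fo U (x \<oplus>\<^bsub>A\<^esub> y)) (fo V (x \<oplus>\<^bsub>A\<^esub> y)) \<cdot> fc2 (smf_plus A C (smf_comp A C K U) (smf_comp A C K V)) x y
    = (fc2 K (fo U (x \<oplus>\<^bsub>A\<^esub> y)) (fo V (x \<oplus>\<^bsub>A\<^esub> y)) \<cdot> (fm K (fc2 U x y) \<boxplus> fm K (fc2 V x y)))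
       \<cdot> ((fc2 K (fo U x) (fo U y) \<boxplus> fc2 K (fo V x) (fo V y))
         \<cdot> C.mid (fo K (fo U x)) (fo K (fo V x)) (fo K (fo U y)) (fo K (fo V y)))"
    by (simp add: C.interchange_Cmp)
  also have "\<dots> = fm K (fc2 U x y \<boxplus>\<^bsub>B\<^esub> fc2 V x y) \<cdot> (fc2 K (fo U x \<oplus>\<^bsub>B\<^esub> fo U y) (fo V x \<oplus>\<^bsub>B\<^esub> fo V y)
       \<cdot> ((fc2 K (fo U x) (fo U y) \<boxplus> fc2 K (fo V x) (fo V y))
         \<cdot> C.mid (fo K (fo U x)) (fo K (fo V x)) (fo K (fo U y)) (fo K (fo V y))))"
    by (subst BC.fc2_nat) simp_all
  also have "\<dots> = fc2 (smf_comp A C K (smf_plus A B U V)) x y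
       \<cdot> (fc2 K (fo U x) (fo V x) \<boxplus> fc2 K (fo U y) (fo V y))"
    by (simp add: BC.fc2_mid)
  finally show ?case .
next
  case 8
  have "fc2 K (fo U \<zero>\<^bsub>A\<^esub>) (fo V \<zero>\<^bsub>A\<^esub>) \<cdot> fc0 (smf_plus A C (smf_comp A C K U) (smf_comp A C K V))
    = (fc2 K (fo U \<zero>\<^bsub>A\<^esub>) (fo V \<zero>\<^bsub>A\<^esub>) \<cdot> (fm K (fc0 U) \<boxplus> fm K (fc0 V))) \<cdot> (fc0 K \<boxplus> fc0 K)"
    by (simp add: C.interchange)
  also have "\<dots> = fc0 (smf_comp A C K (smf_plus A B U V))"
    by (subst BC.fc2_nat) (simp_all add: BC.fc2_zero_zero)
  finally show ?case .
qed (auto simp: BC.fc2_nat)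

lemma fc0_mon_trans:
  assumes [simp]: "sym_mon_functor B C K"
  shows "mon_trans A C \<lparr>src = smf_zero A C, tgt = smf_comp A C K (smf_zero A B), cmpt = \<lambda>x\<in>Obj A. fc0 K\<rparr>"
  by (rule AC.mon_transI) (auto simp: BC.fc2_zero_zero)

end

section \<open>Functoriality of hom categories in both variables\<close>

lemma PermHom1_simps [simp]:
  "sym_mon_functor A C P \<Longrightarrow> fo (PermHom1 A C A' C' S K) P = smf_comp A' C' K (smf_comp A' C P S)"
  "mon_trans A C \<alpha> \<Longrightarrow> fm (PermHom1 A C A' C' S K) \<alpha>
    = mt_hcomp A' C' (mt_id C C' K) (mt_hcomp A' C \<alpha> (mt_id A' A S))"
  "\<lbrakk>sym_mon_functor A C P; sym_mon_functor A C Q\<rbrakk> \<Longrightarrow> fc2 (PermHom1 A C A' C' S K) P Q =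
    \<lparr>src = smf_plus A' C' (smf_comp A' C' K (smf_comp A' C P S)) (smf_comp A' C' K (smf_comp A' C Q S)),
     tgt = smf_comp A' C' K (smf_comp A' C (smf_plus A C P Q) S),
     cmpt = \<lambda>x\<in>Obj A'. fc2 K (fo P (fo S x)) (fo Q (fo S x))\<rparr>"
  "fc0 (PermHom1 A C A' C' S K) = \<lparr>src = smf_zero A' C',
     tgt = smf_comp A' C' K (smf_comp A' C (smf_zero A C) S), cmpt = \<lambda>x\<in>Obj A'. fc0 K\<rparr>"
  "smf_restrict (PermHom A C) (PermHom1 A C A' C' S K) = PermHom1 A C A' C' S K"
  by (simp_all add: PermHom1_def Let_def)

lemma PermHom2_simps [simp]:
  "src (PermHom2 A C A' C' \<sigma> \<kappa>) = PermHom1 A C A' C' (src \<sigma>) (src \<kappa>)"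
  "tgt (PermHom2 A C A' C' \<sigma> \<kappa>) = PermHom1 A C A' C' (tgt \<sigma>) (tgt \<kappa>)"
  "sym_mon_functor A C P \<Longrightarrow> cmpt (PermHom2 A C A' C' \<sigma> \<kappa>) P
     = mt_hcomp A' C' \<kappa> (mt_hcomp A' C (mt_id A C P) \<sigma>)"
  "cmpt (PermHom2 A C A' C' \<sigma> \<kappa>) \<in> extensional (Obj (PermHom A C))"
  by (simp_all add: PermHom2_def)

locale perm_quad = A: permutative A + C: permutative C + A': permutative A' + C': permutative C'
  for A :: "('oa, 'ma) pcat" and C :: "('oc, 'mc) pcat" and A' :: "('oa1, 'ma1) pcat"
    and C' :: "('oc1, 'mc1) pcat"
begin

sublocale T1: perm_triple A' A C ..
sublocale T2: perm_triple A' C C' ..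
sublocale H: perm_pair "PermHom A C" "PermHom A' C'" ..

text \<open>Equations in \<open>PermHom A' C'\<close> are checked componentwise, where each becomes
  the corresponding axiom of K at objects of the form P S x.\<close>

lemma PermHom1_smf [simp]:
  assumes [simp]: "sym_mon_functor A' A S" "sym_mon_functor C C' K"
  shows "sym_mon_functor (PermHom A C) (PermHom A' C') (PermHom1 A C A' C' S K)"
proof -
  let ?G = "PermHom1 A C A' C' S K"
  interpret K: sym_mon_functor C C' K by simp
  have fc2: "mon_trans A' C' (fc2 ?G P Q)" if [simp]: "sym_mon_functor A C P" "sym_mon_functor A C Q" for P Q
    using T2.fc2_mon_trans[of "smf_comp A' C P S" "smf_comp A' C Q S" K] 
    by (simp cong: restrict_cong)
  have fc0: "mon_trans A' C' (fc0 ?G)"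
    using T2.fc0_mon_trans[of K] by simp
  have "sym_mon_functor (PermHom A C) (PermHom A' C') (smf_restrict (PermHom A C) ?G)"
  proof (rule H.sym_mon_functorI, goal_cases)
    case (7 P Q)
    then show ?case using fc2[of P Q] by (intro T2.AC.iso_PermHomI) auto
  next
    case 11
    show ?case using fc0 by (intro T2.AC.iso_PermHomI) auto
  qed (auto intro!: mt_eqI[where A = A'] simp: T2.BC.fc2_nat K.fc2_assoc K.fc2_unit_left K.fc2_symmetry)
  then show ?thesis by simp
qed

lemma PermHom2_mon_trans [simp]:
  assumes [simp]: "mon_trans A' A \<sigma>" "mon_trans C C' \<kappa>"
  shows "mon_trans (PermHom A C) (PermHom A' C') (PermHom2 A C A' C' \<sigma> \<kappa>)"
  unfolding PermHom2_def
proof (rule H.mon_transI, goal_cases)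
  case (6 \<alpha>)
  then have [simp]: "mon_trans A C \<alpha>" by simp
  have "cmpt \<kappa> (fo (tgt \<alpha>) (fo (tgt \<sigma>) x)) \<cdot>\<^bsub>C'\<^esub> (fm (src \<kappa>) (fm (tgt \<alpha>) (cmpt \<sigma> x)) \<cdot>\<^bsub>C'\<^esub> fm (src \<kappa>) (cmpt \<alpha> (fo (src \<sigma>) x)))
    = fm (tgt \<kappa>) (cmpt \<alpha> (fo (tgt \<sigma>) x)) \<cdot>\<^bsub>C'\<^esub> (cmpt \<kappa> (fo (src \<alpha>) (fo (tgt \<sigma>) x)) \<cdot>\<^bsub>C'\<^esub> fm (src \<kappa>) (fm (src \<alpha>) (cmpt \<sigma> x)))"
    if [simp]: "x \<in> Obj A'" for x
  proof -
    have "fm (src \<kappa>) (fm (tgt \<alpha>) (cmpt \<sigma> x)) \<cdot>\<^bsub>C'\<^esub> fm (src \<kappa>) (cmpt \<alpha> (fo (src \<sigma>) x))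
      = fm (src \<kappa>) (cmpt \<alpha> (fo (tgt \<sigma>) x)) \<cdot>\<^bsub>C'\<^esub> fm (src \<kappa>) (fm (src \<alpha>) (cmpt \<sigma> x))"
      using arg_cong[OF T1.BC.cmpt_nat[of \<alpha> "cmpt \<sigma> x" "fo (tgt \<sigma>) x"], of "fm (src \<kappa>)"] by simp
    then show ?thesis
      using C'.assoc_eq[OF T2.BC.cmpt_nat[of \<kappa> "cmpt \<alpha> (fo (tgt \<sigma>) x)" "fo (tgt \<alpha>) (fo (tgt \<sigma>) x)"],
          of "fm (src \<kappa>) (fm (src \<alpha>) (cmpt \<sigma> x))"] by simp
  qed
  then show ?case by (intro mt_eqI[where A = A']) simp_all
next
  case (7 P Q)
  then have [simp]: "sym_mon_functor A C P" "sym_mon_functor A C Q" by simp_all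
  have "cmpt \<kappa> (fo P (fo (tgt \<sigma>) x) \<oplus>\<^bsub>C\<^esub> fo Q (fo (tgt \<sigma>) x)) \<cdot>\<^bsub>C'\<^esub>
      (fm (src \<kappa>) (fm P (cmpt \<sigma> x) \<boxplus>\<^bsub>C\<^esub> fm Q (cmpt \<sigma> x)) \<cdot>\<^bsub>C'\<^esub> fc2 (src \<kappa>) (fo P (fo (src \<sigma>) x)) (fo Q (fo (src \<sigma>) x)))
    = fc2 (tgt \<kappa>) (fo P (fo (tgt \<sigma>) x)) (fo Q (fo (tgt \<sigma>) x)) \<cdot>\<^bsub>C'\<^esub>
      ((cmpt \<kappa> (fo P (fo (tgt \<sigma>) x)) \<cdot>\<^bsub>C'\<^esub> fm (src \<kappa>) (fm P (cmpt \<sigma> x)))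
        \<boxplus>\<^bsub>C'\<^esub> (cmpt \<kappa> (fo Q (fo (tgt \<sigma>) x)) \<cdot>\<^bsub>C'\<^esub> fm (src \<kappa>) (fm Q (cmpt \<sigma> x))))"
    if [simp]: "x \<in> Obj A'" for x
    using T2.BC.fc2_nat[of "src \<kappa>" "fm P (cmpt \<sigma> x)" "fm Q (cmpt \<sigma> x)" "fo P (fo (tgt \<sigma>) x)" "fo Q (fo (tgt \<sigma>) x)"]
      C'.assoc_eq[OF T2.BC.cmpt_sum[of \<kappa> "fo P (fo (tgt \<sigma>) x)" "fo Q (fo (tgt \<sigma>) x)"],
        of "fm (src \<kappa>) (fm P (cmpt \<sigma> x)) \<boxplus>\<^bsub>C'\<^esub> fm (src \<kappa>) (fm Q (cmpt \<sigma> x))"]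
    by (simp add: C'.interchange)
  then show ?case by (intro mt_eqI[where A = A']) simp_all
next
  case 8
  show ?case by (intro mt_eqI[where A = A']) (simp_all add: T2.BC.cmpt_zero)
qed auto

end

lemma (in perm_pair) PermHom1_id:
  "PermHom1 A B A B (smf_id A) (smf_id B) = smf_id (PermHom A B)"
proof -
  interpret perm_quad A B A B ..
  show ?thesis
    by (rule smf_eqI[where A = "PermHom A B"]) (auto intro!: mt_eqI[where A = A])
qed

text \<open>Composition is preserved strictly, constraints included. Compositionality of the
  pseudonaturality constraint rests on it.\<close>

lemma PermHom1_comp:
  assumes "permutative A" "permutative A'" "permutative A''" "permutative C" "permutative C'" "permutative C''"
    and "sym_mon_functor A' A S" "sym_mon_functor A'' A' S'" "sym_mon_functor C C' K" "sym_mon_functor C' C'' K'"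
  shows "PermHom1 A C A'' C'' (smf_comp A'' A S S') (smf_comp C C'' K' K)
    = smf_comp (PermHom A C) (PermHom A'' C'') (PermHom1 A' C' A'' C'' S' K') (PermHom1 A C A' C' S K)"
proof -
  note [simp] = assms
  interpret Q1: perm_quad A C A' C' using assms by (simp add: perm_quad_def)
  interpret Q2: perm_quad A' C' A'' C'' using assms by (simp add: perm_quad_def)
  interpret Q3: perm_quad A C A'' C'' using assms by (simp add: perm_quad_def)
  interpret T1: perm_triple A'' A' A using assms by (simp add: perm_triple_def)
  interpret T2: perm_triple C C' C'' using assms by (simp add: perm_triple_def)
  interpret T3: perm_triple A' A C using assms by (simp add: perm_triple_def)
  interpret T4: perm_triple A'' A' C using assms by (simp add: perm_triple_def)
  have *: "smf_comp A'' C'' (smf_comp C C'' K' K) (smf_comp A'' C P (smf_comp A'' A S S'))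
    = smf_comp A'' C'' K' (smf_comp A'' C' (smf_comp A' C' K (smf_comp A' C P S)) S')"
    if "sym_mon_functor A C P" for P
    by (rule smf_eqI[where A = "A''"]) (use that in auto)
  \<comment> \<open>Transformations record their source and target functors, so these have to be
    identified before components are compared. \<open>z\<close> and \<open>p\<close> are the cases
    of \<open>*\<close> at a zero functor and at a sum, in the form that simplification leaves
    behind.\<close>
  have z: "smf_comp A'' C'' (smf_comp C C'' K' K) (smf_zero A'' C)
    = smf_comp A'' C'' K' (smf_comp A'' C' (smf_comp A' C' K (smf_zero A' C)) S')"
    by (rule smf_eqI[where A = "A''"]) auto
  have p: "smf_comp A'' C'' (smf_comp C C'' K' K) (smf_plus A'' C (smf_comp A'' C P (smf_comp A'' A S S')) (smf_comp A'' C Q (smf_comp A'' A S S')))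
    = smf_comp A'' C'' K' (smf_comp A'' C' (smf_comp A' C' K (smf_plus A' C (smf_comp A' C P S) (smf_comp A' C Q S))) S')"
    if "sym_mon_functor A C P" "sym_mon_functor A C Q" for P Q
    using *[of "smf_plus A C P Q"] that by simp
  have fc2: "mon_trans A' C' (fc2 (PermHom1 A C A' C' S K) P Q)" if [simp]: "sym_mon_functor A C P" "sym_mon_functor A C Q" for P Q
    using Q1.H.fc2_Arr[OF Q1.PermHom1_smf[of S K], of P Q] by simp
  have fc0: "mon_trans A' C' (fc0 (PermHom1 A C A' C' S K))"
    using Q1.H.fc0_Arr[OF Q1.PermHom1_smf[of S K]] by simp
  show ?thesis
  proof (rule smf_eqI[where A = "PermHom A C"], goal_cases)
    case (3 P) then show ?case by (simp add: *)
  next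
    case (4 \<alpha>) then show ?case by (auto intro!: mt_eqI[where A = "A''"] simp: *)
  next
    case (5 P Q) then show ?case using fc2[of P Q] by (auto intro!: mt_eqI[where A = "A''"] simp: * p)
  next
    case 6 then show ?case using fc0 by (auto intro!: mt_eqI[where A = "A''"] simp: z)
  qed auto
qed

section \<open>The tensor product\<close>

context perm_pair
begin

abbreviation "eq\<^sub>t \<equiv> teq A B"
abbreviation "wf\<^sub>t \<equiv> wf_exp A B"
abbreviation "cls \<equiv> tcls A B"
abbreviation "T \<equiv> A \<otimes> B"

lemma gen_Obj: "gen_ok A B t \<Longrightarrow> gen_dom t \<in> lists (Obj A \<times> Obj B) \<and> gen_cod A B t \<in> lists (Obj A \<times> Obj B)"
  by (cases t) auto

lemma edom_Obj: "wf\<^sub>t e \<Longrightarrow> edom A B e \<in> lists (Obj A \<times> Obj B)"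
  and ecod_Obj: "wf\<^sub>t e \<Longrightarrow> ecod A B e \<in> lists (Obj A \<times> Obj B)"
  by (induction e) (use gen_Obj in \<open>auto simp: lists_eq_set\<close>)

lemma eid_simps [simp]:
  assumes "X \<in> lists (Obj A \<times> Obj B)"
  shows "wf\<^sub>t (eid A B X)" "edom A B (eid A B X) = X" "ecod A B (eid A B X) = X"
  using assms by (auto simp: eid_def lists_eq_set intro!: map_idI)

lemma ebeta1_simps [simp]:
  assumes "p \<in> Obj A \<times> Obj B" "Y \<in> lists (Obj A \<times> Obj B)"
  shows "wf\<^sub>t (ebeta1 A B p Y) \<and> edom A B (ebeta1 A B p Y) = p # Y \<and> ecod A B (ebeta1 A B p Y) = Y @ [p]"
  using assms(2) by induction (use assms(1) in \<open>auto simp del: wf_exp.simps(1) edom.simps(1) ecod.simps(1)\<close>)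

lemma ebeta_simps [simp]:
  assumes "X \<in> lists (Obj A \<times> Obj B)" "Y \<in> lists (Obj A \<times> Obj B)"
  shows "wf\<^sub>t (ebeta A B X Y)" "edom A B (ebeta A B X Y) = X @ Y" "ecod A B (ebeta A B X Y) = Y @ X"
proof -
  have "wf\<^sub>t (ebeta A B X Y) \<and> edom A B (ebeta A B X Y) = X @ Y \<and> ecod A B (ebeta A B X Y) = Y @ X"
    using assms(1) by induction (use assms(2) in \<open>auto\<close>)
  then show "wf\<^sub>t (ebeta A B X Y)" "edom A B (ebeta A B X Y) = X @ Y" "ecod A B (ebeta A B X Y) = Y @ X"
    by blast+
qed

lemma base_Cmp_dom:
  assumes "set fs \<subseteq> Arr A \<times> Arr B" "set gs \<subseteq> Arr A \<times> Arr B"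
    "map (map_prod (Dom A) (Dom B)) gs = map (map_prod (Cod A) (Cod B)) fs"
  defines "hs \<equiv> map2 (\<lambda>(g, g') (f, f'). (g \<cdot>\<^bsub>A\<^esub> f, g' \<cdot> f')) gs fs"
  shows "set hs \<subseteq> Arr A \<times> Arr B" "map (map_prod (Dom A) (Dom B)) hs = map (map_prod (Dom A) (Dom B)) fs"
    "map (map_prod (Cod A) (Cod B)) hs = map (map_prod (Cod A) (Cod B)) gs"
proof -
  have "length gs = length fs" using assms(3) map_eq_imp_length_eq by blast
  then have "set hs \<subseteq> Arr A \<times> Arr B \<and> map (map_prod (Dom A) (Dom B)) hs = map (map_prod (Dom A) (Dom B)) fs \<and>
    map (map_prod (Cod A) (Cod B)) hs = map (map_prod (Cod A) (Cod B)) gs"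
    using assms(1-3) unfolding hs_def by (induction gs fs rule: list_induct2) auto
  then show "set hs \<subseteq> Arr A \<times> Arr B" "map (map_prod (Dom A) (Dom B)) hs = map (map_prod (Dom A) (Dom B)) fs"
    "map (map_prod (Cod A) (Cod B)) hs = map (map_prod (Cod A) (Cod B)) gs" by blast+
qed

text \<open>Makes domain and codomain well defined on classes. Well-formedness matters: in
  \<open>base_Cmp\<close> the function \<open>map2\<close> truncates to the shorter list, and only
  composability forces equal lengths.\<close>

lemma trel_dom_cod:
  assumes "trel A B e e'" "wf\<^sub>t e" "wf\<^sub>t e'"
  shows "edom A B e = edom A B e' \<and> ecod A B e = ecod A B e'"
  using assms
proof cases
  case (base_Cmp gs fs)
  then show ?thesis using base_Cmp_dom(2,3)[of fs gs] assms by simp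
next
  case (Beta_natural e e')
  then show ?thesis using assms by (simp add: edom_Obj ecod_Obj)
next
  case (Beta_Beta X Y)
  then show ?thesis using assms by simp
next
  case (Beta_Sum X Y Z)
  then show ?thesis using assms by simp
qed (use assms in \<open>auto simp: edom_Obj ecod_Obj gen_Obj pure_def Hom_def\<close>)

lemma teq_wf: "eq\<^sub>t e e' \<Longrightarrow> wf\<^sub>t e \<and> wf\<^sub>t e' \<and> edom A B e = edom A B e' \<and> ecod A B e = ecod A B e'"
  by (induction rule: teq.induct) (auto dest: trel_dom_cod)

lemma cls_eqI: "eq\<^sub>t e e' \<Longrightarrow> cls e = cls e'"
  unfolding tcls_def using teq.trans teq.sym by blast

lemma trep_cls: "wf\<^sub>t e \<Longrightarrow> eq\<^sub>t e (trep (cls e))"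
  unfolding trep_def tcls_def using someI[of "\<lambda>x. x \<in> {e'. eq\<^sub>t e e'}" e] teq.refl by auto

lemma Obj_T [simp]: "Obj T = lists (Obj A \<times> Obj B)"
  and Osum_T [simp]: "Osum T = (@)" and Zero_T [simp]: "Zero T = []"
  by (simp_all add: tensor_def)

lemma Ident_T: "Ident T X = cls (eid A B X)"
  and Sym_T: "Sym T X Y = cls (ebeta A B X Y)"
  by (simp_all add: tensor_def)

lemma cls_Arr [simp]: "wf\<^sub>t e \<Longrightarrow> cls e \<in> Arr T"
  by (simp add: tensor_def)

lemma Arr_T_cases: assumes "E \<in> Arr T" obtains e where "wf\<^sub>t e" "E = cls e"
  using assms by (auto simp: tensor_def)

lemma Dom_cls [simp]: "wf\<^sub>t e \<Longrightarrow> Dom T (cls e) = edom A B e"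
  and Cod_cls [simp]: "wf\<^sub>t e \<Longrightarrow> Cod T (cls e) = ecod A B e"
  using teq_wf[OF trep_cls[of e]] by (simp_all add: tensor_def)

text \<open>The operations on T are defined through chosen representatives; congruence of
  \<open>teq\<close> lets them be computed on any representatives.\<close>

lemma Cmp_cls: "\<lbrakk>wf\<^sub>t e; wf\<^sub>t e'; edom A B e' = ecod A B e\<rbrakk> \<Longrightarrow> cls e' \<cdot>\<^bsub>T\<^esub> cls e = cls (e' \<odot> e)"
  using teq_wf[OF trep_cls[of e]] teq_wf[OF trep_cls[of e']]
  by (simp add: tensor_def) (intro cls_eqI teq.Cmp_cong teq.sym[OF trep_cls], simp_all)

lemma Asum_cls: "\<lbrakk>wf\<^sub>t e; wf\<^sub>t e'\<rbrakk> \<Longrightarrow> cls e \<boxplus>\<^bsub>T\<^esub> cls e' = cls (e \<uplus> e')"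
  by (simp add: tensor_def) (intro cls_eqI teq.Sum_cong teq.sym[OF trep_cls], simp_all)

lemma cls_rel: "\<lbrakk>trel A B e e'; wf\<^sub>t e; wf\<^sub>t e'\<rbrakk> \<Longrightarrow> cls e = cls e'"
  by (intro cls_eqI teq.rel)

lemma category_T: "category T"
proof (rule categoryI, goal_cases)
  case (1 f) then show ?case by (metis Arr_T_cases Dom_cls edom_Obj Obj_T)
next
  case (2 f) then show ?case by (metis Arr_T_cases Cod_cls ecod_Obj Obj_T)
next
  case (9 f g h)
  then show ?case
    by (elim Arr_T_cases) (simp add: Cmp_cls cls_rel trel.Cmp_assoc)
next
  case (10 f)
  then show ?case
    by (elim Arr_T_cases) (simp add: Cmp_cls cls_rel trel.Cmp_id_left Ident_T ecod_Obj)
next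
  case (11 f)
  then show ?case
    by (elim Arr_T_cases) (simp add: Cmp_cls cls_rel trel.Cmp_id_right Ident_T edom_Obj)
qed (auto simp: Ident_T Cmp_cls elim!: Arr_T_cases)

lemma permutative_T: "permutative T"
proof (rule permutativeI[OF category_T], goal_cases)
  case (6 x y)
  have "cls (eid A B x \<uplus> eid A B y) = cls (eid A B (x @ y))"
    unfolding eid_def map_append using 6 eid_simps(1)[of x] eid_simps(1)[of y]
    by (intro cls_rel trel.base_Sum) (auto simp: eid_def)
  then show ?case using 6 by (simp add: Ident_T Asum_cls)
next
  case (7 f g f' g')
  then show ?case
    by (elim Arr_T_cases) (simp add: Cmp_cls Asum_cls cls_rel trel.Sum_Cmp)
next
  case (11 f g h)
  then show ?case
    by (elim Arr_T_cases) (simp add: Asum_cls cls_rel trel.Sum_assoc)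
next
  case (12 f)
  then show ?case
    by (elim Arr_T_cases) (simp add: Asum_cls cls_rel trel.Sum_unit_left Ident_T)
next
  case (13 f)
  then show ?case
    by (elim Arr_T_cases) (simp add: Asum_cls cls_rel trel.Sum_unit_right Ident_T)
next
  case (17 f g)
  then show ?case
    by (elim Arr_T_cases) (simp add: Asum_cls Sym_T Cmp_cls cls_rel trel.Beta_natural ecod_Obj edom_Obj)
next
  case (18 x y)
  then show ?case
    by (simp add: Sym_T Ident_T Cmp_cls cls_rel trel.Beta_Beta)
next
  case (19 x y z)
  then show ?case
    by (simp add: Sym_T Ident_T Cmp_cls Asum_cls cls_rel trel.Beta_Sum)
qed (auto simp: Asum_cls Sym_T elim!: Arr_T_cases)

end

sublocale perm_pair \<subseteq> T: permutative "A \<otimes> B"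
  by (rule permutative_T)

context perm_pair
begin

text \<open>Class-level names for the generators. By \<open>T_arr_induct\<close> they generate all
  arrows together with the symmetry of one-term sums, the empty identity, composites, sums and
  inverses.\<close>

definition pr :: "'m1 \<Rightarrow> 'm2 \<Rightarrow> ('o1, 'm1, 'o2, 'm2) texp set" where "pr f g = cls (pure f g)"
definition dL :: "'o1 \<Rightarrow> 'o2 \<Rightarrow> 'o2 \<Rightarrow> ('o1, 'm1, 'o2, 'm2) texp set" where "dL a b b' = cls (EGen (DeltaL a b b'))"
definition dR :: "'o2 \<Rightarrow> 'o1 \<Rightarrow> 'o1 \<Rightarrow> ('o1, 'm1, 'o2, 'm2) texp set" where "dR b a a' = cls (EGen (DeltaR b a a'))"
definition zL :: "'o1 \<Rightarrow> ('o1, 'm1, 'o2, 'm2) texp set" where "zL a = cls (EGen (ZetaL a))"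
definition zR :: "'o2 \<Rightarrow> ('o1, 'm1, 'o2, 'm2) texp set" where "zR b = cls (EGen (ZetaR b))"

lemma wf_pure [simp]: "wf\<^sub>t (pure f g) \<longleftrightarrow> f \<in> Arr A \<and> g \<in> Arr B"
  and edom_pure [simp]: "edom A B (pure f g) = [(Dom A f, Dom B g)]"
  and ecod_pure [simp]: "ecod A B (pure f g) = [(Cod A f, Cod B g)]"
  by (auto simp: pure_def)

lemma T_gens [simp]:
  "\<lbrakk>f \<in> Arr A; g \<in> Arr B\<rbrakk> \<Longrightarrow> pr f g \<in> Arr T"
  "\<lbrakk>f \<in> Arr A; g \<in> Arr B\<rbrakk> \<Longrightarrow> Dom T (pr f g) = [(Dom A f, Dom B g)]"
  "\<lbrakk>f \<in> Arr A; g \<in> Arr B\<rbrakk> \<Longrightarrow> Cod T (pr f g) = [(Cod A f, Cod B g)]"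
  "\<lbrakk>a \<in> Obj A; b \<in> Obj B; b' \<in> Obj B\<rbrakk> \<Longrightarrow> dL a b b' \<in> Arr T"
  "\<lbrakk>a \<in> Obj A; b \<in> Obj B; b' \<in> Obj B\<rbrakk> \<Longrightarrow> Dom T (dL a b b') = [(a, b), (a, b')]"
  "\<lbrakk>a \<in> Obj A; b \<in> Obj B; b' \<in> Obj B\<rbrakk> \<Longrightarrow> Cod T (dL a b b') = [(a, b \<oplus> b')]"
  "\<lbrakk>b \<in> Obj B; a \<in> Obj A; a' \<in> Obj A\<rbrakk> \<Longrightarrow> dR b a a' \<in> Arr T"
  "\<lbrakk>b \<in> Obj B; a \<in> Obj A; a' \<in> Obj A\<rbrakk> \<Longrightarrow> Dom T (dR b a a') = [(a, b), (a', b)]"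
  "\<lbrakk>b \<in> Obj B; a \<in> Obj A; a' \<in> Obj A\<rbrakk> \<Longrightarrow> Cod T (dR b a a') = [(a \<oplus>\<^bsub>A\<^esub> a', b)]"
  "a \<in> Obj A \<Longrightarrow> zL a \<in> Arr T" "a \<in> Obj A \<Longrightarrow> Dom T (zL a) = []" "a \<in> Obj A \<Longrightarrow> Cod T (zL a) = [(a, \<zero>)]"
  "b \<in> Obj B \<Longrightarrow> zR b \<in> Arr T" "b \<in> Obj B \<Longrightarrow> Dom T (zR b) = []" "b \<in> Obj B \<Longrightarrow> Cod T (zR b) = [(\<zero>\<^bsub>A\<^esub>, b)]"
  by (simp_all add: pr_def dL_def dR_def zL_def zR_def)

lemma inverse_gen: "gen_ok A B t \<Longrightarrow> inverse_arrows T (cls (EGen t)) (cls (EInv t))"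
  by (rule T.inverse_arrowsI)
    (simp_all add: Cmp_cls Ident_T cls_rel trel.inv_left trel.inv_right gen_Obj)

lemma cls_EInv: "gen_ok A B t \<Longrightarrow> cls (EInv t) = inv_arr T (cls (EGen t))"
  using T.inv_arr_eq[OF inverse_gen] by simp

lemma iso_gens [simp]:
  "\<lbrakk>a \<in> Obj A; b \<in> Obj B; b' \<in> Obj B\<rbrakk> \<Longrightarrow> iso T (dL a b b')"
  "\<lbrakk>b \<in> Obj B; a \<in> Obj A; a' \<in> Obj A\<rbrakk> \<Longrightarrow> iso T (dR b a a')"
  "a \<in> Obj A \<Longrightarrow> iso T (zL a)" "b \<in> Obj B \<Longrightarrow> iso T (zR b)"
  unfolding dL_def dR_def zL_def zR_def using T.isoI[OF inverse_gen] by auto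

lemma pr_Ident: "\<lbrakk>a \<in> Obj A; b \<in> Obj B\<rbrakk> \<Longrightarrow> pr (\<one>\<^bsub>A\<^esub> a) (\<one> b) = \<one>\<^bsub>T\<^esub> [(a, b)]"
  by (simp add: pr_def Ident_T eid_def pure_def)

lemma pr_Cmp: "\<lbrakk>f \<in> Arr A; g \<in> Arr A; Dom A g = Cod A f; f' \<in> Arr B; g' \<in> Arr B; Dom B g' = Cod B f'\<rbrakk> \<Longrightarrow>
    pr g g' \<cdot>\<^bsub>T\<^esub> pr f f' = pr (g \<cdot>\<^bsub>A\<^esub> f) (g' \<cdot> f')"
  using trel.base_Cmp[of A B "[(g, g')]" "[(f, f')]"]
  by (simp add: pr_def Cmp_cls) (rule cls_rel; simp add: pure_def)

lemma EBase_Cons: "\<lbrakk>p \<in> Arr A \<times> Arr B; set fs \<subseteq> Arr A \<times> Arr B\<rbrakk> \<Longrightarrow>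
    cls (EBase (p # fs)) = pr (fst p) (snd p) \<boxplus>\<^bsub>T\<^esub> cls (EBase fs)"
  using trel.base_Sum[of A B "[p]" fs]
  by (cases p, simp add: pr_def Asum_cls) (rule cls_rel[symmetric]; simp add: pure_def)

lemma EBase_Nil: "cls (EBase []) = \<one>\<^bsub>T\<^esub> []"
  by (simp add: Ident_T eid_def)

text \<open>On one-term sums \<open>ebeta\<close> unfolds to the generator padded with identities,
  which the strict unit laws remove.\<close>

lemma Beta_T: "\<lbrakk>p \<in> Obj A \<times> Obj B; q \<in> Obj A \<times> Obj B\<rbrakk> \<Longrightarrow> cls (EGen (Beta p q)) = \<beta>\<^bsub>T\<^esub> [p] [q]"
proof -
  assume p: "p \<in> Obj A \<times> Obj B" "q \<in> Obj A \<times> Obj B"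
  have "\<beta>\<^bsub>T\<^esub> [p] [q] = (((\<one>\<^bsub>T\<^esub> [q] \<boxplus>\<^bsub>T\<^esub> \<one>\<^bsub>T\<^esub> [p]) \<cdot>\<^bsub>T\<^esub> (cls (EGen (Beta p q)) \<boxplus>\<^bsub>T\<^esub> \<one>\<^bsub>T\<^esub> [])) \<boxplus>\<^bsub>T\<^esub> \<one>\<^bsub>T\<^esub> []) \<cdot>\<^bsub>T\<^esub> (\<one>\<^bsub>T\<^esub> [p] \<boxplus>\<^bsub>T\<^esub> \<one>\<^bsub>T\<^esub> [q])"
    using p by (simp add: Sym_T Ident_T Cmp_cls Asum_cls)
  also have "\<dots> = cls (EGen (Beta p q))"
    using p T.Asum_Zero_right[of "cls (EGen (Beta p q))"] by simp
  finally show ?thesis by simp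
qed

text \<open>Translates an equation between classes into one between expressions, so that the lemmas
  below become single clauses of \<open>trel\<close>.\<close>

lemmas T_to_cls = pr_def dL_def dR_def zL_def zR_def Cmp_cls Asum_cls Ident_T

lemma dL_nat: "\<lbrakk>f \<in> Arr A; g \<in> Arr B; g' \<in> Arr B; Cod A f = a; Cod B g = b; Cod B g' = b'\<rbrakk> \<Longrightarrow>
    dL a b b' \<cdot>\<^bsub>T\<^esub> (pr f g \<boxplus>\<^bsub>T\<^esub> pr f g') = pr f (g \<boxplus> g') \<cdot>\<^bsub>T\<^esub> dL (Dom A f) (Dom B g) (Dom B g')"
  by (clarsimp simp: T_to_cls, rule cls_rel, rule trel.DeltaL_natural; auto intro: Arr_Hom)

lemma dR_nat: "\<lbrakk>f \<in> Arr A; f' \<in> Arr A; g \<in> Arr B; Cod A f = a; Cod A f' = a'; Cod B g = b\<rbrakk> \<Longrightarrow>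
    dR b a a' \<cdot>\<^bsub>T\<^esub> (pr f g \<boxplus>\<^bsub>T\<^esub> pr f' g) = pr (f \<boxplus>\<^bsub>A\<^esub> f') g \<cdot>\<^bsub>T\<^esub> dR (Dom B g) (Dom A f) (Dom A f')"
  by (clarsimp simp: T_to_cls, rule cls_rel, rule trel.DeltaR_natural; auto intro: Arr_Hom)

lemma zL_nat: "\<lbrakk>f \<in> Arr A; Cod A f = a\<rbrakk> \<Longrightarrow> pr f (\<one> \<zero>) \<cdot>\<^bsub>T\<^esub> zL (Dom A f) = zL a"
  by (clarsimp simp: T_to_cls, rule cls_rel[symmetric], rule trel.ZetaL_natural; auto intro: Arr_Hom)

lemma zR_nat: "\<lbrakk>g \<in> Arr B; Cod B g = b\<rbrakk> \<Longrightarrow> pr (\<one>\<^bsub>A\<^esub> \<zero>\<^bsub>A\<^esub>) g \<cdot>\<^bsub>T\<^esub> zR (Dom B g) = zR b"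
  by (clarsimp simp: T_to_cls, rule cls_rel[symmetric], rule trel.ZetaR_natural; auto intro: Arr_Hom)

lemma dL_assoc: "\<lbrakk>a \<in> Obj A; b \<in> Obj B; b' \<in> Obj B; b'' \<in> Obj B\<rbrakk> \<Longrightarrow>
    dL a (b \<oplus> b') b'' \<cdot>\<^bsub>T\<^esub> (dL a b b' \<boxplus>\<^bsub>T\<^esub> \<one>\<^bsub>T\<^esub> [(a, b'')])
    = dL a b (b' \<oplus> b'') \<cdot>\<^bsub>T\<^esub> (\<one>\<^bsub>T\<^esub> [(a, b)] \<boxplus>\<^bsub>T\<^esub> dL a b' b'')"
  by (clarsimp simp: T_to_cls, rule cls_rel, rule trel.DeltaL_assoc; auto intro: Arr_Hom)

lemma dL_unit: "\<lbrakk>a \<in> Obj A; b \<in> Obj B\<rbrakk> \<Longrightarrow> dL a \<zero> b \<cdot>\<^bsub>T\<^esub> (zL a \<boxplus>\<^bsub>T\<^esub> \<one>\<^bsub>T\<^esub> [(a, b)]) = \<one>\<^bsub>T\<^esub> [(a, b)]"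
  by (clarsimp simp: T_to_cls, rule cls_rel, rule trel.DeltaL_unit_left; auto intro: Arr_Hom)

lemma dL_symmetry: "\<lbrakk>a \<in> Obj A; b \<in> Obj B; b' \<in> Obj B\<rbrakk> \<Longrightarrow>
    pr (\<one>\<^bsub>A\<^esub> a) (\<beta> b b') \<cdot>\<^bsub>T\<^esub> dL a b b' = dL a b' b \<cdot>\<^bsub>T\<^esub> \<beta>\<^bsub>T\<^esub> [(a, b)] [(a, b')]"
  by (clarsimp simp: T_to_cls simp flip: Beta_T, rule cls_rel, rule trel.DeltaL_symmetry; auto intro: Arr_Hom)

lemma dR_assoc: "\<lbrakk>b \<in> Obj B; a \<in> Obj A; a' \<in> Obj A; a'' \<in> Obj A\<rbrakk> \<Longrightarrow>
    dR b (a \<oplus>\<^bsub>A\<^esub> a') a'' \<cdot>\<^bsub>T\<^esub> (dR b a a' \<boxplus>\<^bsub>T\<^esub> \<one>\<^bsub>T\<^esub> [(a'', b)])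
    = dR b a (a' \<oplus>\<^bsub>A\<^esub> a'') \<cdot>\<^bsub>T\<^esub> (\<one>\<^bsub>T\<^esub> [(a, b)] \<boxplus>\<^bsub>T\<^esub> dR b a' a'')"
  by (clarsimp simp: T_to_cls, rule cls_rel, rule trel.DeltaR_assoc; auto intro: Arr_Hom)

lemma dR_unit: "\<lbrakk>b \<in> Obj B; a \<in> Obj A\<rbrakk> \<Longrightarrow> dR b \<zero>\<^bsub>A\<^esub> a \<cdot>\<^bsub>T\<^esub> (zR b \<boxplus>\<^bsub>T\<^esub> \<one>\<^bsub>T\<^esub> [(a, b)]) = \<one>\<^bsub>T\<^esub> [(a, b)]"
  by (clarsimp simp: T_to_cls, rule cls_rel, rule trel.DeltaR_unit_left; auto intro: Arr_Hom)

lemma dR_symmetry: "\<lbrakk>b \<in> Obj B; a \<in> Obj A; a' \<in> Obj A\<rbrakk> \<Longrightarrow>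
    pr (\<beta>\<^bsub>A\<^esub> a a') (\<one> b) \<cdot>\<^bsub>T\<^esub> dR b a a' = dR b a' a \<cdot>\<^bsub>T\<^esub> \<beta>\<^bsub>T\<^esub> [(a, b)] [(a', b)]"
  by (clarsimp simp: T_to_cls simp flip: Beta_T, rule cls_rel, rule trel.DeltaR_symmetry; auto intro: Arr_Hom)

lemma dL_dR:
  assumes "a \<in> Obj A" "a' \<in> Obj A" "b \<in> Obj B" "b' \<in> Obj B"
  shows "dR (b \<oplus> b') a a' \<cdot>\<^bsub>T\<^esub> ((dL a b b' \<boxplus>\<^bsub>T\<^esub> dL a' b b') \<cdot>\<^bsub>T\<^esub> T.mid [(a, b)] [(a', b)] [(a, b')] [(a', b')])
    = dL (a \<oplus>\<^bsub>A\<^esub> a') b b' \<cdot>\<^bsub>T\<^esub> (dR b a a' \<boxplus>\<^bsub>T\<^esub> dR b' a a')"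
proof -
  have "T.mid [(a, b)] [(a', b)] [(a, b')] [(a', b')] = cls (eid A B [(a, b)] \<uplus> EGen (Beta (a', b) (a, b')) \<uplus> eid A B [(a', b')])"
    using assms by (simp add: T.mid_def Ident_T Asum_cls del: T.Asum_assoc flip: Beta_T)
  then show ?thesis
    using cls_rel[OF trel.DeltaL_DeltaR[of A B a a' b b']] assms by (simp add: T_to_cls)
qed

lemma zL_zR: "zR \<zero> = zL \<zero>\<^bsub>A\<^esub>"
  by (clarsimp simp: T_to_cls, rule cls_rel[symmetric], rule trel.ZetaL_ZetaR; auto intro: Arr_Hom)

lemma dR_zL: "\<lbrakk>a \<in> Obj A; a' \<in> Obj A\<rbrakk> \<Longrightarrow> dR \<zero> a a' \<cdot>\<^bsub>T\<^esub> (zL a \<boxplus>\<^bsub>T\<^esub> zL a') = zL (a \<oplus>\<^bsub>A\<^esub> a')"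
  by (clarsimp simp: T_to_cls, rule cls_rel, rule trel.DeltaR_ZetaL; auto intro: Arr_Hom)

lemma dL_zR: "\<lbrakk>b \<in> Obj B; b' \<in> Obj B\<rbrakk> \<Longrightarrow> dL \<zero>\<^bsub>A\<^esub> b b' \<cdot>\<^bsub>T\<^esub> (zR b \<boxplus>\<^bsub>T\<^esub> zR b') = zR (b \<oplus> b')"
  by (clarsimp simp: T_to_cls, rule cls_rel, rule trel.DeltaL_ZetaR; auto intro: Arr_Hom)

text \<open>Induction over expressions, stated for classes: a formal inverse becomes the actual
  inverse of its generator, so stability under inverses suffices, and a list of base arrows becomes
  a sum of arrows \<open>pr f g\<close>.\<close>

lemma T_arr_induct [consumes 1, case_names Nil pr dL dR Sym zL zR inv Cmp Asum]:
  assumes "E \<in> Arr T"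
    and Nil: "P (\<one>\<^bsub>T\<^esub> [])"
    and pr: "\<And>f g. \<lbrakk>f \<in> Arr A; g \<in> Arr B\<rbrakk> \<Longrightarrow> P (pr f g)"
    and gens: "\<And>a b b'. \<lbrakk>a \<in> Obj A; b \<in> Obj B; b' \<in> Obj B\<rbrakk> \<Longrightarrow> P (dL a b b')"
      "\<And>b a a'. \<lbrakk>b \<in> Obj B; a \<in> Obj A; a' \<in> Obj A\<rbrakk> \<Longrightarrow> P (dR b a a')"
      "\<And>p q. \<lbrakk>p \<in> Obj A \<times> Obj B; q \<in> Obj A \<times> Obj B\<rbrakk> \<Longrightarrow> P (\<beta>\<^bsub>T\<^esub> [p] [q])"
      "\<And>a. a \<in> Obj A \<Longrightarrow> P (zL a)" "\<And>b. b \<in> Obj B \<Longrightarrow> P (zR b)"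
    and inv: "\<And>E. \<lbrakk>iso T E; P E\<rbrakk> \<Longrightarrow> P (inv_arr T E)"
    and Cmp: "\<And>E E'. \<lbrakk>E \<in> Arr T; E' \<in> Arr T; Dom T E' = Cod T E; P E; P E'\<rbrakk> \<Longrightarrow> P (E' \<cdot>\<^bsub>T\<^esub> E)"
    and Asum: "\<And>E E'. \<lbrakk>E \<in> Arr T; E' \<in> Arr T; P E; P E'\<rbrakk> \<Longrightarrow> P (E \<boxplus>\<^bsub>T\<^esub> E')"
  shows "P E"
proof -
  have *: "P (cls (EGen t))" if "gen_ok A B t" for t
    using that gens by (cases t) (auto simp: Beta_T simp flip: dL_def dR_def zL_def zR_def)
  have "P (cls e)" if "wf\<^sub>t e" for e
    using that
  proof (induction e)
    case (EBase fs)
    then show ?case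
    proof (induction fs)
      case (Cons p fs)
      then show ?case by (subst EBase_Cons) (auto intro!: pr Asum)
    qed (simp add: EBase_Nil Nil)
  next
    case (EInv t)
    then show ?case by (simp add: cls_EInv * inv T.isoI[OF inverse_gen])
  next
    case (ECmp e e')
    then show ?case by (simp flip: Cmp_cls add: Cmp)
  next
    case (ESum e e')
    then show ?case by (simp flip: Asum_cls add: Asum)
  qed (simp add: *)
  then show ?thesis using assms(1) by (auto elim: Arr_T_cases)
qed

end

section \<open>The currying functor\<close>

context perm_pair
begin

definition Uo :: "'o1 \<Rightarrow> ('o2, 'm2, ('o1 \<times> 'o2) list, ('o1, 'm1, 'o2, 'm2) texp set) smf" where
  "Uo a = smf_restrict B \<lparr>fo = \<lambda>b. [(a, b)], fm = \<lambda>g. pr (\<one>\<^bsub>A\<^esub> a) g, fc2 = dL a, fc0 = zL a\<rparr>"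

definition U :: "('o1, 'm1, ('o2, 'm2, ('o1 \<times> 'o2) list, ('o1, 'm1, 'o2, 'm2) texp set) smf,
    ('o2, 'm2, ('o1 \<times> 'o2) list, ('o1, 'm1, 'o2, 'm2) texp set) mtrans) smf" where
  "U = smf_restrict A \<lparr>fo = Uo,
     fm = \<lambda>f. \<lparr>src = Uo (Dom A f), tgt = Uo (Cod A f), cmpt = \<lambda>b\<in>Obj B. pr f (\<one> b)\<rparr>,
     fc2 = \<lambda>a a'. \<lparr>src = smf_plus B T (Uo a) (Uo a'), tgt = Uo (a \<oplus>\<^bsub>A\<^esub> a'), cmpt = \<lambda>b\<in>Obj B. dR b a a'\<rparr>,
     fc0 = \<lparr>src = smf_zero B T, tgt = Uo \<zero>\<^bsub>A\<^esub>, cmpt = restrict zR (Obj B)\<rparr>\<rparr>"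

lemma Uo_simps [simp]:
  "b \<in> Obj B \<Longrightarrow> fo (Uo a) b = [(a, b)]" "g \<in> Arr B \<Longrightarrow> fm (Uo a) g = pr (\<one>\<^bsub>A\<^esub> a) g"
  "\<lbrakk>b \<in> Obj B; b' \<in> Obj B\<rbrakk> \<Longrightarrow> fc2 (Uo a) b b' = dL a b b'" "fc0 (Uo a) = zL a"
  by (simp_all add: Uo_def)

lemma U_simps [simp]:
  "a \<in> Obj A \<Longrightarrow> fo U a = Uo a"
  "f \<in> Arr A \<Longrightarrow> fm U f = \<lparr>src = Uo (Dom A f), tgt = Uo (Cod A f), cmpt = \<lambda>b\<in>Obj B. pr f (\<one> b)\<rparr>"
  "\<lbrakk>a \<in> Obj A; a' \<in> Obj A\<rbrakk> \<Longrightarrow> fc2 U a a'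
     = \<lparr>src = smf_plus B T (Uo a) (Uo a'), tgt = Uo (a \<oplus>\<^bsub>A\<^esub> a'), cmpt = \<lambda>b\<in>Obj B. dR b a a'\<rparr>"
  "fc0 U = \<lparr>src = smf_zero B T, tgt = Uo \<zero>\<^bsub>A\<^esub>, cmpt = restrict zR (Obj B)\<rparr>"
  by (simp_all add: U_def)

lemma pr_split:
  assumes "f \<in> Arr A" "g \<in> Arr B"
  shows "pr f g = pr f (\<one> (Cod B g)) \<cdot>\<^bsub>T\<^esub> pr (\<one>\<^bsub>A\<^esub> (Dom A f)) g"
    and "pr f g = pr (\<one>\<^bsub>A\<^esub> (Cod A f)) g \<cdot>\<^bsub>T\<^esub> pr f (\<one> (Dom B g))"
  using assms by (simp_all add: pr_Cmp)

text \<open>Besides functoriality of \<open>pr\<close>, the axioms are the naturality,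
  associativity, unit and symmetry relations imposed on \<open>DeltaL\<close> and
  \<open>ZetaL\<close>.\<close>

lemma Uo_smf [simp]:
  assumes [simp]: "a \<in> Obj A"
  shows "sym_mon_functor B T (Uo a)"
proof -
  interpret BT: perm_pair B T ..
  have *: "pr (\<one>\<^bsub>A\<^esub> a) (g \<boxplus> g') \<cdot>\<^bsub>T\<^esub> dL a (Dom B g) (Dom B g')
    = dL a (Cod B g) (Cod B g') \<cdot>\<^bsub>T\<^esub> (pr (\<one>\<^bsub>A\<^esub> a) g \<boxplus>\<^bsub>T\<^esub> pr (\<one>\<^bsub>A\<^esub> a) g')"
    if "g \<in> Arr B" "g' \<in> Arr B" for g g'
    using that by (subst dL_nat) simp_all
  show ?thesis
    unfolding Uo_def
    by (rule BT.sym_mon_functorI)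
      (auto simp: pr_Ident pr_Cmp * dL_assoc dL_unit dL_symmetry)
qed

text \<open>Each remaining group of relations has its place. \<open>fm U f\<close> is monoidal by
  naturality of \<open>DeltaL\<close> and \<open>ZetaL\<close> in A; \<open>fc2 U\<close> is
  monoidal by the compatibility of \<open>DeltaL\<close> with \<open>DeltaR\<close> and by
  \<open>dR_zL\<close>; \<open>fc0 U\<close> is monoidal by \<open>dL_zR\<close> and
  \<open>zL_zR\<close>. The axioms of U itself are the relations for \<open>DeltaR\<close> and
  \<open>ZetaR\<close>.\<close>

lemma U_smf [simp]: "sym_mon_functor A (PermHom B T) U"
proof -
  interpret BT: perm_pair B T ..
  interpret AH: perm_pair A "PermHom B T" ..
  have fm: "mon_trans B T (fm U f)" if [simp]: "f \<in> Arr A" for f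
  proof (simp, rule BT.mon_transI, goal_cases)
    case (7 x y)
    then show ?case using dL_nat[of f "\<one> x" "\<one> y" "Cod A f" x y] by simp
  next
    case 8
    show ?case using zL_nat[of f] by simp
  qed (auto simp: pr_Cmp)
  have fc2: "mon_trans B T (fc2 U a a')" if [simp]: "a \<in> Obj A" "a' \<in> Obj A" for a a'
  proof (simp, rule BT.mon_transI, goal_cases)
    case (6 g)
    then show ?case using dR_nat[of "\<one>\<^bsub>A\<^esub> a" "\<one>\<^bsub>A\<^esub> a'" g] by simp
  next
    case (7 x y)
    then show ?case by (simp add: dL_dR)
  next
    case 8
    show ?case by (simp add: dR_zL)
  qed auto
  have fc0: "mon_trans B T (fc0 U)"
  proof (simp, rule BT.mon_transI, goal_cases)
    case (6 g)
    then show ?case using zR_nat[of g] by simp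
  next
    case (7 x y)
    then show ?case by (simp add: dL_zR)
  next
    case 8
    show ?case by (simp add: zL_zR)
  qed auto
  have "sym_mon_functor A (PermHom B T) (smf_restrict A U)"
  proof (rule AH.sym_mon_functorI, goal_cases)
    case (5 a)
    then show ?case by (auto intro!: mt_eqI[where A = B] simp: pr_Ident)
  next
    case (7 a a')
    then show ?case using fc2 by (intro BT.iso_PermHomI) auto
  next
    case (10 f g)
    then show ?case
      by (auto intro!: mt_eqI[where A = B] simp: dR_nat)
  next
    case 11
    show ?case using fc0 by (intro BT.iso_PermHomI) auto
  next
    case (14 a a' a'')
    then show ?case by (auto intro!: mt_eqI[where A = B] simp: dR_assoc)
  next
    case (15 a)
    then show ?case by (auto intro!: mt_eqI[where A = B] simp: dR_unit)
  next
    case (16 a a')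
    then show ?case by (auto intro!: mt_eqI[where A = B] simp: dR_symmetry)
  qed (use fm fc2 fc0 in \<open>auto intro!: mt_eqI[where A = B] simp: pr_Cmp\<close>)
  then show ?thesis by (simp add: U_def)
qed

text \<open>A replacement for the rules that unfold \<open>fm U f\<close>, \<open>fc2 U\<close> and
  \<open>fc0 U\<close> to records: with these terms left folded, side conditions such as
  \<open>mon_trans B T (fm U f)\<close> can be solved by rewriting.\<close>

lemma U_parts:
  "f \<in> Arr A \<Longrightarrow> mon_trans B T (fm U f)" "f \<in> Arr A \<Longrightarrow> src (fm U f) = Uo (Dom A f)"
  "f \<in> Arr A \<Longrightarrow> tgt (fm U f) = Uo (Cod A f)" "\<lbrakk>f \<in> Arr A; b \<in> Obj B\<rbrakk> \<Longrightarrow> cmpt (fm U f) b = pr f (\<one> b)"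
  "\<lbrakk>a \<in> Obj A; a' \<in> Obj A\<rbrakk> \<Longrightarrow> mon_trans B T (fc2 U a a')"
  "\<lbrakk>a \<in> Obj A; a' \<in> Obj A\<rbrakk> \<Longrightarrow> src (fc2 U a a') = smf_plus B T (Uo a) (Uo a')"
  "\<lbrakk>a \<in> Obj A; a' \<in> Obj A\<rbrakk> \<Longrightarrow> tgt (fc2 U a a') = Uo (a \<oplus>\<^bsub>A\<^esub> a')"
  "\<lbrakk>a \<in> Obj A; a' \<in> Obj A; b \<in> Obj B\<rbrakk> \<Longrightarrow> cmpt (fc2 U a a') b = dR b a a'"
  "mon_trans B T (fc0 U)" "src (fc0 U) = smf_zero B T" "tgt (fc0 U) = Uo \<zero>\<^bsub>A\<^esub>"
  "b \<in> Obj B \<Longrightarrow> cmpt (fc0 U) b = zR b"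
proof -
  interpret BT: perm_pair B T ..
  interpret AH: perm_pair A "PermHom B T" ..
  show "f \<in> Arr A \<Longrightarrow> mon_trans B T (fm U f)"
    "\<lbrakk>a \<in> Obj A; a' \<in> Obj A\<rbrakk> \<Longrightarrow> mon_trans B T (fc2 U a a')" "mon_trans B T (fc0 U)"
    using AH.fm_Arr[OF U_smf] AH.fc2_Arr[OF U_smf] AH.fc0_Arr[OF U_smf] by simp_all
qed simp_all

end

section \<open>Iterated hom categories and the functor \<open>W\<close>\<close>

locale perm3 = A: permutative A + B: permutative B + C: permutative C
  for A :: "('oa, 'ma) pcat" and B :: "('ob, 'mb) pcat" and C :: "('oc, 'mc) pcat" (structure)
begin

sublocale AB: perm_pair A B ..
sublocale BTC: perm_triple B "A \<otimes> B" C ..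
sublocale AH: perm_pair A "PermHom B C" ..
sublocale WQ: perm_quad B "A \<otimes> B" B C ..
sublocale UT: perm_triple A "PermHom B (A \<otimes> B)" "PermHom B C" ..

abbreviation "T \<equiv> A \<otimes> B"
abbreviation "is_left \<equiv> sym_mon_functor T C"
abbreviation "is_right \<equiv> sym_mon_functor A (PermHom B C)"

lemma right_simps [simp]:
  assumes Q: "is_right Q"
  shows "a \<in> Obj A \<Longrightarrow> sym_mon_functor B C (fo Q a)"
    "f \<in> Arr A \<Longrightarrow> mon_trans B C (fm Q f)"
    "f \<in> Arr A \<Longrightarrow> src (fm Q f) = fo Q (Dom A f)" "f \<in> Arr A \<Longrightarrow> tgt (fm Q f) = fo Q (Cod A f)"
    "\<lbrakk>a \<in> Obj A; a' \<in> Obj A\<rbrakk> \<Longrightarrow> mon_trans B C (fc2 Q a a')"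
    "\<lbrakk>a \<in> Obj A; a' \<in> Obj A\<rbrakk> \<Longrightarrow> src (fc2 Q a a') = smf_plus B C (fo Q a) (fo Q a')"
    "\<lbrakk>a \<in> Obj A; a' \<in> Obj A\<rbrakk> \<Longrightarrow> tgt (fc2 Q a a') = fo Q (a \<oplus>\<^bsub>A\<^esub> a')"
    "mon_trans B C (fc0 Q)" "src (fc0 Q) = smf_zero B C" "tgt (fc0 Q) = fo Q \<zero>\<^bsub>A\<^esub>"
  using AH.fo_Obj[OF Q] AH.fm_Arr[OF Q] AH.Dom_fm[OF Q] AH.Cod_fm[OF Q] AH.fc2_Arr[OF Q] AH.Dom_fc2[OF Q]
    AH.Cod_fc2[OF Q] AH.fc0_Arr[OF Q] AH.Dom_fc0[OF Q] AH.Cod_fc0[OF Q]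
  by simp_all

lemma right_mt_simps [simp]:
  assumes Q: "mon_trans A (PermHom B C) \<theta>"
  shows "a \<in> Obj A \<Longrightarrow> mon_trans B C (cmpt \<theta> a)"
    "a \<in> Obj A \<Longrightarrow> src (cmpt \<theta> a) = fo (src \<theta>) a" "a \<in> Obj A \<Longrightarrow> tgt (cmpt \<theta> a) = fo (tgt \<theta>) a"
  using AH.cmpt_Arr[OF Q] AH.Dom_cmpt[OF Q] AH.Cod_cmpt[OF Q] by simp_all

text \<open>Seven families of values in C determine an object of the iterated hom category. For
  \<open>Wo P\<close> they are the values of P at one-term sums and at the arrows 1.g and f.1, and
  the values at \<open>dL\<close>, \<open>dR\<close>, \<open>zL\<close>, \<open>zR\<close> composed
  with the constraints of P.\<close>

lemma right_eqI:
  assumes [simp]: "is_right Q" "is_right Q'"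
    and [simp]: "\<And>a b. \<lbrakk>a \<in> Obj A; b \<in> Obj B\<rbrakk> \<Longrightarrow> fo (fo Q a) b = fo (fo Q' a) b"
      "\<And>a g. \<lbrakk>a \<in> Obj A; g \<in> Arr B\<rbrakk> \<Longrightarrow> fm (fo Q a) g = fm (fo Q' a) g"
      "\<And>a b b'. \<lbrakk>a \<in> Obj A; b \<in> Obj B; b' \<in> Obj B\<rbrakk> \<Longrightarrow> fc2 (fo Q a) b b' = fc2 (fo Q' a) b b'"
      "\<And>a. a \<in> Obj A \<Longrightarrow> fc0 (fo Q a) = fc0 (fo Q' a)"
      "\<And>f b. \<lbrakk>f \<in> Arr A; b \<in> Obj B\<rbrakk> \<Longrightarrow> cmpt (fm Q f) b = cmpt (fm Q' f) b"
      "\<And>a a' b. \<lbrakk>a \<in> Obj A; a' \<in> Obj A; b \<in> Obj B\<rbrakk> \<Longrightarrow> cmpt (fc2 Q a a') b = cmpt (fc2 Q' a a') b"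
      "\<And>b. b \<in> Obj B \<Longrightarrow> cmpt (fc0 Q) b = cmpt (fc0 Q') b"
  shows "Q = Q'"
proof (rule smf_eqI[where A = A])
  show *: "fo Q a = fo Q' a" if "a \<in> Obj A" for a
    by (rule smf_eqI[where A = B]) (use that in \<open>simp_all add: BTC.AC.smf_extensional\<close>)
  show "fm Q f = fm Q' f" if "f \<in> Arr A" for f
    using that by (intro mt_eqI[where A = B]) (simp_all add: *)
  show "fc2 Q a a' = fc2 Q' a a'" if "a \<in> Obj A" "a' \<in> Obj A" for a a'
    using that by (intro mt_eqI[where A = B]) (simp_all add: *)
  show "fc0 Q = fc0 Q'"
    by (intro mt_eqI[where A = B]) (simp_all add: *)
qed (simp_all add: AH.smf_extensional)

lemma right_mt_eqI:
  assumes [simp]: "mon_trans A (PermHom B C) \<theta>" "mon_trans A (PermHom B C) \<theta>'" "src \<theta> = src \<theta>'" "tgt \<theta> = tgt \<theta>'"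
    and [simp]: "\<And>a b. \<lbrakk>a \<in> Obj A; b \<in> Obj B\<rbrakk> \<Longrightarrow> cmpt (cmpt \<theta> a) b = cmpt (cmpt \<theta>' a) b"
  shows "\<theta> = \<theta>'"
  by (intro mt_eqI[where A = A] mt_eqI[where A = B]) simp_all

definition Wo where
  "Wo P = smf_comp A (PermHom B C) (PermHom1 B T B C (smf_id B) P) AB.U"

definition Wm where
  "Wm \<phi> = mt_hcomp A (PermHom B C) (PermHom2 B T B C (mt_id B B (smf_id B)) \<phi>)
     (mt_id A (PermHom B T) AB.U)"

lemma Wo_right [simp]: "is_left P \<Longrightarrow> is_right (Wo P)"
  by (simp add: Wo_def)

lemma Wm_right [simp]: "mon_trans T C \<phi> \<Longrightarrow> mon_trans A (PermHom B C) (Wm \<phi>)"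
  unfolding Wm_def by (intro UT.mt_hcomp_mon_trans WQ.PermHom2_mon_trans) simp_all

lemma Wm_dom_cod [simp]: "src (Wm \<phi>) = Wo (src \<phi>)" "tgt (Wm \<phi>) = Wo (tgt \<phi>)"
  by (simp_all add: Wm_def Wo_def)

context
  notes [simp del] = AB.U_simps(2-4) and [simp] = AB.U_parts AB.pr_Ident
begin

lemma Wo_simps [simp]:
  assumes [simp]: "is_left P"
  shows "\<lbrakk>a \<in> Obj A; b \<in> Obj B\<rbrakk> \<Longrightarrow> fo (fo (Wo P) a) b = fo P [(a, b)]"
    "\<lbrakk>a \<in> Obj A; g \<in> Arr B\<rbrakk> \<Longrightarrow> fm (fo (Wo P) a) g = fm P (AB.pr (\<one>\<^bsub>A\<^esub> a) g)"
    "\<lbrakk>a \<in> Obj A; b \<in> Obj B; b' \<in> Obj B\<rbrakk> \<Longrightarrow> fc2 (fo (Wo P) a) b b'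
      = fm P (AB.dL a b b') \<cdot> fc2 P [(a, b)] [(a, b')]"
    "a \<in> Obj A \<Longrightarrow> fc0 (fo (Wo P) a) = fm P (AB.zL a) \<cdot> fc0 P"
    "\<lbrakk>f \<in> Arr A; b \<in> Obj B\<rbrakk> \<Longrightarrow> cmpt (fm (Wo P) f) b = fm P (AB.pr f (\<one>\<^bsub>B\<^esub> b))"
    "\<lbrakk>a \<in> Obj A; a' \<in> Obj A; b \<in> Obj B\<rbrakk> \<Longrightarrow> cmpt (fc2 (Wo P) a a') b
      = fm P (AB.dR b a a') \<cdot> fc2 P [(a, b)] [(a', b)]"
    "b \<in> Obj B \<Longrightarrow> cmpt (fc0 (Wo P)) b = fm P (AB.zR b) \<cdot> fc0 P"
  by (simp_all add: Wo_def)

end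

end

lemma (in perm_pair) iso_mt_id [simp]: "sym_mon_functor A B F \<Longrightarrow> iso (PermHom A B) (mt_id A B F)"
  using H.iso_Ident[of F] by simp

context perm3
begin

definition W where
  "W = smf_restrict (PermHom T C) \<lparr>fo = Wo, fm = Wm,
     fc2 = \<lambda>P P'. \<one>\<^bsub>PermHom A (PermHom B C)\<^esub> (smf_plus A (PermHom B C) (Wo P) (Wo P')),
     fc0 = \<one>\<^bsub>PermHom A (PermHom B C)\<^esub> (smf_zero A (PermHom B C))\<rparr>"

lemma W_simps [simp]:
  "is_left P \<Longrightarrow> fo W P = Wo P" "mon_trans T C \<phi> \<Longrightarrow> fm W \<phi> = Wm \<phi>"
  "\<lbrakk>is_left P; is_left P'\<rbrakk> \<Longrightarrow> fc2 W P P' = mt_id A (PermHom B C) (smf_plus A (PermHom B C) (Wo P) (Wo P'))"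
  "fc0 W = mt_id A (PermHom B C) (smf_zero A (PermHom B C))"
  by (simp_all add: W_def)

lemma cmpt_Wm [simp]:
  assumes [simp]: "mon_trans T C \<phi>" and [simp]: "a \<in> Obj A" "b \<in> Obj B"
  shows "cmpt (cmpt (Wm \<phi>) a) b = cmpt \<phi> [(a, b)]"
proof -
  have "mon_trans B T (mt_id B T (AB.Uo a))" by simp
  then show ?thesis by (simp add: Wm_def)
qed

lemma cmpt_mid:
  assumes "sym_mon_functor B C F" "sym_mon_functor B C G" "sym_mon_functor B C H" "sym_mon_functor B C K" "b \<in> Obj B"
  shows "cmpt (BTC.AC.H.mid F G H K) b = C.mid (fo F b) (fo G b) (fo H b) (fo K b)"
  using assms by (simp add: BTC.AC.H.mid_def C.mid_def)

text \<open>Strictness of \<open>W\<close> needs this equality of objects. It holds because the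
  shuffle entering the constraint of a sum in \<open>PermHom B C\<close> has the shuffle of C as its
  components (\<open>cmpt_mid\<close>).\<close>

lemma Wo_plus:
  assumes [simp]: "is_left P" "is_left P'"
  shows "Wo (smf_plus T C P P') = smf_plus A (PermHom B C) (Wo P) (Wo P')"
proof (rule right_eqI, goal_cases)
  case (5 a b b')
  then show ?case by (simp add: C.interchange_Cmp)
next
  case (6 a)
  then show ?case by (simp add: C.interchange)
next
  case (8 a a' b)
  then show ?case by (simp add: C.interchange_Cmp cmpt_mid)
next
  case (9 b)
  then show ?case by (simp add: C.interchange)
qed simp_all

lemma Wo_zero: "Wo (smf_zero T C) = smf_zero A (PermHom B C)"
  by (rule right_eqI) simp_all

lemma W_strict: "strict_sym_mon_functor (PermHom T C) (PermHom A (PermHom B C)) W"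
proof -
  interpret W: perm_pair "PermHom T C" "PermHom A (PermHom B C)" ..
  have "sym_mon_functor (PermHom T C) (PermHom A (PermHom B C)) (smf_restrict (PermHom T C) W)"
  proof (rule W.sym_mon_functorI, goal_cases)
    case (5 P)
    then show ?case by (simp, intro right_mt_eqI) simp_all
  next
    case (6 \<phi> \<psi>)
    then show ?case by (simp, intro right_mt_eqI) simp_all
  next
    case (10 \<phi> \<psi>)
    then show ?case by (simp add: Wo_plus, intro right_mt_eqI) (simp_all add: Wo_plus)
  next
    case (14 P P' P'')
    then show ?case by (simp add: Wo_plus, intro right_mt_eqI) (simp_all add: Wo_plus)
  next
    case (15 P)
    then show ?case by (simp add: Wo_plus Wo_zero, intro right_mt_eqI) (simp_all add: Wo_plus Wo_zero)
  next
    case (16 P P')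
    then show ?case by (simp add: Wo_plus, intro right_mt_eqI) (simp_all add: Wo_plus)
  qed (auto simp: Wo_plus Wo_zero)
  then have "sym_mon_functor (PermHom T C) (PermHom A (PermHom B C)) W"
    by (simp add: W_def)
  then show ?thesis
    unfolding strict_sym_mon_functor_def strict_sym_mon_functor_axioms_def by simp
qed

text \<open>For a family compatible with the constraints, naturality on the generators other than
  \<beta> suffices. At \<beta> and at sums the square is obtained after precomposition with
  \<open>fc2 P\<close>, which is then cancelled; inverses and composites follow formally.\<close>

lemma left_nat:
  assumes [simp]: "is_left P" "is_left P'"
    and l [simp]: "\<And>X. X \<in> Obj T \<Longrightarrow> l X \<in> Arr C" "\<And>X. X \<in> Obj T \<Longrightarrow> Dom C (l X) = fo P X"
      "\<And>X. X \<in> Obj T \<Longrightarrow> Cod C (l X) = fo P' X"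
    and sum: "\<And>X Y. \<lbrakk>X \<in> Obj T; Y \<in> Obj T\<rbrakk> \<Longrightarrow> l (X @ Y) \<cdot> fc2 P X Y = fc2 P' X Y \<cdot> (l X \<boxplus> l Y)"
    and zero: "l [] \<cdot> fc0 P = fc0 P'"
    and pr: "\<And>f g. \<lbrakk>f \<in> Arr A; g \<in> Arr B\<rbrakk> \<Longrightarrow> l [(Cod A f, Cod B g)] \<cdot> fm P (AB.pr f g) = fm P' (AB.pr f g) \<cdot> l [(Dom A f, Dom B g)]"
    and dL: "\<And>a b b'. \<lbrakk>a \<in> Obj A; b \<in> Obj B; b' \<in> Obj B\<rbrakk> \<Longrightarrow>
      l [(a, b \<oplus>\<^bsub>B\<^esub> b')] \<cdot> fm P (AB.dL a b b') = fm P' (AB.dL a b b') \<cdot> l [(a, b), (a, b')]"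
    and dR: "\<And>b a a'. \<lbrakk>b \<in> Obj B; a \<in> Obj A; a' \<in> Obj A\<rbrakk> \<Longrightarrow>
      l [(a \<oplus>\<^bsub>A\<^esub> a', b)] \<cdot> fm P (AB.dR b a a') = fm P' (AB.dR b a a') \<cdot> l [(a, b), (a', b)]"
    and zL: "\<And>a. a \<in> Obj A \<Longrightarrow> l [(a, \<zero>\<^bsub>B\<^esub>)] \<cdot> fm P (AB.zL a) = fm P' (AB.zL a) \<cdot> l []"
    and zR: "\<And>b. b \<in> Obj B \<Longrightarrow> l [(\<zero>\<^bsub>A\<^esub>, b)] \<cdot> fm P (AB.zR b) = fm P' (AB.zR b) \<cdot> l []"
  shows "mon_trans T C \<lparr>src = P, tgt = P', cmpt = restrict l (Obj T)\<rparr>"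
proof (rule BTC.BC.mon_transI, goal_cases)
  case (6 E)
  then show ?case
  proof (induction E rule: AB.T_arr_induct)
    case Nil
    have "[] \<in> Obj T" by simp
    from BTC.BC.fm_Ident[OF assms(1) this] BTC.BC.fm_Ident[OF assms(2) this] l[OF this] show ?case by simp
  next
    case (Sym p q)
    then have [simp]: "[p] \<in> Obj T" "[q] \<in> Obj T" "[p, q] \<in> Obj T" "[q, p] \<in> Obj T" by auto
    \<comment> \<open>The memberships just proved are stated with \<open>Obj T\<close>, so its
      unfolding to \<open>lists\<close> is switched off. The same device recurs below.\<close>
    note [simp del] = AB.Obj_T
    interpret P: sym_mon_functor T C P by simp
    interpret P': sym_mon_functor T C P' by simp
    \<comment> \<open>The symmetry axioms of P and P' replace the images of the symmetry of T by the
      symmetry of C, which is natural.\<close>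
    have "(fm P' (\<beta>\<^bsub>T\<^esub> [p] [q]) \<cdot> l [p, q]) \<cdot> fc2 P [p] [q] = fm P' (\<beta>\<^bsub>T\<^esub> [p] [q]) \<cdot> (fc2 P' [p] [q] \<cdot> (l [p] \<boxplus> l [q]))"
      using sum[of "[p]" "[q]"] by simp
    also have "\<dots> = fc2 P' [q] [p] \<cdot> (\<beta> (fo P' [p]) (fo P' [q]) \<cdot> (l [p] \<boxplus> l [q]))"
      by (subst C.assoc_eq[OF P'.fc2_symmetry]) (simp_all del: AB.Obj_T)
    also have "\<dots> = (fc2 P' [q] [p] \<cdot> (l [q] \<boxplus> l [p])) \<cdot> \<beta> (fo P [p]) (fo P [q])"
      by (simp add: C.Sym_nat del: AB.Obj_T)
    also have "\<dots> = l [q, p] \<cdot> (fc2 P [q] [p] \<cdot> \<beta> (fo P [p]) (fo P [q]))"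
      using sum[of "[q]" "[p]"] by (simp del: AB.Obj_T flip: sum)
    also have "\<dots> = (l [q, p] \<cdot> fm P (\<beta>\<^bsub>T\<^esub> [p] [q])) \<cdot> fc2 P [p] [q]"
      using P.fc2_symmetry[of "[p]" "[q]"] by (simp del: AB.Obj_T)
    finally have "fm P' (\<beta>\<^bsub>T\<^esub> [p] [q]) \<cdot> l [p, q] = l [q, p] \<cdot> fm P (\<beta>\<^bsub>T\<^esub> [p] [q])"
      by (rule C.iso_cancel_right) (simp_all del: AB.Obj_T)
    then show ?case by (simp del: AB.Obj_T)
  next
    case (inv E)
    note [simp] = AB.T.iso_Arr[OF inv(1)]
    show ?case using inv
      by (simp add: AB.T.iso_Arr is_functor.fm_inv[OF sym_mon_functor.axioms(3)[OF assms(1)]]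
          is_functor.fm_inv[OF sym_mon_functor.axioms(3)[OF assms(2)]])
        (rule C.inv_commute[symmetric]; simp del: AB.Obj_T)
  next
    case (Cmp E E')
    have "l (Cod T E') \<cdot> (fm P E' \<cdot> fm P E) = fm P' E' \<cdot> (l (Dom T E') \<cdot> fm P E)"
      by (rule C.assoc_eq) (use Cmp in \<open>simp_all del: AB.Obj_T\<close>)
    with Cmp show ?case by (simp del: AB.Obj_T)
  next
    case (Asum E E')
    note [simp] = Asum(1,2)
    have [simp]: "Dom T E @ Dom T E' \<in> Obj T" "Cod T E @ Cod T E' \<in> Obj T"
      using AB.T.Obj_Dom[OF Asum(1)] AB.T.Obj_Dom[OF Asum(2)] AB.T.Obj_Cod[OF Asum(1)] AB.T.Obj_Cod[OF Asum(2)] by auto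
    note [simp del] = AB.Obj_T
    have f: "fc2 P (Cod T E) (Cod T E') \<cdot> (fm P E \<boxplus> fm P E') = fm P (E \<boxplus>\<^bsub>T\<^esub> E') \<cdot> fc2 P (Dom T E) (Dom T E')"
      and f': "fc2 P' (Cod T E) (Cod T E') \<cdot> (fm P' E \<boxplus> fm P' E') = fm P' (E \<boxplus>\<^bsub>T\<^esub> E') \<cdot> fc2 P' (Dom T E) (Dom T E')"
      by (rule BTC.BC.fc2_nat; simp)+
    have "(l (Cod T E @ Cod T E') \<cdot> fm P (E \<boxplus>\<^bsub>T\<^esub> E')) \<cdot> fc2 P (Dom T E) (Dom T E')
      = l (Cod T E @ Cod T E') \<cdot> (fc2 P (Cod T E) (Cod T E') \<cdot> (fm P E \<boxplus> fm P E'))"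
      by (simp add: f)
    also have "\<dots> = fc2 P' (Cod T E) (Cod T E') \<cdot> ((l (Cod T E) \<boxplus> l (Cod T E')) \<cdot> (fm P E \<boxplus> fm P E'))"
      by (rule C.assoc_eq[OF sum]) simp_all
    also have "\<dots> = fc2 P' (Cod T E) (Cod T E') \<cdot> ((fm P' E \<boxplus> fm P' E') \<cdot> (l (Dom T E) \<boxplus> l (Dom T E')))"
      by (simp add: C.interchange Asum(3,4))
    also have "\<dots> = fm P' (E \<boxplus>\<^bsub>T\<^esub> E') \<cdot> (fc2 P' (Dom T E) (Dom T E') \<cdot> (l (Dom T E) \<boxplus> l (Dom T E')))"
      by (rule C.assoc_eq[OF f']) simp_all
    also have "\<dots> = (fm P' (E \<boxplus>\<^bsub>T\<^esub> E') \<cdot> l (Dom T E @ Dom T E')) \<cdot> fc2 P (Dom T E) (Dom T E')"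
      by (simp flip: sum)
    finally have "l (Cod T E @ Cod T E') \<cdot> fm P (E \<boxplus>\<^bsub>T\<^esub> E') = fm P' (E \<boxplus>\<^bsub>T\<^esub> E') \<cdot> l (Dom T E @ Dom T E')"
      by (rule C.iso_cancel_right) simp_all
    then show ?case by simp
  qed (simp_all add: pr dL dR zL zR)
qed (simp_all add: sum zero)

end

section \<open>Currying is fully faithful\<close>

context perm3
begin

text \<open>Compatibility with the constraints of \<open>P\<close> and \<open>P'\<close> leaves no other choice for the components of a
  lift of \<open>\<theta>: Wo P \<rightarrow> Wo P'\<close>.\<close>

fun glue where
  "glue P P' \<theta> [] = fc0 P' \<cdot> inv_arr C (fc0 P)"
| "glue P P' \<theta> (p # X) = fc2 P' [p] X \<cdot>
    ((cmpt (cmpt \<theta> (fst p)) (snd p) \<boxplus> glue P P' \<theta> X) \<cdot> inv_arr C (fc2 P [p] X))"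

context
  fixes P P' \<theta>
  assumes P [simp]: "is_left P" "is_left P'" and \<theta> [simp]: "mon_trans A (PermHom B C) \<theta>" "src \<theta> = Wo P" "tgt \<theta> = Wo P'"
begin

interpretation P: sym_mon_functor T C P by (rule P)
interpretation P': sym_mon_functor T C P' by (rule P)

abbreviation (input) "gl \<equiv> glue P P' \<theta>"

lemma glue_dom_cod:
  "X \<in> Obj T \<Longrightarrow> gl X \<in> Arr C \<and> Dom C (gl X) = fo P X \<and> Cod C (gl X) = fo P' X"
proof (induction X)
  case Nil
  then have "[] \<in> Obj T" by simp
  then show ?case by simp
next
  case (Cons p X)
  then have [simp]: "[p] \<in> Obj T" "X \<in> Obj T" "p # X \<in> Obj T" "fst p \<in> Obj A" "snd p \<in> Obj B" "[p] @ X = p # X" by auto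
  show ?case using Cons.IH by (simp del: AB.Obj_T)
qed

lemma glue_simps [simp]: "X \<in> Obj T \<Longrightarrow> gl X \<in> Arr C" "X \<in> Obj T \<Longrightarrow> Dom C (gl X) = fo P X"
  "X \<in> Obj T \<Longrightarrow> Cod C (gl X) = fo P' X"
  using glue_dom_cod by blast+

lemma glue_Nil: "gl [] \<cdot> fc0 P = fc0 P'"
proof -
  have "[] \<in> Obj T" by simp
  then show ?thesis by simp
qed

lemma glue_Cons:
  assumes "[(a, b)] \<in> Obj T" "X \<in> Obj T"
  shows "gl ((a, b) # X) \<cdot> fc2 P [(a, b)] X = fc2 P' [(a, b)] X \<cdot> (cmpt (cmpt \<theta> a) b \<boxplus> gl X)"
proof -
  have [simp]: "a \<in> Obj A" "b \<in> Obj B" "[(a, b)] @ X = (a, b) # X" "(a, b) # X \<in> Obj T" using assms by auto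
  show ?thesis using assms by (simp del: AB.Obj_T)
qed

text \<open>A one-term sum is a list with an empty tail, which \<open>glue\<close> carries through
  the constraints; the right unit laws of P and P' remove it.\<close>

lemma glue_single:
  assumes [simp]: "a \<in> Obj A" "b \<in> Obj B"
  shows "gl [(a, b)] = cmpt (cmpt \<theta> a) b"
proof -
  have [simp]: "[(a, b)] \<in> Obj T" "[] \<in> Obj T" by auto
  note [simp del] = AB.Obj_T glue.simps
  have u: "fc2 F [(a, b)] [] \<cdot> (\<one> (fo F [(a, b)]) \<boxplus> fc0 F) = \<one> (fo F [(a, b)])" if "is_left F" for F
    using sym_mon_functor.fc2_unit_right[OF that, of "[(a, b)]"] by simp
  have "gl [(a, b)] = gl [(a, b)] \<cdot> (fc2 P [(a, b)] [] \<cdot> (\<one> (fo P [(a, b)]) \<boxplus> fc0 P))"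
    by (simp add: u)
  also have "\<dots> = fc2 P' [(a, b)] [] \<cdot> ((cmpt (cmpt \<theta> a) b \<boxplus> gl []) \<cdot> (\<one> (fo P [(a, b)]) \<boxplus> fc0 P))"
    by (rule C.assoc_eq[OF glue_Cons]) simp_all
  also have "\<dots> = (fc2 P' [(a, b)] [] \<cdot> (\<one> (fo P' [(a, b)]) \<boxplus> fc0 P')) \<cdot> (cmpt (cmpt \<theta> a) b \<boxplus> \<one> \<zero>)"
    by (simp add: C.interchange glue_Nil del: C.Asum_Zero_right)
  also have "\<dots> = cmpt (cmpt \<theta> a) b" by (simp add: u)
  finally show ?thesis .
qed

text \<open>The recursion gives monoidality only for a one-term left summand
  (\<open>glue_Cons\<close>). Associativity of both constraints extends it to longer ones, after
  precomposition with the invertible \<open>fc2 P [p] X \<boxplus> \<one> (fo P Y)\<close>.\<close>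

lemma glue_append:
  assumes "X \<in> Obj T" and Y [simp]: "Y \<in> Obj T"
  shows "gl (X @ Y) \<cdot> fc2 P X Y = fc2 P' X Y \<cdot> (gl X \<boxplus> gl Y)"
  using assms(1)
proof (induction X)
  case Nil
  then have [simp]: "[] \<in> Obj T" by simp
  note [simp del] = AB.Obj_T glue.simps
  have u: "fc2 F [] Y \<cdot> (fc0 F \<boxplus> \<one> (fo F Y)) = \<one> (fo F Y)" if "is_left F" for F
    using sym_mon_functor.fc2_unit_left[OF that, of Y] by simp
  have "(fc2 P' [] Y \<cdot> (gl [] \<boxplus> gl Y)) \<cdot> (fc0 P \<boxplus> \<one> (fo P Y))
    = (fc2 P' [] Y \<cdot> (fc0 P' \<boxplus> \<one> (fo P' Y))) \<cdot> (\<one> \<zero> \<boxplus> gl Y)"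
    by (simp add: C.interchange glue_Nil del: C.Asum_Zero_left)
  also have "\<dots> = (gl Y \<cdot> fc2 P [] Y) \<cdot> (fc0 P \<boxplus> \<one> (fo P Y))"
    by (simp add: u)
  finally have "fc2 P' [] Y \<cdot> (gl [] \<boxplus> gl Y) = gl Y \<cdot> fc2 P [] Y"
    by (rule C.iso_cancel_right) simp_all
  then show ?case by simp
next
  case (Cons p X)
  obtain a b where p: "p = (a, b)" by (cases p)
  from Cons have [simp]: "[(a, b)] \<in> Obj T" "X \<in> Obj T" "(a, b) # X \<in> Obj T" "a \<in> Obj A" "b \<in> Obj B"
    "X @ Y \<in> Obj T" "(a, b) # X @ Y \<in> Obj T" "[(a, b)] @ Z = (a, b) # Z" for Z using Y by (auto simp: p)
  note [simp del] = AB.Obj_T glue.simps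
  let ?t = "cmpt (cmpt \<theta> a) b"
  have a: "fc2 F ((a, b) # X) Y \<cdot> (fc2 F [(a, b)] X \<boxplus> \<one> (fo F Y))
    = fc2 F [(a, b)] (X @ Y) \<cdot> (\<one> (fo F [(a, b)]) \<boxplus> fc2 F X Y)" if "is_left F" for F
    using sym_mon_functor.fc2_assoc[OF that, of "[(a, b)]" X Y] by simp
  have "(gl ((a, b) # X @ Y) \<cdot> fc2 P ((a, b) # X) Y) \<cdot> (fc2 P [(a, b)] X \<boxplus> \<one> (fo P Y))
    = gl ((a, b) # X @ Y) \<cdot> (fc2 P [(a, b)] (X @ Y) \<cdot> (\<one> (fo P [(a, b)]) \<boxplus> fc2 P X Y))"
    by (simp add: a)
  also have "\<dots> = fc2 P' [(a, b)] (X @ Y) \<cdot> ((?t \<boxplus> gl (X @ Y)) \<cdot> (\<one> (fo P [(a, b)]) \<boxplus> fc2 P X Y))"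
    by (rule C.assoc_eq[OF glue_Cons]) simp_all
  also have "\<dots> = (fc2 P' [(a, b)] (X @ Y) \<cdot> (\<one> (fo P' [(a, b)]) \<boxplus> fc2 P' X Y)) \<cdot> (?t \<boxplus> (gl X \<boxplus> gl Y))"
    using Cons.IH by (simp add: C.interchange)
  also have "\<dots> = fc2 P' ((a, b) # X) Y \<cdot> ((fc2 P' [(a, b)] X \<cdot> (?t \<boxplus> gl X)) \<boxplus> gl Y)"
    using C.interchange[of "?t \<boxplus> gl X" "fc2 P' [(a, b)] X" "gl Y" "\<one> (fo P' Y)"]
    by (simp flip: a)
  also have "\<dots> = (fc2 P' ((a, b) # X) Y \<cdot> (gl ((a, b) # X) \<boxplus> gl Y)) \<cdot> (fc2 P [(a, b)] X \<boxplus> \<one> (fo P Y))"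
    by (simp add: C.interchange glue_Cons)
  finally have "gl ((a, b) # X @ Y) \<cdot> fc2 P ((a, b) # X) Y = fc2 P' ((a, b) # X) Y \<cdot> (gl ((a, b) # X) \<boxplus> gl Y)"
    by (rule C.iso_cancel_right) simp_all
  then show ?case by (simp add: p)
qed

text \<open>Naturality of the glued family on generators uses every part of the structure of
  \<theta>: for f.g, naturality of \<theta> in A and of its components in B; for \<open>dL\<close>
  and \<open>zL\<close>, monoidality of the components \<open>cmpt \<theta> a\<close>; for
  \<open>dR\<close> and \<open>zR\<close>, monoidality of \<theta> itself.\<close>

lemma W_full: "\<exists>\<phi>. mon_trans T C \<phi> \<and> src \<phi> = P \<and> tgt \<phi> = P' \<and> Wm \<phi> = \<theta>"
proof -
  let ?\<phi> = "\<lparr>src = P, tgt = P', cmpt = restrict gl (Obj T)\<rparr>"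
  have nat_l: "cmpt (cmpt \<theta> (Cod A f)) b \<cdot> fm P (AB.pr f (\<one>\<^bsub>B\<^esub> b)) = fm P' (AB.pr f (\<one>\<^bsub>B\<^esub> b)) \<cdot> cmpt (cmpt \<theta> (Dom A f)) b"
    if "f \<in> Arr A" "b \<in> Obj B" for f b
    using arg_cong[OF AH.cmpt_nat[OF \<theta>(1) that(1) HOL.refl], of "\<lambda>\<phi>. cmpt \<phi> b"] that by simp
  have nat_r: "cmpt (cmpt \<theta> a) (Cod B h) \<cdot> fm P (AB.pr (\<one>\<^bsub>A\<^esub> a) h) = fm P' (AB.pr (\<one>\<^bsub>A\<^esub> a) h) \<cdot> cmpt (cmpt \<theta> a) (Dom B h)"
    if "h \<in> Arr B" "a \<in> Obj A" for h a
    using BTC.AC.cmpt_nat[of "cmpt \<theta> a" h] that by simp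
  have "mon_trans T C ?\<phi>"
  proof (rule left_nat, goal_cases)
    case (8 f h)
    have [simp]: "[(x, y)] \<in> Obj T" if "x \<in> Obj A" "y \<in> Obj B" for x y using that by simp
    note [simp] = 8
    note [simp del] = AB.Obj_T
    have "gl [(Cod A f, Cod B h)] \<cdot> fm P (AB.pr f h) =
       (cmpt (cmpt \<theta> (Cod A f)) (Cod B h) \<cdot> fm P (AB.pr f (\<one>\<^bsub>B\<^esub> (Cod B h)))) \<cdot> fm P (AB.pr (\<one>\<^bsub>A\<^esub> (Dom A f)) h)"
      by (subst AB.pr_split(1)) (simp_all add: glue_single del: glue.simps)
    also have "\<dots> = (fm P' (AB.pr f (\<one>\<^bsub>B\<^esub> (Cod B h))) \<cdot> fm P' (AB.pr (\<one>\<^bsub>A\<^esub> (Dom A f)) h)) \<cdot> cmpt (cmpt \<theta> (Dom A f)) (Dom B h)"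
      by (simp add: nat_l nat_r del: glue.simps)
    also have "\<dots> = fm P' (AB.pr f h) \<cdot> gl [(Dom A f, Dom B h)]"
      by (subst AB.pr_split(1)[of f h]) (simp_all add: glue_single del: glue.simps)
    finally show ?case .
  next
    case (9 a b b')
    then have [simp]: "[(a, b)] \<in> Obj T" "[(a, b')] \<in> Obj T" "[(a, b), (a, b')] \<in> Obj T" "[(a, b \<oplus>\<^bsub>B\<^esub> b')] \<in> Obj T" by auto
    note [simp] = 9 and [simp del] = AB.Obj_T glue.simps
    \<comment> \<open>The constraint of \<open>Wo P\<close> at a is the image of \<open>dL\<close>
      composed with \<open>fc2 P\<close>, so monoidality of \<open>cmpt \<theta> a\<close> gives the
      square precomposed with that constraint.\<close>
    have "(gl [(a, b \<oplus>\<^bsub>B\<^esub> b')] \<cdot> fm P (AB.dL a b b')) \<cdot> fc2 P [(a, b)] [(a, b')]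
      = (fm P' (AB.dL a b b') \<cdot> gl [(a, b), (a, b')]) \<cdot> fc2 P [(a, b)] [(a, b')]"
      using BTC.AC.cmpt_sum[of "cmpt \<theta> a" b b'] glue_append[of "[(a, b)]" "[(a, b')]"] by (simp add: glue_single)
    then show ?case by (rule C.iso_cancel_right) simp_all
  next
    case (10 b a a')
    then have [simp]: "[(a, b)] \<in> Obj T" "[(a', b)] \<in> Obj T" "[(a, b), (a', b)] \<in> Obj T" "[(a \<oplus>\<^bsub>A\<^esub> a', b)] \<in> Obj T" by auto
    note [simp] = 10 and [simp del] = AB.Obj_T glue.simps
    have "(gl [(a \<oplus>\<^bsub>A\<^esub> a', b)] \<cdot> fm P (AB.dR b a a')) \<cdot> fc2 P [(a, b)] [(a', b)]
      = (fm P' (AB.dR b a a') \<cdot> gl [(a, b), (a', b)]) \<cdot> fc2 P [(a, b)] [(a', b)]"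
      using arg_cong[OF AH.cmpt_sum[OF \<theta>(1), of a a'], of "\<lambda>\<phi>. cmpt \<phi> b"] glue_append[of "[(a, b)]" "[(a', b)]"]
      by (simp add: glue_single)
    then show ?case by (rule C.iso_cancel_right) simp_all
  next
    case (11 a)
    then have [simp]: "[] \<in> Obj T" "[(a, \<zero>\<^bsub>B\<^esub>)] \<in> Obj T" by auto
    note [simp] = 11 and [simp del] = AB.Obj_T glue.simps
    have "(gl [(a, \<zero>\<^bsub>B\<^esub>)] \<cdot> fm P (AB.zL a)) \<cdot> fc0 P = (fm P' (AB.zL a) \<cdot> gl []) \<cdot> fc0 P"
      using BTC.AC.cmpt_zero[of "cmpt \<theta> a"] by (simp add: glue_single glue_Nil)
    then show ?case by (rule C.iso_cancel_right) simp_all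
  next
    case (12 b)
    then have [simp]: "[] \<in> Obj T" "[(\<zero>\<^bsub>A\<^esub>, b)] \<in> Obj T" by auto
    note [simp] = 12 and [simp del] = AB.Obj_T glue.simps
    have "(gl [(\<zero>\<^bsub>A\<^esub>, b)] \<cdot> fm P (AB.zR b)) \<cdot> fc0 P = (fm P' (AB.zR b) \<cdot> gl []) \<cdot> fc0 P"
      using arg_cong[OF AH.cmpt_zero[OF \<theta>(1)], of "\<lambda>\<phi>. cmpt \<phi> b"] by (simp add: glue_single glue_Nil)
    then show ?case by (rule C.iso_cancel_right) simp_all
  qed (simp_all add: glue_append glue_Nil del: AB.Obj_T glue.simps)
  moreover from this have "Wm ?\<phi> = \<theta>"
    by (intro right_mt_eqI) (simp_all add: glue_single del: glue.simps)
  ultimately show ?thesis by (intro exI[of _ ?\<phi>]) simp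
qed

end

lemma left_mt_eqI:
  assumes [simp]: "mon_trans T C \<phi>" "mon_trans T C \<phi>'" "src \<phi> = src \<phi>'" "tgt \<phi> = tgt \<phi>'"
    and eq: "\<And>a b. \<lbrakk>a \<in> Obj A; b \<in> Obj B\<rbrakk> \<Longrightarrow> cmpt \<phi> [(a, b)] = cmpt \<phi>' [(a, b)]"
  shows "\<phi> = \<phi>'"
proof (rule mt_eqI[where A = T])
  fix X assume "X \<in> Obj T"
  then show "cmpt \<phi> X = cmpt \<phi>' X"
  proof (induction X)
    case Nil
    then have [simp]: "[] \<in> Obj T" by simp
    have "cmpt \<phi> [] \<cdot> fc0 (src \<phi>) = cmpt \<phi>' [] \<cdot> fc0 (src \<phi>)"
      using BTC.BC.cmpt_zero[of \<phi>] BTC.BC.cmpt_zero[of \<phi>'] by simp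
    then show ?case by (rule C.iso_cancel_right) (simp_all del: AB.Obj_T)
  next
    case (Cons p X)
    then have [simp]: "[p] \<in> Obj T" "X \<in> Obj T" "p # X \<in> Obj T" "[p] @ X = p # X" by auto
    have "cmpt \<phi> [p] = cmpt \<phi>' [p]" using Cons(2) eq by auto
    with Cons have "cmpt \<phi> (p # X) \<cdot> fc2 (src \<phi>) [p] X = cmpt \<phi>' (p # X) \<cdot> fc2 (src \<phi>) [p] X"
      using BTC.BC.cmpt_sum[of \<phi> "[p]" X] BTC.BC.cmpt_sum[of \<phi>' "[p]" X] by (simp del: AB.Obj_T)
    then show ?case by (rule C.iso_cancel_right) (simp_all del: AB.Obj_T)
  qed
qed (simp_all del: AB.Obj_T)

lemma W_faithful:
  assumes "mon_trans T C \<phi>" "mon_trans T C \<phi>'" "src \<phi> = src \<phi>'" "tgt \<phi> = tgt \<phi>'" "Wm \<phi> = Wm \<phi>'"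
  shows "\<phi> = \<phi>'"
  using assms(1-4) cmpt_Wm[OF assms(1)] cmpt_Wm[OF assms(2)] unfolding assms(5)
  by (intro left_mt_eqI) auto

text \<open>Fullness, applied to the identity of \<open>Wo P\<close>, yields a transformation from P
  to P'. It is an identity at one-term sums, hence everywhere by strictness and induction; its
  naturality squares then say that P and P' agree on arrows.\<close>

lemma strict_eqI:
  assumes "strict_sym_mon_functor T C P" "strict_sym_mon_functor T C P'" and W: "Wo P = Wo P'"
  shows "P = P'"
proof -
  interpret P: strict_sym_mon_functor T C P by (rule assms)
  interpret P': strict_sym_mon_functor T C P' by (rule assms)
  have [simp]: "is_left P" "is_left P'" by unfold_locales
  obtain \<phi> where \<phi> [simp]: "mon_trans T C \<phi>" "src \<phi> = P" "tgt \<phi> = P'" "Wm \<phi> = mt_id A (PermHom B C) (Wo P)"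
    using W_full[of P P' "mt_id A (PermHom B C) (Wo P)"] W by auto
  have *: "cmpt \<phi> X = \<one> (fo P X) \<and> fo P' X = fo P X" if "X \<in> Obj T" for X
    using that
  proof (induction X)
    case Nil
    then have [simp]: "[] \<in> Obj T" by simp
    \<comment> \<open>Strictness speaks of the constraints; comparing codomains turns it into
      equalities of objects.\<close>
    have d: "fo F [] = \<zero>" if "strict_sym_mon_functor T C F" for F
    proof -
      have "is_left F" using that by (simp add: strict_sym_mon_functor_def)
      then show ?thesis using BTC.BC.Cod_fc0[of F] strict_sym_mon_functor.fc0_strict[OF that] by simp
    qed
    show ?case using BTC.BC.cmpt_zero[of \<phi>] BTC.BC.Dom_cmpt[of \<phi> "[]"] d[OF assms(1)] d[OF assms(2)]
      by (simp add: P.fc0_strict P'.fc0_strict del: AB.Obj_T)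
  next
    case (Cons p X)
    then have [simp]: "[p] \<in> Obj T" "X \<in> Obj T" "p # X \<in> Obj T" "[p] @ X = p # X"
      and p: "fst p \<in> Obj A" "snd p \<in> Obj B" by auto
    have d: "fo F (p # X) = fo F [p] \<oplus> fo F X" if "strict_sym_mon_functor T C F" for F
    proof -
      have "is_left F" using that by (simp add: strict_sym_mon_functor_def)
      then show ?thesis using BTC.BC.Cod_fc2[of F "[p]" X] strict_sym_mon_functor.fc2_strict[OF that, of "[p]" X]
        by (simp del: AB.Obj_T)
    qed
    have "cmpt \<phi> [(fst p, snd p)] = \<one> (fo P [p])"
      using cmpt_Wm[OF \<phi>(1) p, unfolded \<phi>(4)] p by simp
    then have 1: "cmpt \<phi> [p] = \<one> (fo P [p])" by simp
    from this have 2: "fo P' [p] = fo P [p]"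
      using BTC.BC.Cod_cmpt[of \<phi> "[p]"] by (simp del: AB.Obj_T)
    show ?case
      using BTC.BC.cmpt_sum[of \<phi> "[p]" X] d[OF assms(1)] d[OF assms(2)] Cons.IH 1 2
      by (simp add: P.fc2_strict P'.fc2_strict del: AB.Obj_T)
  qed
  show ?thesis
  proof (rule smf_eqI[where A = T])
    fix E assume E: "E \<in> Arr T"
    then show "fm P E = fm P' E"
      using BTC.BC.cmpt_nat[of \<phi> E] * by (simp del: AB.Obj_T)
  qed (use * in \<open>simp_all add: P.fc2_strict P'.fc2_strict P.fc0_strict P'.fc0_strict P.extensional P'.extensional\<close>)
qed

end

section \<open>Strict functors out of the tensor product\<close>

context perm3
begin

fun obj_val where "obj_val Q (a, b) = fo (fo Q a) b"

definition sum_val where "sum_val Q X = foldr (\<lambda>p x. obj_val Q p \<oplus> x) X \<zero>"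

text \<open>The arrow f.g is read as f.1 followed by 1.g; the opposite order has the same value by
  \<open>right_nat\<close>.\<close>

fun arr_val where "arr_val Q (f, g) = fm (fo Q (Cod A f)) g \<cdot> cmpt (fm Q f) (Dom B g)"

fun gen_val where
  "gen_val Q (DeltaL a b b') = fc2 (fo Q a) b b'"
| "gen_val Q (DeltaR b a a') = cmpt (fc2 Q a a') b"
| "gen_val Q (Beta p q) = \<beta> (obj_val Q p) (obj_val Q q)"
| "gen_val Q (ZetaL a) = fc0 (fo Q a)"
| "gen_val Q (ZetaR b) = cmpt (fc0 Q) b"

fun val where
  "val Q (EBase fs) = foldr (\<lambda>p x. arr_val Q p \<boxplus> x) fs (\<one> \<zero>)"
| "val Q (EGen t) = gen_val Q t"
| "val Q (EInv t) = inv_arr C (gen_val Q t)"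
| "val Q (e' \<odot> e) = val Q e' \<cdot> val Q e"
| "val Q (e \<uplus> e') = val Q e \<boxplus> val Q e'"

lemma sum_val_simps [simp]: "sum_val Q [] = \<zero>" "sum_val Q (p # X) = obj_val Q p \<oplus> sum_val Q X"
  by (simp_all add: sum_val_def)

context
  fixes Q
  assumes Q [simp]: "is_right Q"
begin

interpretation Q: sym_mon_functor A "PermHom B C" Q by (rule Q)

lemma obj_val_Obj [simp]: "p \<in> Obj A \<times> Obj B \<Longrightarrow> obj_val Q p \<in> Obj C"
  by auto

lemma sum_val_Obj [simp]: "X \<in> lists (Obj A \<times> Obj B) \<Longrightarrow> sum_val Q X \<in> Obj C"
  by (induction X) auto

lemma sum_val_append [simp]: "\<lbrakk>X \<in> lists (Obj A \<times> Obj B); Y \<in> lists (Obj A \<times> Obj B)\<rbrakk>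
    \<Longrightarrow> sum_val Q (X @ Y) = sum_val Q X \<oplus> sum_val Q Y"
  by (induction X) auto

lemma arr_val_simps [simp]: "f \<in> Arr A \<times> Arr B \<Longrightarrow> arr_val Q f \<in> Arr C"
  "f \<in> Arr A \<times> Arr B \<Longrightarrow> Dom C (arr_val Q f) = obj_val Q (map_prod (Dom A) (Dom B) f)"
  "f \<in> Arr A \<times> Arr B \<Longrightarrow> Cod C (arr_val Q f) = obj_val Q (map_prod (Cod A) (Cod B) f)"
  by (cases f; auto)+

lemma iso_cmpt_fc2 [simp]: "\<lbrakk>a \<in> Obj A; a' \<in> Obj A; b \<in> Obj B\<rbrakk> \<Longrightarrow> iso C (cmpt (fc2 Q a a') b)"
  by (rule BTC.AC.iso_cmpt) (auto intro: Q.fc2_iso)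

lemma iso_cmpt_fc0 [simp]: "b \<in> Obj B \<Longrightarrow> iso C (cmpt (fc0 Q) b)"
  by (rule BTC.AC.iso_cmpt) (auto intro: Q.fc0_iso)

lemma gen_val_simps [simp]:
  assumes "gen_ok A B t"
  shows "iso C (gen_val Q t)" "gen_val Q t \<in> Arr C" "Dom C (gen_val Q t) = sum_val Q (gen_dom t)"
    "Cod C (gen_val Q t) = sum_val Q (gen_cod A B t)"
  using assms by (cases t; auto)+

lemma val_simps [simp]:
  assumes "wf_exp A B e"
  shows "val Q e \<in> Arr C" "Dom C (val Q e) = sum_val Q (edom A B e)" "Cod C (val Q e) = sum_val Q (ecod A B e)"
proof -
  have "val Q e \<in> Arr C \<and> Dom C (val Q e) = sum_val Q (edom A B e) \<and> Cod C (val Q e) = sum_val Q (ecod A B e)"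
    using assms
  proof (induction e)
    case (EBase fs)
    then show ?case by (induction fs) (auto simp del: arr_val.simps obj_val.simps)
  qed (auto simp: AB.edom_Obj AB.ecod_Obj)
  then show "val Q e \<in> Arr C" "Dom C (val Q e) = sum_val Q (edom A B e)" "Cod C (val Q e) = sum_val Q (ecod A B e)"
    by blast+
qed

lemma val_eid [simp]: "X \<in> lists (Obj A \<times> Obj B) \<Longrightarrow> val Q (eid A B X) = \<one> (sum_val Q X)"
proof (induction X)
  case (Cons p X)
  then have "fst p \<in> Obj A" "snd p \<in> Obj B" "sum_val Q X \<in> Obj C" by auto
  with Cons show ?case by (cases p) (simp add: eid_def)
qed (simp add: eid_def)

text \<open>The recursions for \<open>ebeta1\<close> and \<open>ebeta\<close> are the two hexagons,
  which hold in C as \<open>Sym_Osum\<close> and \<open>Osum_Sym\<close>.\<close>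

lemma val_ebeta1: 
  assumes "Y \<in> lists (Obj A \<times> Obj B)" and p: "p \<in> Obj A \<times> Obj B"
  shows "val Q (ebeta1 A B p Y) = \<beta> (obj_val Q p) (sum_val Q Y)"
  using assms(1) 
proof (induction Y)
  case (Cons q Y)
  then have "q \<in> Obj A \<times> Obj B" "Y \<in> lists (Obj A \<times> Obj B)" by auto
  with Cons.IH p show ?case by (simp add: C.Sym_Osum)
qed (use p in simp)

lemma val_ebeta: 
  assumes "X \<in> lists (Obj A \<times> Obj B)" "Y \<in> lists (Obj A \<times> Obj B)"
  shows "val Q (ebeta A B X Y) = \<beta> (sum_val Q X) (sum_val Q Y)"
  using assms(1) 
proof (induction X)
  case (Cons p X)
  then have "p \<in> Obj A \<times> Obj B" "X \<in> lists (Obj A \<times> Obj B)" by auto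
  with Cons.IH assms(2) show ?case by (simp add: C.Osum_Sym val_ebeta1)
qed (use assms in simp)

lemma right_nat: "\<lbrakk>f \<in> Arr A; g \<in> Arr B; Dom A f = a; Cod B g = b\<rbrakk> \<Longrightarrow>
    cmpt (fm Q f) b \<cdot> fm (fo Q a) g = fm (fo Q (Cod A f)) g \<cdot> cmpt (fm Q f) (Dom B g)"
  using BTC.AC.cmpt_nat[of "fm Q f" g b] by simp

lemma arr_val_Cmp:
  assumes [simp]: "f \<in> Arr A" "g \<in> Arr A" "Dom A g = Cod A f" "f' \<in> Arr B" "g' \<in> Arr B" "Dom B g' = Cod B f'"
  shows "arr_val Q (g \<cdot>\<^bsub>A\<^esub> f, g' \<cdot>\<^bsub>B\<^esub> f') = arr_val Q (g, g') \<cdot> arr_val Q (f, f')"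
  by (simp add: C.assoc_eq[OF right_nat])

lemma fc2_right_nat:
  assumes [simp]: "f \<in> Arr A" "f' \<in> Arr A" "b \<in> Obj B"
  shows "cmpt (fc2 Q (Cod A f) (Cod A f')) b \<cdot> (cmpt (fm Q f) b \<boxplus> cmpt (fm Q f') b)
    = cmpt (fm Q (f \<boxplus>\<^bsub>A\<^esub> f')) b \<cdot> cmpt (fc2 Q (Dom A f) (Dom A f')) b"
  using arg_cong[OF AH.fc2_nat[OF Q assms(1,2) HOL.refl HOL.refl], of "\<lambda>\<phi>. cmpt \<phi> b"] by simp

lemma fc2_right_assoc:
  assumes [simp]: "a \<in> Obj A" "a' \<in> Obj A" "a'' \<in> Obj A" "b \<in> Obj B"
  shows "cmpt (fc2 Q (a \<oplus>\<^bsub>A\<^esub> a') a'') b \<cdot> (cmpt (fc2 Q a a') b \<boxplus> \<one> (fo (fo Q a'') b))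
    = cmpt (fc2 Q a (a' \<oplus>\<^bsub>A\<^esub> a'')) b \<cdot> (\<one> (fo (fo Q a) b) \<boxplus> cmpt (fc2 Q a' a'') b)"
  using arg_cong[OF Q.fc2_assoc[of a a' a''], of "\<lambda>\<phi>. cmpt \<phi> b"] by simp

lemma fc2_right_unit:
  assumes [simp]: "a \<in> Obj A" "b \<in> Obj B"
  shows "cmpt (fc2 Q \<zero>\<^bsub>A\<^esub> a) b \<cdot> (cmpt (fc0 Q) b \<boxplus> \<one> (fo (fo Q a) b)) = \<one> (fo (fo Q a) b)"
    "cmpt (fc2 Q a \<zero>\<^bsub>A\<^esub>) b \<cdot> (\<one> (fo (fo Q a) b) \<boxplus> cmpt (fc0 Q) b) = \<one> (fo (fo Q a) b)"
  using arg_cong[OF Q.fc2_unit_left[of a], of "\<lambda>\<phi>. cmpt \<phi> b"]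
    arg_cong[OF Q.fc2_unit_right[of a], of "\<lambda>\<phi>. cmpt \<phi> b"] by simp_all

lemma fc2_right_symmetry:
  assumes [simp]: "a \<in> Obj A" "a' \<in> Obj A" "b \<in> Obj B"
  shows "cmpt (fm Q (\<beta>\<^bsub>A\<^esub> a a')) b \<cdot> cmpt (fc2 Q a a') b
    = cmpt (fc2 Q a' a) b \<cdot> \<beta> (fo (fo Q a) b) (fo (fo Q a') b)"
  using arg_cong[OF Q.fc2_symmetry[of a a'], of "\<lambda>\<phi>. cmpt \<phi> b"] by simp

text \<open>The mirror image of \<open>U_smf\<close>. The strict monoidal clauses and those for
  \<beta> hold as C is permutative; the clauses for \<open>DeltaL\<close> and \<open>ZetaL\<close>
  come from the axioms of \<open>fo Q a\<close>, those for \<open>DeltaR\<close> and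
  \<open>ZetaR\<close> from the axioms of Q. Naturality of the left-hand generators in A says that
  \<open>fm Q f\<close> is monoidal, and the mixed clauses say that \<open>fc2 Q\<close> and
  \<open>fc0 Q\<close> have monoidal values.\<close>

lemma val_trel:
  assumes "trel A B e e'" "wf_exp A B e" "wf_exp A B e'"
  shows "val Q e = val Q e'"
  using assms
proof cases
  case (base_Cmp gs fs)
  \<comment> \<open>Without equal lengths \<open>map2\<close> would drop terms; well-formedness of
    the composite provides them.\<close>
  have "length gs = length fs" using assms base_Cmp by (auto dest: map_eq_imp_length_eq)
  then show ?thesis using assms unfolding base_Cmp
  proof (induction gs fs rule: list_induct2)
    case (Cons g gs f fs)
    obtain g1 g2 f1 f2 where [simp]: "g = (g1, g2)" "f = (f1, f2)" by (cases g, cases f)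
    have "val Q (EBase gs \<odot> EBase fs) = val Q (EBase (map2 (\<lambda>(g, g') (f, f'). (g \<cdot>\<^bsub>A\<^esub> f, g' \<cdot>\<^bsub>B\<^esub> f')) gs fs))"
      using Cons(3-) by (intro Cons.IH trel.base_Cmp) auto
    moreover have "wf_exp A B (EBase gs \<odot> EBase fs)" using Cons(3-) by simp
    moreover have "arr_val Q (g1 \<cdot>\<^bsub>A\<^esub> f1, g2 \<cdot>\<^bsub>B\<^esub> f2) = arr_val Q g \<cdot> arr_val Q f" 
      using arr_val_Cmp[of f1 g1 f2 g2] Cons(3-) by simp
    ultimately show ?case using Cons(3-)
        val_simps[of "EBase fs"] val_simps[of "EBase gs"]
      by (simp add: C.interchange del: arr_val.simps obj_val.simps)
  qed simp
next
  case (base_Sum fs gs)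
  have "val Q (EBase (fs @ gs)) = val Q (EBase fs) \<boxplus> val Q (EBase gs)"
    if "set fs \<subseteq> Arr A \<times> Arr B"
    using that
  proof (induction fs)
    case Nil
    then show ?case using assms base_Sum val_simps[of "EBase gs"] by simp
  next
    case (Cons f fs)
    then show ?case using assms base_Sum val_simps[of "EBase gs"] val_simps[of "EBase fs"]
      by (simp del: arr_val.simps)
  qed
  with assms base_Sum show ?thesis by simp
next
  case (DeltaL_natural f a a' g b b1 g' b' b1')
  then have [simp]: "f \<in> Arr A" "Dom A f = a" "Cod A f = a'" "g \<in> Arr B" "Dom B g = b" "Cod B g = b1"
    "g' \<in> Arr B" "Dom B g' = b'" "Cod B g' = b1'" by (auto simp: Hom_def)
  have [simp]: "a \<in> Obj A" "a' \<in> Obj A" "b \<in> Obj B" "b1 \<in> Obj B" "b' \<in> Obj B" "b1' \<in> Obj B"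
    using A.Obj_Dom[of f] A.Obj_Cod[of f] B.Obj_Dom[of g] B.Obj_Cod[of g] B.Obj_Dom[of g'] B.Obj_Cod[of g'] by simp_all
  \<comment> \<open>First g and g' pass through the constraint of \<open>fo Q a'\<close> by its
    naturality, then f passes because \<open>fm Q f\<close> is monoidal.\<close>
  have "fc2 (fo Q a') b1 b1' \<cdot> ((fm (fo Q a') g \<boxplus> fm (fo Q a') g') \<cdot> (cmpt (fm Q f) b \<boxplus> cmpt (fm Q f) b'))
    = fm (fo Q a') (g \<boxplus>\<^bsub>B\<^esub> g') \<cdot> (fc2 (fo Q a') b b' \<cdot> (cmpt (fm Q f) b \<boxplus> cmpt (fm Q f) b'))"
    using BTC.AC.fc2_nat[of "fo Q a'" g g' b1 b1'] by (intro C.assoc_eq) simp_all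
  also have "\<dots> = fm (fo Q a') (g \<boxplus>\<^bsub>B\<^esub> g') \<cdot> (cmpt (fm Q f) (b \<oplus>\<^bsub>B\<^esub> b') \<cdot> fc2 (fo Q a) b b')"
    using BTC.AC.cmpt_sum[of "fm Q f" b b'] by simp
  finally show ?thesis using DeltaL_natural by (simp add: pure_def C.interchange)
next
  case (DeltaR_natural g b b1 f a a1 f' a' a1')
  then have [simp]: "f \<in> Arr A" "Dom A f = a" "Cod A f = a1" "g \<in> Arr B" "Dom B g = b" "Cod B g = b1"
    "f' \<in> Arr A" "Dom A f' = a'" "Cod A f' = a1'" by (auto simp: Hom_def)
  have [simp]: "a \<in> Obj A" "a1 \<in> Obj A" "b \<in> Obj B" "b1 \<in> Obj B" "a' \<in> Obj A" "a1' \<in> Obj A"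
    using A.Obj_Dom[of f] A.Obj_Cod[of f] B.Obj_Dom[of g] B.Obj_Cod[of g] A.Obj_Dom[of f'] A.Obj_Cod[of f'] by simp_all
  \<comment> \<open>The roles are exchanged: g passes because \<open>fc2 Q a1 a1'\<close> is natural
    in B, then f and f' pass because \<open>fc2 Q\<close> is natural in A.\<close>
  have "cmpt (fc2 Q a1 a1') b1 \<cdot> ((fm (fo Q a1) g \<boxplus> fm (fo Q a1') g) \<cdot> (cmpt (fm Q f) b \<boxplus> cmpt (fm Q f') b))
    = fm (fo Q (a1 \<oplus>\<^bsub>A\<^esub> a1')) g \<cdot> (cmpt (fc2 Q a1 a1') b \<cdot> (cmpt (fm Q f) b \<boxplus> cmpt (fm Q f') b))"
    using BTC.AC.cmpt_nat[of "fc2 Q a1 a1'" g b1] by (intro C.assoc_eq) simp_all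
  also have "\<dots> = fm (fo Q (a1 \<oplus>\<^bsub>A\<^esub> a1')) g \<cdot> (cmpt (fm Q (f \<boxplus>\<^bsub>A\<^esub> f')) b \<cdot> cmpt (fc2 Q a a') b)"
    using fc2_right_nat[of f f' b] by simp
  finally show ?thesis using DeltaR_natural by (simp add: pure_def C.interchange)
next
  case (ZetaL_natural f a a1)
  then have [simp]: "f \<in> Arr A" "Dom A f = a" "Cod A f = a1" by (auto simp: Hom_def)
  have [simp]: "a \<in> Obj A" "a1 \<in> Obj A" using A.Obj_Dom[of f] A.Obj_Cod[of f] by simp_all
  show ?thesis using ZetaL_natural BTC.AC.cmpt_zero[of "fm Q f"] by (simp add: pure_def)
next
  case (ZetaR_natural g b b1)
  then have [simp]: "g \<in> Arr B" "Dom B g = b" "Cod B g = b1" by (auto simp: Hom_def)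
  have [simp]: "b \<in> Obj B" "b1 \<in> Obj B" using B.Obj_Dom[of g] B.Obj_Cod[of g] by simp_all
  show ?thesis using ZetaR_natural BTC.AC.cmpt_nat[of "fc0 Q" g b1] by (simp add: pure_def)
next
  case (Beta_natural e e')
  then show ?thesis using assms by (simp add: val_ebeta AB.edom_Obj AB.ecod_Obj C.Sym_nat)
next
  case (Beta_Sum X Y Z)
  then show ?thesis by (simp add: val_ebeta C.Sym_Osum)
next
  case (DeltaL_assoc a b b' b'')
  then show ?thesis
    using assms sym_mon_functor.fc2_assoc[of B C "fo Q a" b b' b''] by simp
next
  case (DeltaL_unit_left a b)
  then show ?thesis
    using assms sym_mon_functor.fc2_unit_left[of B C "fo Q a" b] by simp
next
  case (DeltaL_unit_right a b)
  then show ?thesis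
    using assms sym_mon_functor.fc2_unit_right[of B C "fo Q a" b] by simp
next
  case (DeltaL_symmetry a b b')
  then show ?thesis
    using assms sym_mon_functor.fc2_symmetry[of B C "fo Q a" b b'] by (simp add: pure_def)
next
  case (DeltaR_symmetry a a' b)
  then show ?thesis
    using assms fc2_right_symmetry[of a a' b] by (simp add: pure_def)
next
  case (DeltaL_DeltaR a a' b b')
  then show ?thesis
    using assms BTC.AC.cmpt_sum[of "fc2 Q a a'" b b'] by (simp add: C.mid_def)
next
  case ZetaL_ZetaR
  then show ?thesis
    using BTC.AC.cmpt_zero[of "fc0 Q"] by simp
next
  case (DeltaR_ZetaL a a')
  then show ?thesis
    using assms BTC.AC.cmpt_zero[of "fc2 Q a a'"] by simp
next
  case (DeltaL_ZetaR b b')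
  then show ?thesis
    using assms BTC.AC.cmpt_sum[of "fc0 Q" b b'] by simp
qed (use assms in \<open>simp_all add: C.interchange val_ebeta AB.edom_Obj AB.ecod_Obj AB.gen_Obj fc2_right_assoc fc2_right_unit\<close>)

lemma val_teq: "teq A B e e' \<Longrightarrow> val Q e = val Q e'"
  by (induction rule: teq.induct) (auto intro: val_trel)

lemma val_trep: "wf_exp A B e \<Longrightarrow> val Q (trep (tcls A B e)) = val Q e"
  using val_teq[OF AB.trep_cls] by simp

end

definition Ro where
  "Ro Q = smf_restrict T \<lparr>fo = sum_val Q, fm = \<lambda>E. val Q (trep E),
     fc2 = \<lambda>X Y. \<one> (sum_val Q X \<oplus> sum_val Q Y), fc0 = \<one> \<zero>\<rparr>"

lemma fm_Ro [simp]: "\<lbrakk>is_right Q; wf_exp A B e\<rbrakk> \<Longrightarrow> fm (Ro Q) (AB.cls e) = val Q e"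
  by (simp add: Ro_def val_trep)

lemma Ro_simps:
  "X \<in> Obj T \<Longrightarrow> fo (Ro Q) X = sum_val Q X"
  "\<lbrakk>X \<in> Obj T; Y \<in> Obj T\<rbrakk> \<Longrightarrow> fc2 (Ro Q) X Y = \<one> (sum_val Q X \<oplus> sum_val Q Y)" "fc0 (Ro Q) = \<one> \<zero>"
  by (simp_all add: Ro_def del: AB.Obj_T)

lemma Ro_strict: assumes [simp]: "is_right Q" shows "strict_sym_mon_functor T C (Ro Q)"
proof -
  have "is_left (smf_restrict T (Ro Q))"
  proof (rule BTC.BC.sym_mon_functorI, goal_cases)
    case (5 X)
    then show ?case by (simp add: AB.Ident_T Ro_simps)
  next
    case (16 X Y)
    then show ?case by (simp add: AB.Sym_T Ro_simps val_ebeta)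
  qed (auto simp: Ro_simps AB.edom_Obj AB.ecod_Obj AB.Cmp_cls AB.Asum_cls elim!: AB.Arr_T_cases)
  then have "is_left (Ro Q)" by (simp add: Ro_def)
  then show ?thesis
    unfolding strict_sym_mon_functor_def strict_sym_mon_functor_axioms_def by (simp add: Ro_simps)
qed

lemma Ro_left [simp]: "is_right Q \<Longrightarrow> is_left (Ro Q)"
  using Ro_strict by (simp add: strict_sym_mon_functor_def)

text \<open>Each of the seven families is \<open>val\<close> of a single generator or of an arrow
  \<open>pr f g\<close>, and strictness of \<open>Ro Q\<close> removes the constraints from the
  formulas for \<open>Wo\<close>.\<close>

lemma Wo_Ro:
  assumes [simp]: "is_right Q"
  shows "Wo (Ro Q) = Q"
proof -
  have g: "fm (Ro Q) (AB.pr f g) = arr_val Q (f, g)" if "f \<in> Arr A" "g \<in> Arr B" for f g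
  proof -
    have "arr_val Q (f, g) \<in> Arr C" using that by (intro arr_val_simps) auto
    then show ?thesis using that by (simp add: AB.pr_def) (simp add: pure_def)
  qed
  show ?thesis
  proof (rule right_eqI, goal_cases)
    case (4 a g)
    \<comment> \<open>In \<open>arr_val\<close> at 1.g the factor coming from A must disappear; it
      does since Q preserves identities.\<close>
    have "cmpt (fm Q (\<one>\<^bsub>A\<^esub> a)) (Dom B g) = \<one> (fo (fo Q a) (Dom B g))"
      using arg_cong[OF AH.fm_Ident[OF assms 4(1)], of "\<lambda>\<phi>. cmpt \<phi> (Dom B g)"] 4 by simp
    with 4 show ?case by (simp add: g)
  next
    case (7 f b)
    then show ?case by (simp add: g)
  qed (simp_all add: Ro_simps AB.dL_def AB.dR_def AB.zL_def AB.zR_def)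
qed

end

section \<open>Functoriality of the tensor product\<close>

text \<open>The zero object of T is rewritten to the empty list, so the general unit laws are
  restated in that normal form.\<close>

lemma (in perm_pair) Asum_T_Nil [simp]: "E \<in> Arr T \<Longrightarrow> E \<boxplus>\<^bsub>T\<^esub> \<one>\<^bsub>T\<^esub> [] = E"
  "E \<in> Arr T \<Longrightarrow> \<one>\<^bsub>T\<^esub> [] \<boxplus>\<^bsub>T\<^esub> E = E"
  using T.Asum_Zero_right[of E] T.Asum_Zero_left[of E] by simp_all

locale tensor_quad = A: permutative A + B: permutative B + A': permutative A' + B': permutative B'
  for A :: "('oa, 'ma) pcat" and B :: "('ob, 'mb) pcat" and A' :: "('oa1, 'ma1) pcat" and B' :: "('ob1, 'mb1) pcat"
begin

sublocale L: perm3 A B "A' \<otimes> B'" 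
  by (intro perm3.intro A.permutative_axioms B.permutative_axioms perm_pair.permutative_T perm_pair.intro
    A'.permutative_axioms B'.permutative_axioms)
sublocale R: perm_pair A' B' ..
sublocale QG: perm_quad B' "A' \<otimes> B'" B "A' \<otimes> B'" ..
sublocale TF: perm_triple A A' "PermHom B' (A' \<otimes> B')" ..
sublocale TU: perm_triple A "PermHom B' (A' \<otimes> B')" "PermHom B (A' \<otimes> B')" ..

abbreviation "T' \<equiv> A' \<otimes> B'"

text \<open>\<open>F \<otimes> G\<close> is the strict functor classified by \<open>UFG F G\<close>, whose value at \<open>(a, b)\<close> is \<open>Fa.Gb\<close>; so the
  expression map \<^const>\<open>tensor_exp\<close> respects the imposed relations by the results on \<open>Ro\<close>.\<close>

definition UFG where
  "UFG F G = smf_comp A (PermHom B T') (PermHom1 B' T' B T' G (smf_id T')) (smf_comp A (PermHom B' T') R.U F)"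

context
  fixes F G assumes F [simp]: "sym_mon_functor A A' F" and G [simp]: "sym_mon_functor B B' G"
begin

lemma UFG_right [simp]: "L.is_right (UFG F G)"
  by (simp add: UFG_def)

context
  notes [simp del] = R.U_simps(2-4) and [simp] = R.U_parts R.pr_Ident
begin

lemma UFG_simps [simp]:
  "\<lbrakk>a \<in> Obj A; b \<in> Obj B\<rbrakk> \<Longrightarrow> fo (fo (UFG F G) a) b = [(fo F a, fo G b)]"
  "\<lbrakk>a \<in> Obj A; g \<in> Arr B\<rbrakk> \<Longrightarrow> fm (fo (UFG F G) a) g = R.pr (\<one>\<^bsub>A'\<^esub> (fo F a)) (fm G g)"
  "\<lbrakk>a \<in> Obj A; b \<in> Obj B; b' \<in> Obj B\<rbrakk> \<Longrightarrow> fc2 (fo (UFG F G) a) b b'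
    = R.pr (\<one>\<^bsub>A'\<^esub> (fo F a)) (fc2 G b b') \<cdot>\<^bsub>T'\<^esub> R.dL (fo F a) (fo G b) (fo G b')"
  "a \<in> Obj A \<Longrightarrow> fc0 (fo (UFG F G) a) = R.pr (\<one>\<^bsub>A'\<^esub> (fo F a)) (fc0 G) \<cdot>\<^bsub>T'\<^esub> R.zL (fo F a)"
  "\<lbrakk>f \<in> Arr A; b \<in> Obj B\<rbrakk> \<Longrightarrow> cmpt (fm (UFG F G) f) b = R.pr (fm F f) (\<one>\<^bsub>B'\<^esub> (fo G b))"
  "\<lbrakk>a \<in> Obj A; a' \<in> Obj A; b \<in> Obj B\<rbrakk> \<Longrightarrow> cmpt (fc2 (UFG F G) a a') b
    = R.pr (fc2 F a a') (\<one>\<^bsub>B'\<^esub> (fo G b)) \<cdot>\<^bsub>T'\<^esub> R.dR (fo G b) (fo F a) (fo F a')"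
  "b \<in> Obj B \<Longrightarrow> cmpt (fc0 (UFG F G)) b = R.pr (fc0 F) (\<one>\<^bsub>B'\<^esub> (fo G b)) \<cdot>\<^bsub>T'\<^esub> R.zR (fo G b)"
  by (simp_all add: UFG_def)

end

lemma sum_val_UFG: "X \<in> lists (Obj A \<times> Obj B) \<Longrightarrow> L.sum_val (UFG F G) X = map (map_prod (fo F) (fo G)) X"
  by (induction X) auto

lemma inv_pr: "\<lbrakk>iso A' f; iso B' g\<rbrakk> \<Longrightarrow> inv_arr T' (R.pr f g) = R.pr (inv_arr A' f) (inv_arr B' g)"
  and iso_pr: "\<lbrakk>iso A' f; iso B' g\<rbrakk> \<Longrightarrow> iso T' (R.pr f g)"
proof -
  assume i: "iso A' f" "iso B' g"
  then have [simp]: "f \<in> Arr A'" "g \<in> Arr B'" using A'.iso_Arr B'.iso_Arr by auto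
  from i have "inverse_arrows T' (R.pr f g) (R.pr (inv_arr A' f) (inv_arr B' g))"
    by (intro L.C.inverse_arrowsI) (simp_all add: R.pr_Cmp R.pr_Ident)
  then show "inv_arr T' (R.pr f g) = R.pr (inv_arr A' f) (inv_arr B' g)" "iso T' (R.pr f g)"
    by (rule L.C.inv_arr_eq L.C.isoI)+
qed

text \<open>Evaluation is used here with T' itself as the target. Well-formedness and the domains of
  the image are carried through the induction because computing composites and sums of classes
  depends on them.\<close>

lemma tensor_exp_val:
  assumes "wf_exp A B e"
  shows "wf_exp A' B' (tensor_exp A' B' F G e) \<and>
    edom A' B' (tensor_exp A' B' F G e) = map (map_prod (fo F) (fo G)) (edom A B e) \<and>
    ecod A' B' (tensor_exp A' B' F G e) = map (map_prod (fo F) (fo G)) (ecod A B e) \<and>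
    L.val (UFG F G) e = R.cls (tensor_exp A' B' F G e)"
  using assms
proof (induction e)
  case (EBase fs)
  then show ?case
  proof (induction fs)
    case Nil
    then show ?case by (simp add: R.EBase_Nil)
  next
    case (Cons p fs)
    then have p: "fst p \<in> Arr A" "snd p \<in> Arr B" by auto
    from p have "L.arr_val (UFG F G) p = R.pr (fm F (fst p)) (fm G (snd p))"
      by (cases p) (simp add: R.pr_Cmp)
    moreover have "set (map (map_prod (fm F) (fm G)) fs) \<subseteq> Arr A' \<times> Arr B'"
      using Cons by auto
    ultimately show ?case using Cons p by (cases p) (simp add: R.EBase_Cons del: L.arr_val.simps)
  qed
next
  case (EGen t)
  then show ?case by (cases t) (auto simp: R.T_to_cls R.Beta_T)
next
  case (EInv t)
  \<comment> \<open>Apart from \<open>Beta\<close>, the image of a generator is a composite, so its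
    inverse is the composite of inverses in the opposite order; this is the form of
    \<open>tensor_exp\<close> on formal inverses.\<close>
  have i: "inv_arr T' (R.cls (EGen t)) = R.cls (EInv t)" if "gen_ok A' B' t" for t
    using R.cls_EInv[OF that] by simp
  show ?case using EInv
    by (cases t) (auto simp: L.C.inv_arr_Cmp iso_pr inv_pr R.Cmp_cls i simp flip: R.Beta_T,
      (simp add: R.pr_def R.dL_def R.dR_def R.zL_def R.zR_def i R.Cmp_cls)+)
next
  case (ECmp e e')
  then show ?case by (simp add: R.Cmp_cls)
next
  case (ESum e e')
  then show ?case by (simp add: R.Asum_cls)
qed

lemma tensor1_eq_Ro: "tensor1 A B A' B' F G = L.Ro (UFG F G)"
proof (rule smf_eqI[where A = "A \<otimes> B"], goal_cases)
  case (4 E)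
  then obtain e where e: "wf_exp A B e" "E = L.AB.cls e" by (rule L.AB.Arr_T_cases)
  then have "wf_exp A B (trep E)" using L.AB.teq_wf[OF L.AB.trep_cls[OF e(1)]] by simp
  then show ?case using e(2) tensor_exp_val[of "trep E"] 4 by (simp add: tensor1_def L.Ro_def)
next
  case (5 X Y)
  then show ?case by (simp add: tensor1_def L.Ro_def sum_val_UFG)
next
  case 6
  show ?case by (simp add: tensor1_def L.Ro_def)
qed (simp_all add: tensor1_def L.Ro_def sum_val_UFG)

lemma tensor1_strict: "strict_sym_mon_functor (A \<otimes> B) T' (tensor1 A B A' B' F G)"
  by (simp add: tensor1_eq_Ro L.Ro_strict)

lemma tensor1_smf [simp]: "sym_mon_functor (A \<otimes> B) T' (tensor1 A B A' B' F G)"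
  by (simp add: tensor1_eq_Ro)

lemma tensor1_simps [simp]:
  "X \<in> lists (Obj A \<times> Obj B) \<Longrightarrow> fo (tensor1 A B A' B' F G) X = map (map_prod (fo F) (fo G)) X"
  "\<lbrakk>X \<in> lists (Obj A \<times> Obj B); Y \<in> lists (Obj A \<times> Obj B)\<rbrakk> \<Longrightarrow> fc2 (tensor1 A B A' B' F G) X Y
    = \<one>\<^bsub>T'\<^esub> (map (map_prod (fo F) (fo G)) X @ map (map_prod (fo F) (fo G)) Y)"
  "fc0 (tensor1 A B A' B' F G) = \<one>\<^bsub>T'\<^esub> []"
  by (simp_all add: tensor1_def)

lemma tensor1_arrs [simp]:
  "\<lbrakk>f \<in> Arr A; g \<in> Arr B\<rbrakk> \<Longrightarrow> fm (tensor1 A B A' B' F G) (L.AB.pr f g) = R.pr (fm F f) (fm G g)"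
  "\<lbrakk>a \<in> Obj A; b \<in> Obj B; b' \<in> Obj B\<rbrakk> \<Longrightarrow> fm (tensor1 A B A' B' F G) (L.AB.dL a b b')
    = R.pr (\<one>\<^bsub>A'\<^esub> (fo F a)) (fc2 G b b') \<cdot>\<^bsub>T'\<^esub> R.dL (fo F a) (fo G b) (fo G b')"
  "\<lbrakk>a \<in> Obj A; a' \<in> Obj A; b \<in> Obj B\<rbrakk> \<Longrightarrow> fm (tensor1 A B A' B' F G) (L.AB.dR b a a')
    = R.pr (fc2 F a a') (\<one>\<^bsub>B'\<^esub> (fo G b)) \<cdot>\<^bsub>T'\<^esub> R.dR (fo G b) (fo F a) (fo F a')"
  "a \<in> Obj A \<Longrightarrow> fm (tensor1 A B A' B' F G) (L.AB.zL a) = R.pr (\<one>\<^bsub>A'\<^esub> (fo F a)) (fc0 G) \<cdot>\<^bsub>T'\<^esub> R.zL (fo F a)"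
  "b \<in> Obj B \<Longrightarrow> fm (tensor1 A B A' B' F G) (L.AB.zR b) = R.pr (fc0 F) (\<one>\<^bsub>B'\<^esub> (fo G b)) \<cdot>\<^bsub>T'\<^esub> R.zR (fo G b)"
  unfolding tensor1_eq_Ro L.AB.pr_def L.AB.dL_def L.AB.dR_def L.AB.zL_def L.AB.zR_def
  by (simp_all add: pure_def R.pr_Cmp)

end

lemma tensor2_simps [simp]:
  "src (tensor2 A B A' B' \<phi> \<psi>) = tensor1 A B A' B' (src \<phi>) (src \<psi>)"
  "tgt (tensor2 A B A' B' \<phi> \<psi>) = tensor1 A B A' B' (tgt \<phi>) (tgt \<psi>)"
  by (simp_all add: tensor2_def)

lemma cmpt_tensor2_single:
  "\<lbrakk>a \<in> Obj A; b \<in> Obj B\<rbrakk> \<Longrightarrow> cmpt (tensor2 A B A' B' \<phi> \<psi>) [(a, b)] = R.pr (cmpt \<phi> a) (cmpt \<psi> b)"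
  by (simp add: tensor2_def R.pr_def pure_def)

text \<open>An instance of \<open>left_nat\<close> with T' as target. Each square for a constraint
  generator is cut in two: monoidality of \<phi> or \<psi> inside a single term, then naturality of
  the generator in T'.\<close>

lemma tensor2_mon_trans [simp]:
  assumes [simp]: "mon_trans A A' \<phi>" "mon_trans B B' \<psi>"
  shows "mon_trans (A \<otimes> B) T' (tensor2 A B A' B' \<phi> \<psi>)"
proof -
  define l where "l X = R.cls (EBase (map (map_prod (cmpt \<phi>) (cmpt \<psi>)) X))" for X
  have Nil: "l [] = \<one>\<^bsub>T'\<^esub> []" by (simp add: l_def R.EBase_Nil)
  have Cons: "l ((a, b) # X) = R.pr (cmpt \<phi> a) (cmpt \<psi> b) \<boxplus>\<^bsub>T'\<^esub> l X"
    if "a \<in> Obj A" "b \<in> Obj B" "X \<in> lists (Obj A \<times> Obj B)" for a b X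
  proof -
    have "set (map (map_prod (cmpt \<phi>) (cmpt \<psi>)) X) \<subseteq> Arr A' \<times> Arr B'" using that by auto
    then show ?thesis using that by (simp add: l_def R.EBase_Cons)
  qed
  have single: "l [(a, b)] = R.pr (cmpt \<phi> a) (cmpt \<psi> b)" if "a \<in> Obj A" "b \<in> Obj B" for a b
    by (simp add: l_def R.pr_def pure_def)
  have l: "l X \<in> Arr T' \<and> Dom T' (l X) = map (map_prod (fo (src \<phi>)) (fo (src \<psi>))) X
     \<and> Cod T' (l X) = map (map_prod (fo (tgt \<phi>)) (fo (tgt \<psi>))) X"
    if "X \<in> lists (Obj A \<times> Obj B)" for X
  proof -
    have "set X \<subseteq> Obj A \<times> Obj B" using that by auto
    then show ?thesis unfolding l_def by (subst R.cls_Arr R.Dom_cls R.Cod_cls; auto)+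
  qed
  have app: "l (X @ Y) = l X \<boxplus>\<^bsub>T'\<^esub> l Y" if "X \<in> lists (Obj A \<times> Obj B)" "Y \<in> lists (Obj A \<times> Obj B)" for X Y
    using that(1)
  proof (induction X)
    case Nil
    then show ?case using l[OF that(2)] \<open>l [] = \<one>\<^bsub>T'\<^esub> []\<close> L.C.Asum_Zero_left[of "l Y"] by simp
  next
    case (Cons p X)
    then have "fst p \<in> Obj A" "snd p \<in> Obj B" "X \<in> lists (Obj A \<times> Obj B)" by auto
    then show ?case
      using Cons.IH that(2) l[of X] l[of Y] \<open>\<And>a b X. \<lbrakk>a \<in> Obj A; b \<in> Obj B; X \<in> lists (Obj A \<times> Obj B)\<rbrakk> \<Longrightarrow> l ((a, b) # X) = R.pr (cmpt \<phi> a) (cmpt \<psi> b) \<boxplus>\<^bsub>T'\<^esub> l X\<close>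
      by (cases p) simp
  qed
  have two: "l [(a, b), (a', b')] = R.pr (cmpt \<phi> a) (cmpt \<psi> b) \<boxplus>\<^bsub>T'\<^esub> R.pr (cmpt \<phi> a') (cmpt \<psi> b')"
    if "a \<in> Obj A" "b \<in> Obj B" "a' \<in> Obj A" "b' \<in> Obj B" for a b a' b'
    using that app[of "[(a, b)]" "[(a', b')]"] by (simp add: single)
  have c: "cmpt (tensor2 A B A' B' \<phi> \<psi>) = restrict l (Obj (A \<otimes> B))"
    by (auto simp: tensor2_def l_def fun_eq_iff restrict_def)
  have AA: "perm_pair A A'" and BB: "perm_pair B B'" by unfold_locales
  have "mon_trans (A \<otimes> B) T' \<lparr>src = tensor1 A B A' B' (src \<phi>) (src \<psi>), tgt = tensor1 A B A' B' (tgt \<phi>) (tgt \<psi>),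
    cmpt = restrict l (Obj (A \<otimes> B))\<rparr>"
  proof (rule L.left_nat, goal_cases)
    case (6 X Y)
    then show ?case using l[of X] l[of Y] by (simp add: app)
  next
    case 7
    show ?case by (simp add: Nil)
  next
    case (8 f g)
    then show ?case
      using perm_pair.cmpt_nat[OF AA, of \<phi> f] perm_pair.cmpt_nat[OF BB, of \<psi> g] by (simp add: single R.pr_Cmp)
  next
    case (9 a b b')
    then have "R.pr (cmpt \<phi> a) (cmpt \<psi> (b \<oplus>\<^bsub>B\<^esub> b')) \<cdot>\<^bsub>T'\<^esub> R.pr (\<one>\<^bsub>A'\<^esub> (fo (src \<phi>) a)) (fc2 (src \<psi>) b b')
      = R.pr (\<one>\<^bsub>A'\<^esub> (fo (tgt \<phi>) a)) (fc2 (tgt \<psi>) b b') \<cdot>\<^bsub>T'\<^esub> R.pr (cmpt \<phi> a) (cmpt \<psi> b \<boxplus>\<^bsub>B'\<^esub> cmpt \<psi> b')"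
      using perm_pair.cmpt_sum[OF BB, of \<psi> b b'] by (simp add: R.pr_Cmp)
    from L.C.assoc_eq[OF this, of "R.dL (fo (src \<phi>) a) (fo (src \<psi>) b) (fo (src \<psi>) b')"] 9
    show ?case by (simp add: single two R.dL_nat)
  next
    case (10 b a a')
    then have "R.pr (cmpt \<phi> (a \<oplus>\<^bsub>A\<^esub> a')) (cmpt \<psi> b) \<cdot>\<^bsub>T'\<^esub> R.pr (fc2 (src \<phi>) a a') (\<one>\<^bsub>B'\<^esub> (fo (src \<psi>) b))
      = R.pr (fc2 (tgt \<phi>) a a') (\<one>\<^bsub>B'\<^esub> (fo (tgt \<psi>) b)) \<cdot>\<^bsub>T'\<^esub> R.pr (cmpt \<phi> a \<boxplus>\<^bsub>A'\<^esub> cmpt \<phi> a') (cmpt \<psi> b)"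
      using perm_pair.cmpt_sum[OF AA, of \<phi> a a'] by (simp add: R.pr_Cmp)
    from L.C.assoc_eq[OF this, of "R.dR (fo (src \<psi>) b) (fo (src \<phi>) a) (fo (src \<phi>) a')"] 10
    show ?case by (simp add: single two R.dR_nat)
  next
    case (11 a)
    then have "R.pr (cmpt \<phi> a) (cmpt \<psi> \<zero>\<^bsub>B\<^esub>) \<cdot>\<^bsub>T'\<^esub> R.pr (\<one>\<^bsub>A'\<^esub> (fo (src \<phi>) a)) (fc0 (src \<psi>))
      = R.pr (\<one>\<^bsub>A'\<^esub> (fo (tgt \<phi>) a)) (fc0 (tgt \<psi>)) \<cdot>\<^bsub>T'\<^esub> R.pr (cmpt \<phi> a) (\<one>\<^bsub>B'\<^esub> \<zero>\<^bsub>B'\<^esub>)"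
      using perm_pair.cmpt_zero[OF BB, of \<psi>] by (simp add: R.pr_Cmp)
    from L.C.assoc_eq[OF this, of "R.zL (fo (src \<phi>) a)"] 11 R.zL_nat[of "cmpt \<phi> a" "fo (tgt \<phi>) a"]
    show ?case by (simp add: single Nil)
  next
    case (12 b)
    then have "R.pr (cmpt \<phi> \<zero>\<^bsub>A\<^esub>) (cmpt \<psi> b) \<cdot>\<^bsub>T'\<^esub> R.pr (fc0 (src \<phi>)) (\<one>\<^bsub>B'\<^esub> (fo (src \<psi>) b))
      = R.pr (fc0 (tgt \<phi>)) (\<one>\<^bsub>B'\<^esub> (fo (tgt \<psi>) b)) \<cdot>\<^bsub>T'\<^esub> R.pr (\<one>\<^bsub>A'\<^esub> \<zero>\<^bsub>A'\<^esub>) (cmpt \<psi> b)"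
      using perm_pair.cmpt_zero[OF AA, of \<phi>] by (simp add: R.pr_Cmp)
    from L.C.assoc_eq[OF this, of "R.zR (fo (src \<psi>) b)"] 12 R.zR_nat[of "cmpt \<psi> b" "fo (tgt \<psi>) b"]
    show ?case by (simp add: single Nil)
  qed (simp_all add: l)
  then show ?thesis using c by (simp add: tensor2_def)
qed

end

section \<open>The adjoint equivalence\<close>

lemma is_functor_id_func: "category X \<Longrightarrow> is_functor X X id_func"
  by (rule is_functorI) (simp_all add: id_func_def category.Obj_Dom)

lemma is_functor_comp_func:
  assumes "is_functor X Y F" "is_functor Y Z G"
  shows "is_functor X Z (G \<circ>\<^sub>F F)"
proof -
  interpret F: is_functor X Y F by fact
  interpret G: is_functor Y Z G by fact
  show ?thesis
    by (rule is_functorI)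
      (simp_all add: comp_func_def F.X.category_axioms G.Y.category_axioms F.fo_in G.fo_in F.fm_Ident G.fm_Ident F.fm_comp G.fm_comp)
qed

context perm3
begin

abbreviation "BC \<equiv> PermHom B C"

text \<open>With \<open>W_faithful\<close>, this rule and the next three turn an equation in
  \<open>PermHom T C\<close> into one in the iterated hom category, where lifts of identities have
  become identities.\<close>

lemma Wm_id [simp]: "is_left P \<Longrightarrow> Wm (mt_id T C P) = mt_id A BC (Wo P)"
  by (rule right_mt_eqI) simp_all

lemma Wm_vcomp [simp]:
  "\<lbrakk>mon_trans T C \<phi>; mon_trans T C \<psi>; src \<psi> = tgt \<phi>\<rbrakk> \<Longrightarrow> Wm (mt_vcomp T C \<psi> \<phi>) = mt_vcomp A BC (Wm \<psi>) (Wm \<phi>)"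
  by (rule right_mt_eqI) simp_all

lemma Wm_Asum [simp]:
  "\<lbrakk>mon_trans T C \<phi>; mon_trans T C \<psi>\<rbrakk> \<Longrightarrow> Wm (\<phi> \<boxplus>\<^bsub>PermHom T C\<^esub> \<psi>) = Wm \<phi> \<boxplus>\<^bsub>PermHom A BC\<^esub> Wm \<psi>"
  by (rule right_mt_eqI) (simp_all add: Wo_plus)

lemma Wm_Sym [simp]:
  "\<lbrakk>is_left P; is_left P'\<rbrakk> \<Longrightarrow> Wm (\<beta>\<^bsub>PermHom T C\<^esub> P P') = \<beta>\<^bsub>PermHom A BC\<^esub> (Wo P) (Wo P')"
  by (rule right_mt_eqI) (simp_all add: Wo_plus)

text \<open>A definite description instead of \<open>glue\<close>: later arguments use only the
  property that characterises the lift.\<close>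

definition lift where
  "lift P P' \<theta> = (THE \<phi>. mon_trans T C \<phi> \<and> src \<phi> = P \<and> tgt \<phi> = P' \<and> Wm \<phi> = \<theta>)"

lemma lift_simps [simp]:
  assumes "is_left P" "is_left P'" "mon_trans A BC \<theta>" "src \<theta> = Wo P" "tgt \<theta> = Wo P'"
  shows "mon_trans T C (lift P P' \<theta>)" "src (lift P P' \<theta>) = P" "tgt (lift P P' \<theta>) = P'" "Wm (lift P P' \<theta>) = \<theta>"
proof -
  have "\<exists>!\<phi>. mon_trans T C \<phi> \<and> src \<phi> = P \<and> tgt \<phi> = P' \<and> Wm \<phi> = \<theta>"
    using W_full[OF assms] W_faithful by metis
  from theI'[OF this, folded lift_def]
  show "mon_trans T C (lift P P' \<theta>)" "src (lift P P' \<theta>) = P" "tgt (lift P P' \<theta>) = P'" "Wm (lift P P' \<theta>) = \<theta>"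
    by blast+
qed

text \<open>The lift of the identity in the opposite direction is the inverse, since both composites
  are sent to identities by \<open>W\<close>, which is faithful.\<close>

lemma iso_lift [simp]:
  assumes [simp]: "is_left P" "is_left P'" "Wo P = Wo P'" "\<theta> = mt_id A BC (Wo P')"
  shows "iso (PermHom T C) (lift P P' \<theta>)"
proof (rule BTC.BC.H.isoI)
  show "inverse_arrows (PermHom T C) (lift P P' \<theta>) (lift P' P \<theta>)"
    by (rule BTC.BC.H.inverse_arrowsI; (simp; fail)?; rule W_faithful) (auto intro!: right_mt_eqI)
qed

text \<open>This is \<open>W\<^sub>b\<close>. Its monoidal constraint is in general no identity: the
  sum of the strict functors \<open>Ro Q\<close> and \<open>Ro Q'\<close> has a shuffle in its
  constraint, whereas \<open>Ro\<close> of the sum is strict. Both have the same image under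
  \<open>Wo\<close>, so the lift is well typed.\<close>

definition R where
  "R = smf_restrict (PermHom A BC) \<lparr>fo = Ro, fm = \<lambda>\<theta>. lift (Ro (src \<theta>)) (Ro (tgt \<theta>)) \<theta>,
     fc2 = \<lambda>Q Q'. lift (smf_plus T C (Ro Q) (Ro Q')) (Ro (smf_plus A BC Q Q')) (mt_id A BC (smf_plus A BC Q Q')),
     fc0 = lift (smf_zero T C) (Ro (smf_zero A BC)) (mt_id A BC (smf_zero A BC))\<rparr>"

lemma R_simps [simp]:
  "is_right Q \<Longrightarrow> fo R Q = Ro Q" "mon_trans A BC \<theta> \<Longrightarrow> fm R \<theta> = lift (Ro (src \<theta>)) (Ro (tgt \<theta>)) \<theta>"
  "\<lbrakk>is_right Q; is_right Q'\<rbrakk> \<Longrightarrow> fc2 R Q Q'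
    = lift (smf_plus T C (Ro Q) (Ro Q')) (Ro (smf_plus A BC Q Q')) (mt_id A BC (smf_plus A BC Q Q'))"
  "fc0 R = lift (smf_zero T C) (Ro (smf_zero A BC)) (mt_id A BC (smf_zero A BC))"
  by (simp_all add: R_def)

declare Wo_Ro [simp] Wo_plus [simp] Wo_zero [simp]

sublocale HH: perm_pair "PermHom A (PermHom B C)" "PermHom (A \<otimes> B) C" ..

lemma R_smf: "sym_mon_functor (PermHom A BC) (PermHom T C) R"
proof -
  have "sym_mon_functor (PermHom A BC) (PermHom T C) (smf_restrict (PermHom A BC) R)"
  proof (rule HH.sym_mon_functorI, goal_cases)
    case (5 Q) then show ?case by (simp, intro W_faithful) simp_all
  next
    case (6 \<theta> \<theta>') then show ?case by (simp, intro W_faithful) simp_all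
  next
    case (10 \<theta> \<theta>') then show ?case by (simp, intro W_faithful) (simp_all, intro right_mt_eqI, simp_all)
  next
    case (14 Q Q' Q'') then show ?case by (simp, intro W_faithful) (simp_all, intro right_mt_eqI, simp_all)
  next
    case (15 Q) then show ?case by (simp, intro W_faithful) (simp_all, intro right_mt_eqI, simp_all)
  next
    case (16 Q Q') then show ?case by (simp, intro W_faithful) (simp_all, intro right_mt_eqI, simp_all)
  qed simp_all
  then show ?thesis by (simp add: R_def)
qed

text \<open>The unit compares P with the strict functor having the same image under
  \<open>Wo\<close>. Since \<open>W\<close> sends it to an identity and the counit is an identity,
  the triangle identities hold after applying \<open>W\<close>.\<close>

lemma W_R_adjoint_equivalence:
  "adjoint_equivalence (PermHom T C) (PermHom A BC) W R
    (\<lambda>P. lift P (Ro (Wo P)) (mt_id A BC (Wo P))) (mt_id A BC)"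
proof -
  have W: "is_functor (PermHom T C) (PermHom A BC) W"
    using W_strict by (simp add: strict_sym_mon_functor_def sym_mon_functor_def)
  have R: "is_functor (PermHom A BC) (PermHom T C) R"
    using R_smf by (simp add: sym_mon_functor_def)
  note f = is_functor_id_func is_functor_comp_func[OF W R] is_functor_comp_func[OF R W]
  show ?thesis
  proof (intro adjoint_equivalence.intro W R natural_iso.intro f natural_iso_axioms.intro
      adjoint_equivalence_axioms.intro BTC.BC.H.category_axioms AH.H.category_axioms, goal_cases)
    case (3 \<phi> P P')
    then show ?case
      by (simp add: Hom_def comp_func_def id_func_def) (intro W_faithful, auto intro!: right_mt_eqI)
  next
    case (6 \<theta> Q Q')
    then show ?case
      by (simp add: Hom_def comp_func_def id_func_def) (auto intro!: right_mt_eqI)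
  next
    case (7 P)
    then show ?case by (simp add: Hom_def comp_func_def id_func_def) (auto intro!: right_mt_eqI)
  next
    case (8 P)
    then show ?case
      by (simp add: Hom_def comp_func_def id_func_def) (intro W_faithful, auto intro!: right_mt_eqI)
  qed (simp_all add: Hom_def comp_func_def id_func_def)
qed

end

section \<open>Naturality\<close>

lemma (in perm_triple) strict_comp:
  assumes "strict_sym_mon_functor A B F" "strict_sym_mon_functor B C G"
  shows "strict_sym_mon_functor A C (smf_comp A C G F)"
proof -
  interpret F: strict_sym_mon_functor A B F by fact
  interpret G: strict_sym_mon_functor B C G by fact
  have [simp]: "sym_mon_functor A B F" "sym_mon_functor B C G" by unfold_locales
  have 1: "fo G (x \<oplus>\<^bsub>B\<^esub> y) = fo G x \<oplus> fo G y" if "x \<in> Obj B" "y \<in> Obj B" for x y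
    using BC.Cod_fc2[of G x y] that by (simp add: G.fc2_strict)
  have 2: "fo G \<zero>\<^bsub>B\<^esub> = \<zero>"
    using BC.Cod_fc0[of G] by (simp add: G.fc0_strict)
  show ?thesis
    unfolding strict_sym_mon_functor_def strict_sym_mon_functor_axioms_def
    by (simp add: F.fc2_strict G.fc2_strict F.fc0_strict G.fc0_strict 1 2)
qed

locale perm_six = A: permutative A + B: permutative B + C: permutative C
    + A': permutative A' + B': permutative B' + C': permutative C'
  for A :: "('oa, 'ma) pcat" and B :: "('ob, 'mb) pcat" and C :: "('oc, 'mc) pcat"
    and A' :: "('oa1, 'ma1) pcat" and B' :: "('ob1, 'mb1) pcat" and C' :: "('oc1, 'mc1) pcat"
begin

sublocale X: perm3 A B C ..
sublocale Y: perm3 A' B' C' ..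
sublocale TQ: tensor_quad A' B' A B ..
sublocale L: perm_quad "A \<otimes> B" C "A' \<otimes> B'" C' ..
sublocale H: perm_quad B C B' C' ..
sublocale R: perm_quad A "PermHom B C" A' "PermHom B' C'" ..

abbreviation "left1 F G K \<equiv> PermHom1 (A \<otimes> B) C (A' \<otimes> B') C' (tensor1 A' B' A B F G) K"
abbreviation "right1 F G K \<equiv> PermHom1 A (PermHom B C) A' (PermHom B' C') F (PermHom1 B C B' C' G K)"
abbreviation "left2 \<phi> \<psi> \<kappa> \<equiv> PermHom2 (A \<otimes> B) C (A' \<otimes> B') C' (tensor2 A' B' A B \<phi> \<psi>) \<kappa>"
abbreviation "right2 \<phi> \<psi> \<kappa> \<equiv> PermHom2 A (PermHom B C) A' (PermHom B' C') \<phi> (PermHom2 B C B' C' \<psi> \<kappa>)"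

lemma W_natural_obj:
  assumes [simp]: "sym_mon_functor A' A F" "sym_mon_functor B' B G" "sym_mon_functor C C' K" "X.is_left P"
  shows "fo (right1 F G K) (X.Wo P) = Y.Wo (fo (left1 F G K) P)"
  by (rule Y.right_eqI) simp_all

lemma W_natural_arr:
  assumes [simp]: "sym_mon_functor A' A F" "sym_mon_functor B' B G" "sym_mon_functor C C' K" "mon_trans (A \<otimes> B) C \<alpha>"
  shows "fm (right1 F G K) (X.Wm \<alpha>) = Y.Wm (fm (left1 F G K) \<alpha>)"
  using W_natural_obj[of F G K "src \<alpha>"] W_natural_obj[of F G K "tgt \<alpha>"]
  by (intro Y.right_mt_eqI) simp_all

text \<open>At (a, b) one side is built from horizontal composites, that is from arrows f.1 and 1.g,
  the other from the single term of \<phi> and \<psi>; \<open>pr_split\<close> identifies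
  them.\<close>

lemma W_natural_two:
  assumes [simp]: "mon_trans A' A \<phi>" "mon_trans B' B \<psi>" "mon_trans C C' \<kappa>" "X.is_left P"
  shows "cmpt (right2 \<phi> \<psi> \<kappa>) (X.Wo P) = Y.Wm (cmpt (left2 \<phi> \<psi> \<kappa>) P)"
  using W_natural_obj[of "src \<phi>" "src \<psi>" "src \<kappa>" P] W_natural_obj[of "tgt \<phi>" "tgt \<psi>" "tgt \<kappa>" P]
    X.AB.pr_split(2)[of "cmpt \<phi> a" "cmpt \<psi> b" for a b]
  by (intro Y.right_mt_eqI) (simp_all add: TQ.cmpt_tensor2_single)

text \<open>These typing rules, and the three groups that follow, replace the unfolding of
  \<open>PermHom1\<close> and \<open>PermHom2\<close> from here on: with \<open>left1\<close> and
  \<open>right1\<close> left folded, naturality of \<open>W\<close> can be used as a rewrite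
  rule.\<close>

lemma left1_simps:
  assumes "sym_mon_functor A' A F" "sym_mon_functor B' B G" "sym_mon_functor C C' K"
  shows "X.is_left P \<Longrightarrow> Y.is_left (fo (left1 F G K) P)"
    "mon_trans (A \<otimes> B) C \<alpha> \<Longrightarrow> mon_trans (A' \<otimes> B') C' (fm (left1 F G K) \<alpha>)"
    "mon_trans (A \<otimes> B) C \<alpha> \<Longrightarrow> src (fm (left1 F G K) \<alpha>) = fo (left1 F G K) (src \<alpha>)"
    "mon_trans (A \<otimes> B) C \<alpha> \<Longrightarrow> tgt (fm (left1 F G K) \<alpha>) = fo (left1 F G K) (tgt \<alpha>)"
  using assms by simp_all

lemma right1_simps:
  assumes "sym_mon_functor A' A F" "sym_mon_functor B' B G" "sym_mon_functor C C' K"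
  shows "X.is_right Q \<Longrightarrow> Y.is_right (fo (right1 F G K) Q)"
    "mon_trans A X.BC \<theta> \<Longrightarrow> mon_trans A' Y.BC (fm (right1 F G K) \<theta>)"
    "mon_trans A X.BC \<theta> \<Longrightarrow> src (fm (right1 F G K) \<theta>) = fo (right1 F G K) (src \<theta>)"
    "mon_trans A X.BC \<theta> \<Longrightarrow> tgt (fm (right1 F G K) \<theta>) = fo (right1 F G K) (tgt \<theta>)"
  using assms by simp_all

lemma left2_simps:
  assumes "mon_trans A' A \<phi>" "mon_trans B' B \<psi>" "mon_trans C C' \<kappa>" "X.is_left P"
  shows "mon_trans (A' \<otimes> B') C' (cmpt (left2 \<phi> \<psi> \<kappa>) P)"
    "src (cmpt (left2 \<phi> \<psi> \<kappa>) P) = fo (left1 (src \<phi>) (src \<psi>) (src \<kappa>)) P"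
    "tgt (cmpt (left2 \<phi> \<psi> \<kappa>) P) = fo (left1 (tgt \<phi>) (tgt \<psi>) (tgt \<kappa>)) P"
  using assms by simp_all

lemma right2_simps:
  assumes "mon_trans A' A \<phi>" "mon_trans B' B \<psi>" "mon_trans C C' \<kappa>" "X.is_right Q"
  shows "mon_trans A' Y.BC (cmpt (right2 \<phi> \<psi> \<kappa>) Q)"
    "src (cmpt (right2 \<phi> \<psi> \<kappa>) Q) = fo (right1 (src \<phi>) (src \<psi>) (src \<kappa>)) Q"
    "tgt (cmpt (right2 \<phi> \<psi> \<kappa>) Q) = fo (right1 (tgt \<phi>) (tgt \<psi>) (tgt \<kappa>)) Q"
  using assms by simp_all

lemma left1_functor:
  assumes "sym_mon_functor A' A F" "sym_mon_functor B' B G" "sym_mon_functor C C' K"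
  shows "is_functor (PermHom (A \<otimes> B) C) (PermHom (A' \<otimes> B') C') (left1 F G K)"
  using L.PermHom1_smf[OF TQ.tensor1_smf[OF assms(1,2)] assms(3)] by (simp add: sym_mon_functor_def)

lemma right1_functor:
  assumes "sym_mon_functor A' A F" "sym_mon_functor B' B G" "sym_mon_functor C C' K"
  shows "is_functor (PermHom A X.BC) (PermHom A' Y.BC) (right1 F G K)"
  using R.PermHom1_smf[OF assms(1) H.PermHom1_smf[OF assms(2,3)]] by (simp add: sym_mon_functor_def)

section \<open>The comparison 2-cell and naturality of the inverse functor\<close>

context
  notes [simp del] = PermHom1_simps PermHom2_simps
    and [simp] = left1_simps right1_simps left2_simps right2_simps
      W_natural_obj[symmetric] W_natural_arr[symmetric] W_natural_two[symmetric]
begin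

text \<open>The lift is well typed because naturality of \<open>W\<close> and \<open>Wo_Ro\<close>
  give both functors the same image under \<open>Wo\<close>.\<close>

definition omega where
  "omega F G K Q = Y.lift (fo (left1 F G K) (X.Ro Q)) (Y.Ro (fo (right1 F G K) Q))
     (mt_id A' (PermHom B' C') (fo (right1 F G K) Q))"

lemma omega_simps [simp]:
  assumes "sym_mon_functor A' A F" "sym_mon_functor B' B G" "sym_mon_functor C C' K" "X.is_right Q"
  shows "mon_trans (A' \<otimes> B') C' (omega F G K Q)" "src (omega F G K Q) = fo (left1 F G K) (X.Ro Q)"
    "tgt (omega F G K Q) = Y.Ro (fo (right1 F G K) Q)"
    "Y.Wm (omega F G K Q) = mt_id A' Y.BC (fo (right1 F G K) Q)"
  using assms by (simp_all add: omega_def)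

lemma omega_iso:
  assumes "sym_mon_functor A' A F" "sym_mon_functor B' B G" "sym_mon_functor C C' K" "X.is_right Q"
  shows "iso (PermHom (A' \<otimes> B') C') (omega F G K Q)"
  using assms by (simp add: omega_def)

lemma omega_natural:
  assumes [simp]: "sym_mon_functor A' A F" "sym_mon_functor B' B G" "sym_mon_functor C C' K" "mon_trans A X.BC \<theta>"
  shows "mt_vcomp (A' \<otimes> B') C' (omega F G K (tgt \<theta>)) (fm (left1 F G K) (fm X.R \<theta>))
    = mt_vcomp (A' \<otimes> B') C' (fm Y.R (fm (right1 F G K) \<theta>)) (omega F G K (src \<theta>))"
  by (rule Y.W_faithful) (simp_all, intro Y.right_mt_eqI, simp_all)

lemma omega_natural_two:
  assumes [simp]: "mon_trans A' A \<phi>" "mon_trans B' B \<psi>" "mon_trans C C' \<kappa>" "X.is_right Q"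
  shows "mt_vcomp (A' \<otimes> B') C' (omega (tgt \<phi>) (tgt \<psi>) (tgt \<kappa>) Q) (cmpt (left2 \<phi> \<psi> \<kappa>) (X.Ro Q))
    = mt_vcomp (A' \<otimes> B') C' (fm Y.R (cmpt (right2 \<phi> \<psi> \<kappa>) Q)) (omega (src \<phi>) (src \<psi>) (src \<kappa>) Q)"
  by (rule Y.W_faithful) (simp_all, intro Y.right_mt_eqI, simp_all)

text \<open>Strictness of K makes the composite of the tensor product of F and G,
  \<open>Ro Q\<close> and K strict, so that \<open>strict_eqI\<close> applies.\<close>

lemma R_natural_obj:
  assumes F: "sym_mon_functor A' A F" "sym_mon_functor B' B G" and K: "strict_sym_mon_functor C C' K" and Q: "X.is_right Q"
  shows "fo (left1 F G K) (X.Ro Q) = Y.Ro (fo (right1 F G K) Q)"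
proof (rule Y.strict_eqI)
  have K': "sym_mon_functor C C' K" using K by (simp add: strict_sym_mon_functor_def)
  show "strict_sym_mon_functor (A' \<otimes> B') C' (fo (left1 F G K) (X.Ro Q))"
    using L.T2.strict_comp[OF L.T1.strict_comp[OF TQ.tensor1_strict[OF F] X.Ro_strict[OF Q]] K] X.Ro_left[OF Q]
    by (simp add: PermHom1_simps)
  show "strict_sym_mon_functor (A' \<otimes> B') C' (Y.Ro (fo (right1 F G K) Q))"
    using F K' Q by (simp add: Y.Ro_strict)
  show "Y.Wo (fo (left1 F G K) (X.Ro Q)) = Y.Wo (Y.Ro (fo (right1 F G K) Q))"
    using F K' Q by simp
qed

lemma omega_strict:
  assumes F: "sym_mon_functor A' A F" "sym_mon_functor B' B G" and K: "strict_sym_mon_functor C C' K" and Q: "X.is_right Q"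
  shows "omega F G K Q = mt_id (A' \<otimes> B') C' (Y.Ro (fo (right1 F G K) Q))"
proof -
  have K': "sym_mon_functor C C' K" using K by (simp add: strict_sym_mon_functor_def)
  note [simp] = F K' Q
  show ?thesis by (rule Y.W_faithful) (simp_all add: R_natural_obj[OF F K Q])
qed

lemma R_natural_arr:
  assumes F: "sym_mon_functor A' A F" "sym_mon_functor B' B G" and K: "strict_sym_mon_functor C C' K"
    and [simp]: "mon_trans A X.BC \<theta>"
  shows "fm (left1 F G K) (fm X.R \<theta>) = fm Y.R (fm (right1 F G K) \<theta>)"
proof -
  have K': "sym_mon_functor C C' K" using K by (simp add: strict_sym_mon_functor_def)
  note [simp] = F K'
  show ?thesis by (rule Y.W_faithful) (simp_all add: R_natural_obj[OF F K])
qed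

lemma R_natural_two:
  assumes [simp]: "mon_trans A' A \<phi>" "mon_trans B' B \<psi>" "mon_trans C C' \<kappa>" "X.is_right Q"
    and K: "strict_sym_mon_functor C C' (src \<kappa>)" "strict_sym_mon_functor C C' (tgt \<kappa>)"
  shows "cmpt (left2 \<phi> \<psi> \<kappa>) (X.Ro Q) = fm Y.R (cmpt (right2 \<phi> \<psi> \<kappa>) Q)"
  by (rule Y.W_faithful) (simp_all add: R_natural_obj[OF _ _ K(1)] R_natural_obj[OF _ _ K(2)])

end

end

text \<open>Both sides are strict, so \<open>strict_eqI\<close> reduces the equality to values at
  generators and avoids evaluating expressions.\<close>

lemma tensor1_comp:
  assumes "permutative A" "permutative B" "permutative A'" "permutative B'" "permutative A''" "permutative B''"
    and F: "sym_mon_functor A A' F" "sym_mon_functor A' A'' F'" "sym_mon_functor B B' G" "sym_mon_functor B' B'' G'"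
  shows "tensor1 A B A'' B'' (smf_comp A A'' F' F) (smf_comp B B'' G' G)
    = smf_comp (A \<otimes> B) (A'' \<otimes> B'') (tensor1 A' B' A'' B'' F' G') (tensor1 A B A' B' F G)"
proof -
  interpret Q1: tensor_quad A B A' B' using assms by (simp add: tensor_quad_def)
  interpret Q2: tensor_quad A' B' A'' B'' using assms by (simp add: tensor_quad_def)
  interpret Q3: tensor_quad A B A'' B'' using assms by (simp add: tensor_quad_def)
  interpret TA: perm_triple A A' A'' using assms by (simp add: perm_triple_def)
  interpret TB: perm_triple B B' B'' using assms by (simp add: perm_triple_def)
  interpret TT: perm_triple "A \<otimes> B" "A' \<otimes> B'" "A'' \<otimes> B''" ..
  note [simp] = F
  show ?thesis
  proof (rule Q3.L.strict_eqI)
    show "strict_sym_mon_functor (A \<otimes> B) (A'' \<otimes> B'') (tensor1 A B A'' B'' (smf_comp A A'' F' F) (smf_comp B B'' G' G))"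
      by (rule Q3.tensor1_strict) simp_all
    show "strict_sym_mon_functor (A \<otimes> B) (A'' \<otimes> B'') (smf_comp (A \<otimes> B) (A'' \<otimes> B'') (tensor1 A' B' A'' B'' F' G') (tensor1 A B A' B' F G))"
      by (rule TT.strict_comp) (simp_all add: Q1.tensor1_strict Q2.tensor1_strict)
    show "Q3.L.Wo (tensor1 A B A'' B'' (smf_comp A A'' F' F) (smf_comp B B'' G' G))
      = Q3.L.Wo (smf_comp (A \<otimes> B) (A'' \<otimes> B'') (tensor1 A' B' A'' B'' F' G') (tensor1 A B A' B' F G))"
      by (rule Q3.L.right_eqI) (simp_all add: Q2.R.pr_Cmp Q2.R.pr_Ident Q2.L.C.assoc_eq1[OF Q2.R.pr_Cmp])
  qed
qed

text \<open>Identity functors are strict, so this is a case of \<open>omega_strict\<close>.\<close>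

lemma omega_id:
  assumes "permutative A" "permutative B" "permutative C" and Q: "sym_mon_functor A (PermHom B C) Q"
  shows "perm_six.omega A B C A B C (smf_id A) (smf_id B) (smf_id C) Q = mt_id (A \<otimes> B) C (perm3.Ro A B C Q)"
proof -
  have p: "perm_six A B C A B C" using assms by (simp add: perm_six_def)
  interpret perm3 A B C using assms by (simp add: perm3_def)
  have s: "strict_sym_mon_functor C C (smf_id C)"
    unfolding strict_sym_mon_functor_def strict_sym_mon_functor_axioms_def by simp
  show ?thesis
    using perm_six.omega_strict[OF p _ _ s Q, of "smf_id A" "smf_id B"] Q
    by (simp add: BTC.AC.PermHom1_id AH.PermHom1_id)
qed

text \<open>Both sides have the same source and target once the hom constructions are known to
  preserve composites, and \<open>W\<close> sends both to an identity; faithfulness does the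
  rest.\<close>

lemma omega_comp:
  fixes A :: "('oa, 'ma) pcat" and B :: "('ob, 'mb) pcat" and C :: "('oc, 'mc) pcat"
    and A' :: "('oa1, 'ma1) pcat" and B' :: "('ob1, 'mb1) pcat" and C' :: "('oc1, 'mc1) pcat"
    and A'' :: "('oa2, 'ma2) pcat" and B'' :: "('ob2, 'mb2) pcat" and C'' :: "('oc2, 'mc2) pcat"
  assumes perm: "permutative A" "permutative B" "permutative C" "permutative A'" "permutative B'" "permutative C'"
      "permutative A''" "permutative B''" "permutative C''"
    and F: "sym_mon_functor A' A F" "sym_mon_functor B' B G" "sym_mon_functor C C' K"
      "sym_mon_functor A'' A' F'" "sym_mon_functor B'' B' G'" "sym_mon_functor C' C'' K'"
    and Q: "sym_mon_functor A (PermHom B C) Q"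
  defines "r \<equiv> PermHom1 A (PermHom B C) A' (PermHom B' C') F (PermHom1 B C B' C' G K)"
    and "l' \<equiv> PermHom1 (A' \<otimes> B') C' (A'' \<otimes> B'') C'' (tensor1 A'' B'' A' B' F' G') K'"
  shows "perm_six.omega A B C A'' B'' C'' (smf_comp A'' A F F') (smf_comp B'' B G G') (smf_comp C C'' K' K) Q
    = mt_vcomp (A'' \<otimes> B'') C'' (perm_six.omega A' B' C' A'' B'' C'' F' G' K' (fo r Q))
        (fm l' (perm_six.omega A B C A' B' C' F G K Q))"
proof -
  have p1: "perm_six A B C A' B' C'" and p2: "perm_six A' B' C' A'' B'' C''" and p3: "perm_six A B C A'' B'' C''"
    using perm by (simp_all add: perm_six_def)
  have q1: "perm3 A B C" and q2: "perm3 A' B' C'" and q3: "perm3 A'' B'' C''"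
    using perm by (simp_all add: perm3_def)
  have T: "permutative (A \<otimes> B)" "permutative (A' \<otimes> B')" "permutative (A'' \<otimes> B'')"
    "permutative (PermHom B C)" "permutative (PermHom B' C')" "permutative (PermHom B'' C'')"
    using perm by (simp_all add: perm_pair.permutative_T perm_pair.permutative_PermHom perm_pair_def)
  interpret Z: perm3 A'' B'' C'' by (rule q3)
  \<comment> \<open>Naming the composites keeps them folded, so that the typing rules of
    \<open>omega\<close> apply to them as to any triple; they are unfolded only in \<open>lc\<close>
    and \<open>rc\<close>.\<close>
  define F'' G'' K'' where "F'' = smf_comp A'' A F F'" "G'' = smf_comp B'' B G G'" "K'' = smf_comp C C'' K' K"
  have F'': "sym_mon_functor A'' A F''" "sym_mon_functor B'' B G''" "sym_mon_functor C C'' K''"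
    unfolding F''_G''_K''_def using F perm by (auto intro!: perm_triple.smf_comp_smf simp: perm_triple_def)
  define l where "l = PermHom1 (A \<otimes> B) C (A' \<otimes> B') C' (tensor1 A' B' A B F G) K"
  define r' where "r' = PermHom1 A' (PermHom B' C') A'' (PermHom B'' C'') F' (PermHom1 B' C' B'' C'' G' K')"
  have r: "sym_mon_functor (PermHom A (PermHom B C)) (PermHom A' (PermHom B' C')) r"
    and l: "sym_mon_functor (PermHom (A \<otimes> B) C) (PermHom (A' \<otimes> B') C') l"
    unfolding r_def l_def using F perm T
    by (auto intro!: perm_quad.PermHom1_smf tensor_quad.tensor1_smf simp: perm_quad_def tensor_quad_def)
  have P: "sym_mon_functor (A \<otimes> B) C (perm3.Ro A B C Q)" using perm3.Ro_left[OF q1 Q] .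
  have Q': "sym_mon_functor A' (PermHom B' C') (fo r Q)"
    using perm_six.right1_simps(1)[OF p1 F(1-3) Q] by (simp add: r_def)
  note o = perm_six.omega_simps[OF p1 F(1-3) Q, folded l_def r_def]
  note o' = perm_six.omega_simps[OF p2 F(4-6) Q', folded l'_def r'_def]
  note o'' = perm_six.omega_simps[OF p3 F'' Q]
  have lc: "PermHom1 (A \<otimes> B) C (A'' \<otimes> B'') C'' (tensor1 A'' B'' A B F'' G'') K''
      = smf_comp (PermHom (A \<otimes> B) C) (PermHom (A'' \<otimes> B'') C'') l' l"
    unfolding l_def l'_def F''_G''_K''_def
    using F perm T tensor_quad.tensor1_smf[of A'' B'' A' B' F' G'] tensor_quad.tensor1_smf[of A' B' A B F G]
    by (subst tensor1_comp[of A'' B'' A' B' A B], simp_all, subst PermHom1_comp[of _ "A' \<otimes> B'" _ _ C'])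
      (simp_all add: tensor_quad_def)
  have rc: "PermHom1 A (PermHom B C) A'' (PermHom B'' C'') F'' (PermHom1 B C B'' C'' G'' K'')
      = smf_comp (PermHom A (PermHom B C)) (PermHom A'' (PermHom B'' C'')) r' r"
    unfolding r_def r'_def F''_G''_K''_def
    using F perm T perm_quad.PermHom1_smf[of B C B' C' G K] perm_quad.PermHom1_smf[of B' C' B'' C'' G' K']
    by (subst PermHom1_comp[of B B' _ C C'], simp_all, subst PermHom1_comp[of A A' _ _ "PermHom B' C'"])
      (simp_all add: perm_quad_def)
  note s = perm_six.left1_simps[OF p2 F(4-6), folded l'_def]
  \<comment> \<open>Naturality of \<open>W\<close> on arrows moves \<open>Wm\<close> past
    \<open>l'\<close>, and the functor \<open>r'\<close> preserves the identity to which
    \<open>omega\<close> is sent.\<close>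
  have w: "Z.Wm (fm l' (perm_six.omega A B C A' B' C' F G K Q)) = mt_id A'' (PermHom B'' C'') (fo r' (fo r Q))"
  proof -
    have r': "is_functor (PermHom A' (PermHom B' C')) (PermHom A'' (PermHom B'' C'')) r'"
      using perm_six.right1_functor[OF p2 F(4-6)] by (simp add: r'_def)
    show ?thesis
      using perm_six.W_natural_arr[OF p2 F(4-6) o(1), folded l'_def r'_def] is_functor.fm_Ident[OF r', of "fo r Q"] Q'
      by (simp add: o)
  qed
  have Q'': "sym_mon_functor A'' (PermHom B'' C'') (fo r' (fo r Q))"
    using perm_six.right1_simps(1)[OF p2 F(4-6) Q'] by (simp add: r'_def)
  show ?thesis
    unfolding F''_G''_K''_def[symmetric]
    by (rule Z.W_faithful)
      (use P Q Q' Q'' in \<open>simp_all add: o o' o'' s w lc rc\<close>, auto intro!: Z.right_mt_eqI)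
qed

section \<open>Assembly into transformations of 2-functors of three variables\<close>

lemma cat_truncate_simps [simp]:
  "Obj (cat.truncate X) = Obj X" "Arr (cat.truncate X) = Arr X" "Dom (cat.truncate X) = Dom X"
  "Cod (cat.truncate X) = Cod X" "Ident (cat.truncate X) = Ident X" "Cmp (cat.truncate X) = Cmp X"
  by (simp_all add: cat.truncate_def)

lemma func_truncate_simps [simp]: "fo (func.truncate F) = fo F" "fm (func.truncate F) = fm F"
  by (simp_all add: func.truncate_def)

lemma Hom_truncate [simp]: "Hom (cat.truncate X) = Hom X"
  by (simp add: Hom_def fun_eq_iff)

lemma iso_truncate [simp]: "iso (cat.truncate X) = iso X"
  by (simp add: iso_def inverse_arrows_def fun_eq_iff)

lemma category_truncate: "category X \<Longrightarrow> category (cat.truncate X)"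
  by (simp add: category_def)

lemma is_functor_truncate:
  "is_functor X Y F \<Longrightarrow> is_functor (cat.truncate X) (cat.truncate Y) (func.truncate F)"
  by (simp add: is_functor_def is_functor_axioms_def category_truncate)

abbreviation "triples \<equiv> op2 PermCat \<times>\<^sub>2 op2 PermCat \<times>\<^sub>2 PermCat"
abbreviation "strict_triples \<equiv> op2 PermCat \<times>\<^sub>2 op2 PermCat \<times>\<^sub>2 StrictPermCat"

lemma triples_simps:
  "(A, B, C) \<in> Cell0 triples \<longleftrightarrow> permutative A \<and> permutative B \<and> permutative C"
  "(F, G, K) \<in> Obj (HomCat triples (A, B, C) (A', B', C')) \<longleftrightarrow>
    sym_mon_functor A' A F \<and> sym_mon_functor B' B G \<and> sym_mon_functor C C' K"
  "(\<phi>, \<psi>, \<kappa>) \<in> Arr (HomCat triples (A, B, C) (A', B', C')) \<longleftrightarrow>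
    mon_trans A' A \<phi> \<and> mon_trans B' B \<psi> \<and> mon_trans C C' \<kappa>"
  "Dom (HomCat triples (A, B, C) (A', B', C')) (\<phi>, \<psi>, \<kappa>) = (src \<phi>, src \<psi>, src \<kappa>)"
  "Cod (HomCat triples (A, B, C) (A', B', C')) (\<phi>, \<psi>, \<kappa>) = (tgt \<phi>, tgt \<psi>, tgt \<kappa>)"
  "One1 triples (A, B, C) = (smf_id A, smf_id B, smf_id C)"
  "Cmp1 triples (A, B, C) (A', B', C') (A'', B'', C'') (F', G', K') (F, G, K)
    = (smf_comp A'' A F F', smf_comp B'' B G G', smf_comp C C'' K' K)"
  by (simp_all add: prod2_def op2_def PermCat_def prod_cat_def)

lemma strict_triples_simps:
  "(F, G, K) \<in> Obj (HomCat strict_triples (A, B, C) (A', B', C')) \<longleftrightarrow>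
    sym_mon_functor A' A F \<and> sym_mon_functor B' B G \<and> strict_sym_mon_functor C C' K"
  "(\<phi>, \<psi>, \<kappa>) \<in> Arr (HomCat strict_triples (A, B, C) (A', B', C')) \<longleftrightarrow>
    mon_trans A' A \<phi> \<and> mon_trans B' B \<psi> \<and> mon_trans C C' \<kappa>
      \<and> strict_sym_mon_functor C C' (src \<kappa>) \<and> strict_sym_mon_functor C C' (tgt \<kappa>)"
  by (simp_all add: prod2_def op2_def PermCat_def StrictPermCat_def prod_cat_def)

lemma two_functor_simps:
  "on0 PermCat_tensor (A, B, C) = cat.truncate (PermHom (A \<otimes> B) C)"
  "on1 PermCat_tensor (A, B, C) (A', B', C') (F, G, K)
    = func.truncate (PermHom1 (A \<otimes> B) C (A' \<otimes> B') C' (tensor1 A' B' A B F G) K)"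
  "on2 PermCat_tensor (A, B, C) (A', B', C') (\<phi>, \<psi>, \<kappa>)
    = cmpt (PermHom2 (A \<otimes> B) C (A' \<otimes> B') C' (tensor2 A' B' A B \<phi> \<psi>) \<kappa>)"
  "on0 PermCat_iterated (A, B, C) = cat.truncate (PermHom A (PermHom B C))"
  "on1 PermCat_iterated (A, B, C) (A', B', C') (F, G, K)
    = func.truncate (PermHom1 A (PermHom B C) A' (PermHom B' C') F (PermHom1 B C B' C' G K))"
  "on2 PermCat_iterated (A, B, C) (A', B', C') (\<phi>, \<psi>, \<kappa>)
    = cmpt (PermHom2 A (PermHom B C) A' (PermHom B' C') \<phi> (PermHom2 B C B' C' \<psi> \<kappa>))"
  by (simp_all add: PermCat_tensor_def PermCat_iterated_def)

text \<open>The locale constants take the three categories as separate arguments, while the theorem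
  asks for functions of a triple.\<close>

definition curry_smf where "curry_smf = (\<lambda>(A, B, C). perm3.W A B C)"
definition uncurry_smf where "uncurry_smf = (\<lambda>(A, B, C). perm3.R A B C)"
definition uncurry_constraint where "uncurry_constraint = (\<lambda>(A, B, C) (A', B', C') (F, G, K). perm_six.omega A B C A' B' C' F G K)"

lemma curry_smf_simps: "curry_smf (A, B, C) = perm3.W A B C" "uncurry_smf (A, B, C) = perm3.R A B C"
  "uncurry_constraint (A, B, C) (A', B', C') (F, G, K) = perm_six.omega A B C A' B' C' F G K"
  by (simp_all add: curry_smf_def uncurry_smf_def uncurry_constraint_def)

lemma W_functor: "perm3 A B C \<Longrightarrow> is_functor (PermHom (A \<otimes> B) C) (PermHom A (PermHom B C)) (perm3.W A B C)"
  and R_functor: "perm3 A B C \<Longrightarrow> is_functor (PermHom A (PermHom B C)) (PermHom (A \<otimes> B) C) (perm3.R A B C)"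
  using perm3.W_strict[of A B C] perm3.R_smf[of A B C]
  by (simp_all add: strict_sym_mon_functor_def sym_mon_functor_def)

lemma triples_perm:
  assumes "(A, B, C) \<in> Cell0 triples" "(A', B', C') \<in> Cell0 triples"
  shows "perm_six A B C A' B' C'" "perm3 A B C" "perm3 A' B' C'"
  using assms by (simp_all add: triples_simps perm_six_def perm3_def)

lemma Cell0_strict_triples: "Cell0 strict_triples = Cell0 triples"
  by (simp add: prod2_def StrictPermCat_def)

lemma two_natural_W: "two_natural triples PermCat_tensor PermCat_iterated (\<lambda>x. underlying_func (curry_smf x))"
proof (rule two_natural.intro, unfold split_paired_all, goal_cases)
  case (1 A B C)
  then show ?case
    by (auto simp: triples_simps two_functor_simps curry_smf_simps perm3_def intro!: is_functor_truncate W_functor)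
next
  case (2 A B C A' B' C' F G K P)
  note p = triples_perm[OF 2(1,2)]
  from 2 show ?case
    using perm_six.W_natural_obj[OF p(1), of F G K P] perm_six.left1_simps[OF p(1), of F G K]
    by (simp add: triples_simps two_functor_simps curry_smf_simps perm3.W_simps[OF p(2)] perm3.W_simps[OF p(3)] del: PermHom1_simps)
next
  case (3 A B C A' B' C' F G K \<alpha>)
  note p = triples_perm[OF 3(1,2)]
  from 3 show ?case
    using perm_six.W_natural_arr[OF p(1), of F G K \<alpha>] perm_six.left1_simps[OF p(1), of F G K]
    by (simp add: triples_simps two_functor_simps curry_smf_simps perm3.W_simps[OF p(2)] perm3.W_simps[OF p(3)] del: PermHom1_simps)
next
  case (4 A B C A' B' C' \<phi> \<psi> \<kappa> P)
  note p = triples_perm[OF 4(1,2)]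
  from 4 show ?case
    using perm_six.W_natural_two[OF p(1), of \<phi> \<psi> \<kappa> P] perm_six.left2_simps[OF p(1), of \<phi> \<psi> \<kappa> P]
    by (simp add: triples_simps two_functor_simps curry_smf_simps perm3.W_simps[OF p(2)] perm3.W_simps[OF p(3)] del: PermHom2_simps)
qed

lemma two_natural_R: "two_natural strict_triples PermCat_iterated PermCat_tensor (\<lambda>x. underlying_func (uncurry_smf x))"
proof (rule two_natural.intro, unfold split_paired_all Cell0_strict_triples, goal_cases)
  case (1 A B C)
  then show ?case
    by (auto simp: triples_simps two_functor_simps curry_smf_simps perm3_def intro!: is_functor_truncate R_functor)
next
  case (2 A B C A' B' C' F G K Q)
  note p = triples_perm[OF 2(1,2)]
  from 2 have K: "sym_mon_functor C C' K" by (simp add: strict_triples_simps strict_sym_mon_functor_def)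
  from 2 show ?case
    using perm_six.R_natural_obj[OF p(1), of F G K Q] perm_six.right1_simps[OF p(1) _ _ K, of F G]
    by (simp add: strict_triples_simps two_functor_simps curry_smf_simps perm3.R_simps[OF p(2)] perm3.R_simps[OF p(3)] del: PermHom1_simps)
next
  case (3 A B C A' B' C' F G K \<theta>)
  note p = triples_perm[OF 3(1,2)]
  from 3 show ?case
    using perm_six.R_natural_arr[OF p(1), of F G K \<theta>]
    by (simp add: strict_triples_simps two_functor_simps curry_smf_simps del: PermHom1_simps)
next
  case (4 A B C A' B' C' \<phi> \<psi> \<kappa> Q)
  note p = triples_perm[OF 4(1,2)]
  from 4 show ?case
    using perm_six.R_natural_two[OF p(1), of \<phi> \<psi> \<kappa> Q]
    by (simp add: strict_triples_simps two_functor_simps curry_smf_simps perm3.R_simps(1)[OF p(2)] del: PermHom2_simps)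
qed

lemma pseudonatural_R:
  "pseudonatural triples PermCat_iterated PermCat_tensor (\<lambda>x. underlying_func (uncurry_smf x)) uncurry_constraint"
proof (rule pseudonatural.intro, unfold split_paired_all, goal_cases)
  case (1 A B C)
  then show ?case
    by (auto simp: triples_simps two_functor_simps curry_smf_simps perm3_def intro!: is_functor_truncate R_functor)
next
  case (2 A B C A' B' C' F G K)
  note p = triples_perm[OF 2(1,2)]
  from 2(3) have F: "sym_mon_functor A' A F" "sym_mon_functor B' B G" "sym_mon_functor C C' K"
    by (simp_all add: triples_simps)
  note R = is_functor_truncate[OF R_functor[OF p(2)]] is_functor_truncate[OF R_functor[OF p(3)]]
    is_functor_truncate[OF perm_six.left1_functor[OF p(1) F]] is_functor_truncate[OF perm_six.right1_functor[OF p(1) F]]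
  show ?case
    unfolding two_functor_simps curry_smf_simps
  proof (rule natural_iso.intro[OF is_functor_comp_func[OF R(1,3)] is_functor_comp_func[OF R(4,2)]], unfold_locales, goal_cases)
    case (1 Q)
    then show ?case
      using perm_six.omega_simps[OF p(1) F, of Q] perm_six.right1_simps(1)[OF p(1) F, of Q]
      by (simp add: Hom_def comp_func_def perm3.R_simps(1)[OF p(2)] perm3.R_simps(1)[OF p(3)] del: PermHom1_simps)
  next
    case (2 Q)
    then show ?case using perm_six.omega_iso[OF p(1) F, of Q] by simp
  next
    case (3 \<theta> Q Q')
    then show ?case using perm_six.omega_natural[OF p(1) F, of \<theta>]
      by (simp add: Hom_def comp_func_def del: PermHom1_simps)
  qed
next
  case (3 A B C A' B' C' \<phi> \<psi> \<kappa> F G K F' G' K' Q)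
  note p = triples_perm[OF 3(1,2)]
  \<comment> \<open>A 2-cell records its source and target, so the 1-cells are expressed through
    them before the 2-cell law is applied.\<close>
  from 3(3) have "(F, G, K) = (src \<phi>, src \<psi>, src \<kappa>)" "(F', G', K') = (tgt \<phi>, tgt \<psi>, tgt \<kappa>)"
    by (auto simp: triples_simps Hom_def)
  with 3 show ?case
    using perm_six.omega_natural_two[OF p(1), of \<phi> \<psi> \<kappa> Q]
    by (simp add: triples_simps two_functor_simps curry_smf_simps perm3.R_simps(1)[OF p(2)] Hom_def del: PermHom2_simps)
next
  case (4 A B C Q)
  \<comment> \<open>\<open>triples_perm\<close> concerns two triples; the same one is supplied
    twice.\<close>
  note p = triples_perm(2)[OF 4(1,1)]
  from 4 show ?case
    by (simp add: triples_simps two_functor_simps curry_smf_simps omega_id perm3.R_simps(1)[OF p])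
next
  case (5 A B C A' B' C' A'' B'' C'' F G K F' G' K' Q)
  then show ?case
    unfolding triples_simps two_functor_simps curry_smf_simps func_truncate_simps cat_truncate_simps PermHom_simps
    by (intro omega_comp) simp_all
qed

theorem theorem6p12:
  shows "\<exists>(W :: ('oa, 'ma, 'ob, 'mb, 'oc, 'mc) triple0 \<Rightarrow>
              (('oa, 'ma, 'ob, 'mb, 'oc, 'mc) left_obj, ('oa, 'ma, 'ob, 'mb, 'oc, 'mc) left_arr,
               ('oa, 'ma, 'ob, 'mb, 'oc, 'mc) right_obj, ('oa, 'ma, 'ob, 'mb, 'oc, 'mc) right_arr) smf)
           W\<^sub>b \<eta> \<epsilon> \<omega>.
    (\<forall>A B C. permutative A \<and> permutative B \<and> permutative C \<longrightarrow>
       adjoint_equivalence (PermHom (A \<otimes> B) C) (PermHom A (PermHom B C))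
         (W (A, B, C)) (W\<^sub>b (A, B, C)) (\<eta> (A, B, C)) (\<epsilon> (A, B, C)) \<and>
       strict_sym_mon_functor (PermHom (A \<otimes> B) C) (PermHom A (PermHom B C)) (W (A, B, C)) \<and>
       sym_mon_functor (PermHom A (PermHom B C)) (PermHom (A \<otimes> B) C) (W\<^sub>b (A, B, C))) \<and>
    two_natural (op2 PermCat \<times>\<^sub>2 op2 PermCat \<times>\<^sub>2 PermCat)
      PermCat_tensor PermCat_iterated (\<lambda>x. underlying_func (W x)) \<and>
    two_natural (op2 PermCat \<times>\<^sub>2 op2 PermCat \<times>\<^sub>2 StrictPermCat)
      PermCat_iterated PermCat_tensor (\<lambda>x. underlying_func (W\<^sub>b x)) \<and>
    pseudonatural (op2 PermCat \<times>\<^sub>2 op2 PermCat \<times>\<^sub>2 PermCat)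
      PermCat_iterated PermCat_tensor (\<lambda>x. underlying_func (W\<^sub>b x)) \<omega> \<and>
    (\<forall>x \<in> Cell0 (op2 PermCat \<times>\<^sub>2 op2 PermCat \<times>\<^sub>2 StrictPermCat).
     \<forall>y \<in> Cell0 (op2 PermCat \<times>\<^sub>2 op2 PermCat \<times>\<^sub>2 StrictPermCat).
     \<forall>f \<in> Obj (HomCat (op2 PermCat \<times>\<^sub>2 op2 PermCat \<times>\<^sub>2 StrictPermCat) x y).
     \<forall>Q \<in> Obj (on0 PermCat_iterated x).
       \<omega> x y f Q = \<one>\<^bsub>on0 PermCat_tensor y\<^esub> (fo (W\<^sub>b y) (fo (on1 PermCat_iterated x y f) Q)))"
proof (intro exI conjI allI impI ballI)
  fix A :: "('oa, 'ma) pcat" and B :: "('ob, 'mb) pcat" and C :: "('oc, 'mc) pcat"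
  assume "permutative A \<and> permutative B \<and> permutative C"
  then have p: "perm3 A B C" by (simp add: perm3_def)
  \<comment> \<open>The existential witnesses are fixed by unification with this statement. The unit
    and counit are therefore written as functions applied to (A, B, C), so that they are found as
    functions of the triple.\<close>
  show "adjoint_equivalence (PermHom (A \<otimes> B) C) (PermHom A (PermHom B C)) (curry_smf (A, B, C)) (uncurry_smf (A, B, C))
      ((\<lambda>(A, B, C) P. perm3.lift A B C P (perm3.Ro A B C (perm3.Wo A B C P)) (mt_id A (PermHom B C) (perm3.Wo A B C P))) (A, B, C))
      ((\<lambda>(A, B, C). mt_id A (PermHom B C)) (A, B, C))"
    using perm3.W_R_adjoint_equivalence[OF p] by (simp add: curry_smf_simps)
  show "strict_sym_mon_functor (PermHom (A \<otimes> B) C) (PermHom A (PermHom B C)) (curry_smf (A, B, C))"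
    using perm3.W_strict[OF p] by (simp add: curry_smf_simps)
  show "sym_mon_functor (PermHom A (PermHom B C)) (PermHom (A \<otimes> B) C) (uncurry_smf (A, B, C))"
    using perm3.R_smf[OF p] by (simp add: curry_smf_simps)
next
  fix x y :: "('oa, 'ma, 'ob, 'mb, 'oc, 'mc) triple0" and f Q
  assume *: "x \<in> Cell0 strict_triples" "y \<in> Cell0 strict_triples" "f \<in> Obj (HomCat strict_triples x y)"
    "Q \<in> Obj (on0 PermCat_iterated x)"
  obtain A B C A' B' C' F G K where x: "x = (A, B, C)" "y = (A', B', C')" "f = (F, G, K)" by (cases x, cases y, cases f)
  note p = triples_perm[OF *(1,2)[unfolded x Cell0_strict_triples]]
  from * have K: "sym_mon_functor C C' K" by (simp add: x strict_triples_simps strict_sym_mon_functor_def)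
  from * show "uncurry_constraint x y f Q = \<one>\<^bsub>on0 PermCat_tensor y\<^esub> (fo (uncurry_smf y) (fo (on1 PermCat_iterated x y f) Q))"
    using perm_six.omega_strict[OF p(1), of F G K Q] perm_six.right1_simps(1)[OF p(1) _ _ K, of F G Q]
    by (simp add: x strict_triples_simps two_functor_simps curry_smf_simps perm3.R_simps(1)[OF p(3)] del: PermHom1_simps)
qed (rule two_natural_W two_natural_R pseudonatural_R)+

end
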